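(* Let $\mathbb{K}$ be a field, $d\ge1$, and fix $c$ with $c_d<c<d+1$. Then $$\lim_{n\to\infty}\mathbb{P}\big(Y\in Y_d(n,\tfrac{c}{n}): A_Y\text{ fails the WLP}\big)=1.$$
   Context: $c_1=1$, and for $d>1$, $c_d$ is the unique positive solution of $g_d(x)=d+1$, where $g_d(x)=(d+1)(x+1)e^{-x}+x(1-e^{-x})^{d+1}$ (one has $c_d<d+1$). $Y_d(n,p)$ is the probability space of simplicial complexes $Y$ on vertex set $[n]$ with $\Delta_n^{(d-1)}\subseteq Y\subseteq\Delta_n^{(d)}$, where $\Delta_n^{(k)}$ is the complex of all subsets of $[n]$ of size at most $k+1$, with $\mathbb{P}(Y)=p^{f_d}(1-p)^{\binom{n}{d+1}-f_d}$, $f_d$ the number of $d$-faces of $Y$. $A_Y=\mathbb{K}[x_1,\dots,x_n]/(I_Y+(x_1^{d+2},\dots,x_n^{d+2}))$ with $I_Y$ the Stanley–Reisner ideal of $Y$. An artinian graded algebra $A$ with top nonzero degree $D$ has the weak Lefschetz property (WLP) if there is a linear form $\ell$ with $\times\ell:A_i\to A_{i+1}$ of full rank for all $i<D$. *)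

theory Defs
  imports Complex_Main
begin

definition g_fun :: "nat \<Rightarrow> real \<Rightarrow> real" where
  "g_fun d x = real (d+1) * (x+1) * exp (-x) + x * (1 - exp (-x)) ^ (d+1)"

definition c_const :: "nat \<Rightarrow> real" where
  "c_const d = (if d = 1 then 1 else (THE x. x > 0 \<and> g_fun d x = real (d+1)))"

definition dfaces :: "nat \<Rightarrow> nat \<Rightarrow> nat set set" where
  "dfaces n d = {\<sigma>. \<sigma> \<subseteq> {..<n} \<and> card \<sigma> = d+1}"

text \<open>The complex Y determined by its set F of d-faces:
  Delta_n^(d-1) \<union> F.  A set is a face iff it is a vertex subset of size \<le> d, or lies in F.\<close>
definition is_face :: "nat \<Rightarrow> nat \<Rightarrow> nat set set \<Rightarrow> nat set \<Rightarrow> bool" where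
  "is_face n d F \<sigma> \<longleftrightarrow> \<sigma> \<subseteq> {..<n} \<and> (card \<sigma> \<le> d \<or> (card \<sigma> = d+1 \<and> \<sigma> \<in> F))"

text \<open>Standard monomials (exponent vectors) of
  A_Y = K[x_0..x_(n-1)] / (I_Y + (x_i^(d+2))): exponents \<le> d+1 and support a face of Y.
  These form a K-basis of A_Y; those of degree i form a basis of (A_Y)_i.\<close>
definition std_mono :: "nat \<Rightarrow> nat \<Rightarrow> nat set set \<Rightarrow> (nat \<Rightarrow> nat) \<Rightarrow> bool" where
  "std_mono n d F m \<longleftrightarrow> (\<forall>j\<ge>n. m j = 0) \<and> (\<forall>j. m j \<le> d+1) \<and> is_face n d F {j. 0 < m j}"

definition mono_basis :: "nat \<Rightarrow> nat \<Rightarrow> nat set set \<Rightarrow> nat \<Rightarrow> (nat \<Rightarrow> nat) set" where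
  "mono_basis n d F i = {m. std_mono n d F m \<and> (\<Sum>j<n. m j) = i}"

text \<open>(A_Y)_i as coordinate vectors on the monomial basis.\<close>
definition graded_piece :: "nat \<Rightarrow> nat \<Rightarrow> nat set set \<Rightarrow> nat \<Rightarrow> ((nat \<Rightarrow> nat) \<Rightarrow> 'k::field) set" where
  "graded_piece n d F i = {v. \<forall>m. m \<notin> mono_basis n d F i \<longrightarrow> v m = 0}"

text \<open>Multiplication by the linear form l = \<Sum>_j a_j x_j, as a map (A_Y)_i \<rightarrow> (A_Y)_(i+1).\<close>
definition mult_lin :: "nat \<Rightarrow> nat \<Rightarrow> nat set set \<Rightarrow> nat \<Rightarrow> (nat \<Rightarrow> 'k::field)
    \<Rightarrow> ((nat \<Rightarrow> nat) \<Rightarrow> 'k) \<Rightarrow> ((nat \<Rightarrow> nat) \<Rightarrow> 'k)" where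
  "mult_lin n d F i a v = (\<lambda>m'. if m' \<in> mono_basis n d F (Suc i) then
      (\<Sum>j<n. if 0 < m' j \<and> m'(j := m' j - 1) \<in> mono_basis n d F i
               then a j * v (m'(j := m' j - 1)) else 0)
      else 0)"

definition full_rank_step :: "nat \<Rightarrow> nat \<Rightarrow> nat set set \<Rightarrow> nat \<Rightarrow> (nat \<Rightarrow> 'k::field) \<Rightarrow> bool" where
  "full_rank_step n d F i a \<longleftrightarrow>
     inj_on (mult_lin n d F i a) (graded_piece n d F i)
     \<or> mult_lin n d F i a ` (graded_piece n d F i) = (graded_piece n d F (Suc i) :: ((nat \<Rightarrow> nat) \<Rightarrow> 'k) set)"

definition top_degree :: "nat \<Rightarrow> nat \<Rightarrow> nat set set \<Rightarrow> nat" where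
  "top_degree n d F = Max {i. mono_basis n d F i \<noteq> {}}"

definition has_WLP :: "'k::field itself \<Rightarrow> nat \<Rightarrow> nat \<Rightarrow> nat set set \<Rightarrow> bool" where
  "has_WLP K n d F \<longleftrightarrow> (\<exists>a :: nat \<Rightarrow> 'k. \<forall>i < top_degree n d F. full_rank_step n d F i a)"

definition Yprob :: "nat \<Rightarrow> nat \<Rightarrow> real \<Rightarrow> (nat set set \<Rightarrow> bool) \<Rightarrow> real" where
  "Yprob n d p P = (\<Sum>F \<in> Pow (dfaces n d).
      if P F then p ^ card F * (1 - p) ^ (card (dfaces n d) - card F) else 0)"

end

theory Submission
  imports Defs "HOL-Library.FuncSet"
begin

text \<open>The property fails in the step from degree \<open>2 + \<dots> + (d + 1)\<close> to degree \<open>1 + \<dots> + (d + 1)\<close>, for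
  every linear form. A \<open>(d - 1)\<close>-face lying in no \<open>d\<close>-face supports an alternating sum of monomials
  which is annihilated by the linear form, so the map is not injective. A \<open>d\<close>-cycle of the complex
  (twisted by the coefficients of the form) gives a functional which vanishes on the image, so the map
  is not surjective.

  Both configurations occur with high probability. The number of uncovered \<open>(d - 1)\<close>-faces is of order
  \<open>exp (- c) * (n choose d)\<close>. For \<open>d \<ge> 2\<close>, cycles are found by counting: the \<open>d\<close>-faces all of whose facets
  have degree at least 2 outnumber the \<open>(d - 1)\<close>-faces of degree at least 2, because the difference has
  expectation asymptotic to \<open>(g_fun d c - (d + 1)) / (d + 1) * (n choose d)\<close>. All these counts change by
  a bounded amount when one \<open>d\<close>-face is added, so their variances are small. For \<open>d = 1\<close>, the second moment
  method for graph cycles of a fixed length \<open>k\<close> bounds the probability of a forest by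
  \<open>k^2 / c^k + o(1)\<close>.\<close>

section \<open>Alternating products of signs\<close>

text \<open>The form is arbitrary: coefficients may vanish, so it cannot always be rescaled to the
  sum of the variables. Hence the weights \<open>w\<close> on the boundary and the set
  \<open>S\<close> of vertices with zero coefficient. The random input is purely combinatorial (a
  count of faces, a cycle in a graph), so one event serves all forms and all fields; the signs 1 and
  -1 survive in every characteristic. The degree comes from the relations
  \<open>x_j^(d+2) = 0\<close>. The cancellation behind the kernel needs distinct exponents on d
  vertices that run up to the cap d + 1; the one behind the functional needs all of 1, ..., d + 1 on
  d + 1 vertices. These two degrees are consecutive. The function g_d measures unknowns minus
  equations. For d = 1 this count is too weak: g_1(1) < 2, so just above c_1 = 1 the expected
  difference is eventually negative. Graphs gain one linear dependency among the equations, so a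
  single cycle suffices; the bound on its absence vanishes only when k grows after n.\<close>

definition alt_sign :: "nat set \<Rightarrow> (nat \<Rightarrow> int) \<Rightarrow> int" where
  "alt_sign A f = (\<Prod>(i,j) \<in> {(i,j). i \<in> A \<and> j \<in> A \<and> i < j}. sgn (f j - f i))"

lemma finite_less_pairs: "finite A \<Longrightarrow> finite {(i,j). i \<in> A \<and> j \<in> A \<and> i < (j::nat)}"
  by (rule finite_subset[of _ "A \<times> A"]) auto

lemma alt_sign_cong: "(\<And>i. i \<in> A \<Longrightarrow> f i = g i) \<Longrightarrow> alt_sign A f = alt_sign A g"
  unfolding alt_sign_def by (rule prod.cong) auto

text \<open>\<open>alt_sign\<close> is the sign of a Vandermonde product, hence of the permutation
  that sorts \<open>f\<close>; a repeated value makes one factor zero. This zero allows sums over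
  all monomials instead of only those with distinct exponents.\<close>

lemma alt_sign_eq_0_iff:
  assumes "finite A"
  shows "alt_sign A f = 0 \<longleftrightarrow> \<not> inj_on f A"
proof -
  have "alt_sign A f = 0 \<longleftrightarrow> (\<exists>i\<in>A. \<exists>j\<in>A. i < j \<and> f i = f j)"
    unfolding alt_sign_def
    by (subst prod_zero_iff[OF finite_less_pairs[OF assms]]) (force simp: sgn_0_0)
  also have "\<dots> \<longleftrightarrow> \<not> inj_on f A"
  proof
    assume "\<exists>i\<in>A. \<exists>j\<in>A. i < j \<and> f i = f j"
    then show "\<not> inj_on f A" unfolding inj_on_def by (metis less_irrefl)
  next
    assume "\<not> inj_on f A"
    then obtain i j where "i \<in> A" "j \<in> A" "f i = f j" "i \<noteq> j" unfolding inj_on_def by blast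
    then show "\<exists>i\<in>A. \<exists>j\<in>A. i < j \<and> f i = f j" by (metis linorder_neqE_nat)
  qed
  finally show ?thesis .
qed

lemma abs_alt_sign_eq_1:
  assumes "finite A" and "inj_on f A"
  shows "\<bar>alt_sign A f\<bar> = 1"
proof -
  have *: "\<bar>prod g P\<bar> = 1" if "\<And>x. x \<in> P \<Longrightarrow> \<bar>g x\<bar> = 1" for g :: "nat \<times> nat \<Rightarrow> int" and P
    using that by (induction P rule: infinite_finite_induct) (auto simp: abs_mult)
  show ?thesis
    unfolding alt_sign_def
    by (rule *) (use assms(2) in \<open>force simp: abs_sgn_eq inj_on_def\<close>)
qed

lemma of_int_alt_sign_neq_0:
  assumes "finite A" and "inj_on f A"
  shows "(of_int (alt_sign A f) :: 'k::ring_1_no_zero_divisors) \<noteq> 0"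
proof -
  have "\<bar>alt_sign A f\<bar> = 1" by (rule abs_alt_sign_eq_1[OF assms])
  then have "alt_sign A f = 1 \<or> alt_sign A f = -1" by linarith
  then show ?thesis by auto
qed

text \<open>Raising \<open>u\<close> or raising \<open>v\<close> gives two functions that differ by
  exchanging the values at \<open>u\<close> and \<open>v\<close>, so their signs are opposite. The
  two values are consecutive integers: any third value lies on the same side of both, and only the
  factor of the pair \<open>u\<close>, \<open>v\<close> changes.\<close>

lemma alt_sign_bump:
  fixes f :: "nat \<Rightarrow> int"
  assumes A: "finite A" and u: "u \<in> A" and v: "v \<in> A" and uv: "u \<noteq> v" and eq: "f u = f v"
    and e: "\<bar>e\<bar> = 1"
  shows "alt_sign A (f(u := f u + e)) = - alt_sign A (f(v := f v + e))"
\<comment> \<open>A third index carrying one of the two values causes a collision on both sides, and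
  both signs are zero.\<close>
proof (cases "\<exists>w\<in>A - {u,v}. f w = f u \<or> f w = f u + e")
  case True
  then obtain w where w: "w \<in> A" "w \<noteq> u" "w \<noteq> v" "f w = f u \<or> f w = f u + e" by auto
  from w(4) have "\<not> inj_on (f(u := f u + e)) A \<and> \<not> inj_on (f(v := f v + e)) A"
  proof
    assume "f w = f u"
    then have "(f(u := f u + e)) w = (f(u := f u + e)) v" "(f(v := f v + e)) w = (f(v := f v + e)) u"
      using w uv eq by auto
    then show ?thesis using w u v unfolding inj_on_def by blast
  next
    assume "f w = f u + e"
    then have "(f(u := f u + e)) w = (f(u := f u + e)) u" "(f(v := f v + e)) w = (f(v := f v + e)) v"
      using w uv eq by auto
    then show ?thesis using w u v unfolding inj_on_def by blast
  qed
  then have "alt_sign A (f(u := f u + e)) = 0" "alt_sign A (f(v := f v + e)) = 0"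
    using alt_sign_eq_0_iff[OF A] by blast+
  then show ?thesis by linarith
next
  case False
  let ?P = "{(i,j). i \<in> A \<and> j \<in> A \<and> i < j}"
  let ?p = "(min u v, max u v)"
  let ?F = "\<lambda>g. \<lambda>(i,j). sgn (g j - g i :: int)"
  let ?g = "f(u := f u + e)" and ?h = "f(v := f v + e)"
  have fin: "finite ?P" by (rule finite_less_pairs[OF A])
  have pin: "?p \<in> ?P" using u v uv by (auto simp: min_def max_def)
  have step: "sgn (f u + e - f w) = sgn (f u - f w)" "sgn (f w - (f u + e)) = sgn (f w - f u)"
    if "w \<in> A" "w \<noteq> u" "w \<noteq> v" for w
  proof -
    have "f w \<noteq> f u" "f w \<noteq> f u + e" using False that by auto
    then show "sgn (f u + e - f w) = sgn (f u - f w)" "sgn (f w - (f u + e)) = sgn (f w - f u)"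
      using e by (auto simp: sgn_if)
  qed
  have rest: "(\<Prod>x\<in>?P - {?p}. ?F ?g x) = (\<Prod>x\<in>?P - {?p}. ?F ?h x)"
  proof (rule prod.cong[OF refl])
    fix x assume x: "x \<in> ?P - {?p}"
    obtain i j where ij: "x = (i,j)" by (cases x)
    have "i \<in> A" "j \<in> A" "i < j" and n: "\<not> (i = u \<and> j = v)" "\<not> (i = v \<and> j = u)"
      using x by (auto simp: ij)
    then consider "i = u" "j \<noteq> u" "j \<noteq> v" | "i = v" "j \<noteq> u" "j \<noteq> v" | "j = u" "i \<noteq> u" "i \<noteq> v"
      | "j = v" "i \<noteq> u" "i \<noteq> v" | "i \<noteq> u" "i \<noteq> v" "j \<noteq> u" "j \<noteq> v"
      by blast
    then show "?F ?g x = ?F ?h x"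
      by cases (use step[OF \<open>i \<in> A\<close>] step[OF \<open>j \<in> A\<close>] uv eq ij in simp_all)
  qed
  have p: "?F ?g ?p = - ?F ?h ?p"
  proof (cases "u < v")
    case True
    then have "?F ?g ?p = sgn (f v - (f u + e))" "?F ?h ?p = sgn (f v + e - f u)"
      by (simp_all add: min_def max_def)
    moreover have "sgn (f v - (f u + e)) = - sgn (f v + e - f u)" using eq e by (simp add: sgn_if)
    ultimately show ?thesis by presburger
  next
    case False
    then have "?F ?g ?p = sgn (f u + e - f v)" "?F ?h ?p = sgn (f u - (f v + e))"
      using uv by (simp_all add: min_def max_def)
    moreover have "sgn (f u + e - f v) = - sgn (f u - (f v + e))" using eq e by (simp add: sgn_if)
    ultimately show ?thesis by presburger
  qed
  have "prod (?F ?g) ?P = ?F ?g ?p * prod (?F ?g) (?P - {?p})"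
    "prod (?F ?h) ?P = ?F ?h ?p * prod (?F ?h) (?P - {?p})"
    by (rule prod.remove[OF fin pin])+
  then have "prod (?F ?g) ?P = - prod (?F ?h) ?P" by (simp only: p rest mult_minus_left)
  then show ?thesis unfolding alt_sign_def .
qed

text \<open>At most two terms survive. If the bump at \<open>j\<close> removes all collisions, the
  value of \<open>j\<close> was shared with some \<open>u\<close>, which \<open>H\<close> places
  inside \<open>T\<close>; every other bump leaves \<open>j\<close> and \<open>u\<close> in
  collision, and the terms of \<open>j\<close> and \<open>u\<close> cancel.\<close>

lemma alt_sign_sum_eq_0:
  assumes A: "finite A" and T: "T \<subseteq> A" and e: "\<bar>e\<bar> = 1"
    and H: "\<And>j. j \<in> T \<Longrightarrow> inj_on (f(j := f j + e)) A \<Longrightarrow> \<exists>u\<in>T. u \<noteq> j \<and> f u = f j"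
  shows "(\<Sum>j\<in>T. alt_sign A (f(j := f j + e))) = 0"
proof (cases "\<exists>j\<in>T. alt_sign A (f(j := f j + e)) \<noteq> 0")
  case False
  then show ?thesis by simp
next
  case True
  then obtain j where j: "j \<in> T" "alt_sign A (f(j := f j + e)) \<noteq> 0" by blast
  obtain u where u: "u \<in> T" "u \<noteq> j" "f u = f j"
    using H[OF j(1)] j(2) alt_sign_eq_0_iff[OF A] by blast
  have fT: "finite T" using A T finite_subset by blast
  have "(\<Sum>w\<in>T. alt_sign A (f(w := f w + e))) = (\<Sum>w\<in>{j,u}. alt_sign A (f(w := f w + e)))"
  proof (rule sum.mono_neutral_right[OF fT])
    show "{j,u} \<subseteq> T" using j u by auto
    show "\<forall>w\<in>T - {j,u}. alt_sign A (f(w := f w + e)) = 0"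
    proof
      fix w assume "w \<in> T - {j,u}"
      then have "(f(w := f w + e)) u = (f(w := f w + e)) j" using u by auto
      then have "\<not> inj_on (f(w := f w + e)) A"
        using u j T unfolding inj_on_def by (meson subsetD)
      then show "alt_sign A (f(w := f w + e)) = 0" using alt_sign_eq_0_iff[OF A] by blast
    qed
  qed
  also have "\<dots> = 0"
    using u j T alt_sign_bump[OF A, of u j f e] e by (auto simp: subset_iff)
  finally show ?thesis .
qed

text \<open>Pairs with \<open>j\<close> contribute -1 for each smaller index and 1 for each larger
  one. In this way the sign of the simplicial boundary arises from the sign of the
  exponents.\<close>

lemma alt_sign_insert_min:
  assumes A: "finite A" and j: "j \<notin> A" and less: "\<And>i. i \<in> A \<Longrightarrow> f j < f i"
  shows "alt_sign (insert j A) f = (-1) ^ card {i\<in>A. i < j} * alt_sign A f"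
proof -
  let ?P = "{(i,k). i \<in> A \<and> k \<in> A \<and> i < k}"
  let ?L = "(\<lambda>i. (i,j)) ` {i\<in>A. i < j}" and ?R = "(\<lambda>i. (j,i)) ` {i\<in>A. j < i}"
  let ?F = "\<lambda>(i,k). sgn (f k - f i)"
  have split: "{(i,k). i \<in> insert j A \<and> k \<in> insert j A \<and> i < k} = ?L \<union> (?R \<union> ?P)"
    using j by auto
  have fin: "finite ?L" "finite ?R" "finite ?P" using A finite_less_pairs[OF A] by auto
  have L: "prod ?F ?L = (-1) ^ card {i\<in>A. i < j}"
  proof -
    have "prod ?F ?L = (\<Prod>i\<in>{i\<in>A. i < j}. sgn (f j - f i))"
      by (subst prod.reindex) (auto simp: inj_on_def)
    also have "\<dots> = (\<Prod>i\<in>{i\<in>A. i < j}. -1)" by (rule prod.cong) (use less in auto)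
    finally show ?thesis by simp
  qed
  have R: "prod ?F ?R = 1"
  proof -
    have "prod ?F ?R = (\<Prod>i\<in>{i\<in>A. j < i}. sgn (f i - f j))"
      by (subst prod.reindex) (auto simp: inj_on_def)
    also have "\<dots> = (\<Prod>i\<in>{i\<in>A. j < i}. 1)" by (rule prod.cong) (use less in auto)
    finally show ?thesis by simp
  qed
  have d: "?R \<inter> ?P = {}" "?L \<inter> (?R \<union> ?P) = {}" using j by auto
  have "alt_sign (insert j A) f = prod ?F (?L \<union> (?R \<union> ?P))"
    unfolding alt_sign_def split ..
  also have "\<dots> = prod ?F ?L * prod ?F (?R \<union> ?P)"
    by (rule prod.union_disjoint[OF fin(1) finite_UnI[OF fin(2,3)] d(2)])
  also have "prod ?F (?R \<union> ?P) = prod ?F ?R * prod ?F ?P"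
    by (rule prod.union_disjoint[OF fin(2,3) d(1)])
  finally show ?thesis unfolding L R alt_sign_def by simp
qed

section \<open>Enumerations and homogeneous linear systems\<close>

lemma ex_bij_initial:
  assumes "finite A" and "S \<subseteq> A"
  shows "\<exists>h. bij_betw h A {0..<card A} \<and> (\<forall>j\<in>S. h j < card S) \<and> (\<forall>j\<in>A - S. card S \<le> h j)"
proof -
  have fS: "finite S" using assms finite_subset by blast
  obtain h1 where h1: "bij_betw h1 S {0..<card S}" using ex_bij_betw_finite_nat[OF fS] by blast
  obtain h2 where h2: "bij_betw h2 (A - S) {0..<card (A - S)}"
    using ex_bij_betw_finite_nat assms(1) by blast
  define h where "h = (\<lambda>j. if j \<in> S then h1 j else card S + h2 j)"
  have c: "card A = card S + card (A - S)"
    using assms fS by (metis card_Diff_subset card_mono le_add_diff_inverse)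
  have "bij_betw h S {0..<card S}"
    using h1 by (subst bij_betw_cong[of _ _ h1]) (auto simp: h_def)
  moreover have "bij_betw h (A - S) {card S..<card A}"
  proof -
    have "bij_betw ((+) (card S)) {0..<card (A - S)} {card S..<card A}"
      unfolding c using bij_betw_add[of "card S" "{0..<card (A-S)}" "{card S..<card S + card (A-S)}"]
      by (simp add: add.commute)
    from bij_betw_trans[OF h2 this] show ?thesis
      by (subst bij_betw_cong[of _ _ "(+) (card S) \<circ> h2"]) (auto simp: h_def)
  qed
  ultimately have "bij_betw h (S \<union> (A - S)) ({0..<card S} \<union> {card S..<card A})"
    by (rule bij_betw_combine) auto
  then have "bij_betw h A {0..<card A}"
    using assms(2) c by (simp add: ivl_disj_un Un_absorb1)
  moreover have "\<forall>j\<in>S. h j < card S" using h1 by (auto simp: h_def bij_betw_def)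
  moreover have "\<forall>j\<in>A - S. card S \<le> h j" by (auto simp: h_def)
  ultimately show ?thesis by blast
qed

text \<open>Gaussian elimination: equation \<open>q\<close> is solved for an unknown
  \<open>r0\<close> with nonzero coefficient and substituted into the others, which lowers both
  counts by one.\<close>

lemma underdetermined_system:
  fixes W :: "'q \<Rightarrow> 'r \<Rightarrow> 'k::field"
  assumes "finite Q" and "finite R" and "card Q < card R"
  shows "\<exists>z. (\<exists>r\<in>R. z r \<noteq> 0) \<and> (\<forall>q\<in>Q. (\<Sum>r\<in>R. W q r * z r) = 0)"
  using assms
proof (induction Q arbitrary: R W rule: finite_induct)
  case empty
  then obtain r where "r \<in> R" by fastforce
  then show ?case by (intro exI[of _ "\<lambda>_. 1"]) auto
next
  case (insert q Q)
  show ?case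
  proof (cases "\<forall>r\<in>R. W q r = 0")
    case True
    obtain z where "\<exists>r\<in>R. z r \<noteq> 0" "\<forall>q\<in>Q. (\<Sum>r\<in>R. W q r * z r) = 0"
      using insert.IH[of R W] insert.prems insert.hyps by (metis Suc_lessD card_insert_disjoint)
    then show ?thesis using True by (intro exI[of _ z]) auto
  next
    case False
    then obtain r0 where r0: "r0 \<in> R" "W q r0 \<noteq> 0" by blast
    define W' where "W' = (\<lambda>p r. W p r - W p r0 * W q r / W q r0)"
    have "card Q < card (R - {r0})" using insert r0 by simp
    then obtain z where z: "\<exists>r\<in>R - {r0}. z r \<noteq> 0" "\<forall>p\<in>Q. (\<Sum>r\<in>R - {r0}. W' p r * z r) = 0"
      using insert.IH[of "R - {r0}" W'] insert.prems(1) by blast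
    define s where "s = (\<Sum>r\<in>R - {r0}. W q r * z r)"
    define z' where "z' = z(r0 := - s / W q r0)"
    have sum: "(\<Sum>r\<in>R. W p r * z' r) = (\<Sum>r\<in>R - {r0}. W p r * z r) - W p r0 * s / W q r0" for p
    proof -
      have "(\<Sum>r\<in>R - {r0}. W p r * z' r) = (\<Sum>r\<in>R - {r0}. W p r * z r)"
        by (rule sum.cong) (auto simp: z'_def)
      then show ?thesis using r0 insert.prems by (simp add: sum.remove[of R r0] z'_def)
    qed
    have "(\<Sum>r\<in>R. W p r * z' r) = 0" if "p \<in> Q" for p
    proof -
      have "0 = (\<Sum>r\<in>R - {r0}. W p r * z r) - (\<Sum>r\<in>R - {r0}. W p r0 * W q r / W q r0 * z r)"
        using z(2) that unfolding W'_def by (simp add: left_diff_distrib sum_subtractf)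
      also have "(\<Sum>r\<in>R - {r0}. W p r0 * W q r / W q r0 * z r) = W p r0 * s / W q r0"
        unfolding s_def by (simp add: sum_distrib_left sum_divide_distrib mult.assoc)
      finally show ?thesis by (simp add: sum)
    qed
    moreover have "(\<Sum>r\<in>R. W q r * z' r) = 0" using r0 by (simp add: sum s_def)
    moreover have "\<exists>r\<in>R. z' r \<noteq> 0" using z(1) by (auto simp: z'_def)
    ultimately show ?thesis by blast
  qed
qed

section \<open>Failure of injectivity\<close>

lemma mono_basis_iff:
  "m \<in> mono_basis n d F i \<longleftrightarrow> (\<forall>j\<ge>n. m j = 0) \<and> (\<forall>j. m j \<le> d + 1) \<and>
     is_face n d F {j. 0 < m j} \<and> (\<Sum>j<n. m j) = i"
  by (auto simp: mono_basis_def std_mono_def)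

lemma finite_mono_basis: "finite (mono_basis n d F i)"
proof (rule finite_subset)
  show "mono_basis n d F i \<subseteq> {m. \<forall>j. (j \<in> {..<n} \<longrightarrow> m j \<in> {..d+1}) \<and> (j \<notin> {..<n} \<longrightarrow> m j = 0)}"
    by (auto simp: mono_basis_iff)
  show "finite {m. \<forall>j. (j \<in> {..<n} \<longrightarrow> m j \<in> {..d+1}) \<and> (j \<notin> {..<n} \<longrightarrow> m j = 0)}"
    by (rule finite_set_of_finite_funs) auto
qed

text \<open>\<open>Max\<close> is meaningful only on a finite set; the bound
  \<open>n * (d+1)\<close> on the degree of a standard monomial provides this.\<close>

lemma less_top_degree:
  assumes "m \<in> mono_basis n d F (Suc i)"
  shows "i < top_degree n d F"
proof -
  have "{i. mono_basis n d F i \<noteq> {}} \<subseteq> {..n * (d+1)}"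
  proof
    fix i assume "i \<in> {i. mono_basis n d F i \<noteq> {}}"
    then obtain m where "m \<in> mono_basis n d F i" by blast
    then have "\<forall>j. m j \<le> d + 1" "(\<Sum>j<n. m j) = i" by (simp_all add: mono_basis_iff)
    then show "i \<in> {..n * (d+1)}" using sum_bounded_above[of "{..<n}" m "d+1"] by auto
  qed
  then have "finite {i. mono_basis n d F i \<noteq> {}}" using finite_subset by blast
  then have "Suc i \<le> top_degree n d F" unfolding top_degree_def by (rule Max_ge) (use assms in auto)
  then show ?thesis by simp
qed

lemma sum_fun_upd_dec:
  fixes m :: "nat \<Rightarrow> nat"
  assumes "j < n" and "0 < m j" and "(\<Sum>j<n. m j) = Suc i"
  shows "(\<Sum>k<n. (m(j := m j - 1)) k) = i"
proof -
  have "(\<Sum>k\<in>{..<n} - {j}. (m(j := m j - 1)) k) = (\<Sum>k\<in>{..<n} - {j}. m k)"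
    by (rule sum.cong) auto
  then show ?thesis using assms by (simp add: sum.remove[of "{..<n}" j])
qed

lemma sum_fun_upd_inc:
  fixes m :: "nat \<Rightarrow> nat"
  assumes "j < n"
  shows "(\<Sum>k<n. (m(j := m j + 1)) k) = Suc (\<Sum>k<n. m k)"
proof -
  have "(\<Sum>k\<in>{..<n} - {j}. (m(j := m j + 1)) k) = (\<Sum>k\<in>{..<n} - {j}. m k)"
    by (rule sum.cong) auto
  then show ?thesis using assms by (simp add: sum.remove[of "{..<n}" j])
qed

text \<open>Provides the monomials that witness nonvanishing: with \<open>b = 2\<close> for the
  kernel element, and with \<open>b = 1\<close> and the vertices of nonzero coefficient as initial
  set for the functional.\<close>

lemma ex_exponents:
  fixes A S :: "nat set"
  assumes "finite A" and "S \<subseteq> A"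
  obtains m where "\<And>j. j \<notin> A \<Longrightarrow> m j = 0" and "bij_betw m A {b..<b + card A}"
    and "\<And>j. j \<in> S \<Longrightarrow> m j < b + card S" and "\<And>j. j \<in> A - S \<Longrightarrow> b + card S \<le> m j"
proof -
  obtain h where h: "bij_betw h A {0..<card A}" "\<forall>j\<in>S. h j < card S" "\<forall>j\<in>A - S. card S \<le> h j"
    using ex_bij_initial[OF assms] by blast
  define m where "m = (\<lambda>j. if j \<in> A then b + h j else 0)"
  have "bij_betw ((+) b) {0..<card A} {b..<b + card A}"
    using bij_betw_add[of b "{0..<card A}" "{b..<b + card A}"] by (simp add: add.commute)
  from bij_betw_trans[OF h(1) this] have "bij_betw m A {b..<b + card A}"
    by (subst bij_betw_cong[of _ _ "(+) b \<circ> h"]) (auto simp: m_def)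
  then show ?thesis using h assms by (intro that[of m]) (auto simp: m_def)
qed

lemma sum_exponents:
  fixes m :: "nat \<Rightarrow> nat"
  assumes "A \<subseteq> {..<n}" and "\<And>j. j \<notin> A \<Longrightarrow> m j = 0" and "bij_betw m A B"
  shows "(\<Sum>j<n. m j) = \<Sum>B"
proof -
  have "(\<Sum>j<n. m j) = (\<Sum>j\<in>A. m j)"
    by (rule sum.mono_neutral_right) (use assms in auto)
  also have "\<dots> = \<Sum>B" using sum.reindex_bij_betw[OF assms(3), of "\<lambda>x. x"] by simp
  finally show ?thesis .
qed

text \<open>The kernel element is the alternating sum of the monomials on the uncovered face whose
  exponents are a permutation of \<open>2, \<dots>, d + 1\<close>. Where the linear form has vanishing coefficients
  (the set \<open>S\<close>), the exponents \<open>2, \<dots>, card S + 1\<close> are reserved for \<open>S\<close>, so that cancelling pairs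
  lie outside \<open>S\<close>.\<close>

lemma mult_lin_not_inj:
  fixes a :: "nat \<Rightarrow> 'k::field"
  assumes \<tau>: "\<tau> \<subseteq> {..<n}" "card \<tau> = d" and free: "\<And>\<sigma>. \<sigma> \<in> F \<Longrightarrow> \<not> \<tau> \<subseteq> \<sigma>"
  shows "\<not> inj_on (mult_lin n d F (\<Sum>{2..<d+2}) a) (graded_piece n d F (\<Sum>{2..<d+2}))"
proof
  let ?I = "\<Sum>{2..<d+2}"
  let ?B = "mono_basis n d F ?I" and ?B' = "mono_basis n d F (Suc ?I)"
  define S where "S = {j\<in>\<tau>. a j = 0}"
  define T where "T = \<tau> - S"
  have fin: "finite \<tau>" using \<tau>(1) finite_subset by blast
  have S: "S \<subseteq> \<tau>" "finite S" using fin by (auto simp: S_def)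
  have T: "T \<subseteq> \<tau>" "finite T" using fin by (auto simp: T_def)
  \<comment> \<open>\<open>K\<close> demands neither distinct exponents nor the cap
    \<open>d + 1\<close>: the sign and membership in the basis take care of these.\<close>
  define K where "K = (\<lambda>m. (\<forall>j. j \<notin> \<tau> \<longrightarrow> m j = 0) \<and> (\<forall>j\<in>\<tau>. 2 \<le> m j) \<and> (\<forall>j\<in>S. m j < 2 + card S))"
  define \<kappa> where "\<kappa> = (\<lambda>m. if m \<in> ?B \<and> K m
     then of_int (alt_sign \<tau> (\<lambda>j. int (m j))) * (\<Prod>j\<in>T. a j ^ m j) else 0 :: 'k)"
  have face: "is_face n d F {j. 0 < m j}" if "K m" for m
  proof -
    have "{j. 0 < m j} = \<tau>"
    proof (intro set_eqI iffI; clarsimp)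
      fix x assume "0 < m x"
      then show "x \<in> \<tau>" using that unfolding K_def by (metis less_irrefl)
    next
      fix x assume "x \<in> \<tau>"
      then have "2 \<le> m x" using that unfolding K_def by blast
      then show "0 < m x" by simp
    qed
    then show ?thesis using \<tau> by (simp add: is_face_def)
  qed
  have "mult_lin n d F ?I a \<kappa> m' = 0" if m': "m' \<in> ?B'" for m'
  proof -
    let ?m = "\<lambda>j. m'(j := m' j - 1)"
    define f where "f = (\<lambda>j. int (m' j))"
    have val: "mult_lin n d F ?I a \<kappa> m' = (\<Sum>j<n. if 0 < m' j \<and> ?m j \<in> ?B then a j * \<kappa> (?m j) else 0)"
      using m' by (simp add: mult_lin_def)
    show ?thesis
    proof (cases "K m'")
      case False
      have "(if 0 < m' j \<and> ?m j \<in> ?B then a j * \<kappa> (?m j) else 0) = 0" for j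
      proof (rule ccontr)
        assume "\<not> ?thesis"
        then have j: "0 < m' j" "a j \<noteq> 0" "K (?m j)" by (auto simp: \<kappa>_def split: if_splits)
        have "j \<notin> S" using j(2) by (auto simp: S_def)
        \<comment> \<open>Were the variable outside \<open>\<tau>\<close>, the support of
          \<open>m'\<close> would be a \<open>d\<close>-face containing \<open>\<tau>\<close>, and
          \<open>\<tau>\<close> is uncovered.\<close>
        have "j \<in> \<tau>"
        proof (rule ccontr)
          assume n: "j \<notin> \<tau>"
          have *: "m' x = (if x \<in> \<tau> then ?m j x else if x = j then m' j else 0)" for x
            using j(3) n unfolding K_def by (auto simp: fun_upd_def split: if_splits)
          have "{x. 0 < m' x} = insert j \<tau>"
          proof (intro set_eqI iffI; clarsimp)
            fix x assume "0 < m' x" "x \<notin> \<tau>"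
            then show "x = j" using *[of x] by (auto split: if_splits)
          next
            fix x assume "x = j \<or> x \<in> \<tau>"
            then show "0 < m' x"
            proof
              assume x: "x \<in> \<tau>"
              then have "2 \<le> ?m j x" using j(3) unfolding K_def by blast
              then show ?thesis using *[of x] x by simp
            qed (use j in simp)
          qed
          then have "is_face n d F (insert j \<tau>)" using m' by (simp add: mono_basis_iff)
          then show False using free[of "insert j \<tau>"] n \<tau> fin by (auto simp: is_face_def)
        qed
        have "K m'"
          unfolding K_def
        proof (intro conjI allI ballI impI)
          fix x assume "x \<notin> \<tau>"
          then have "?m j x = 0" "x \<noteq> j" using j(3) \<open>j \<in> \<tau>\<close> unfolding K_def by blast+
          then show "m' x = 0" by simp
        next
          fix x assume "x \<in> \<tau>"
          then have "2 \<le> ?m j x" using j(3) unfolding K_def by blast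
          then show "2 \<le> m' x" by (auto split: if_splits)
        next
          fix x assume "x \<in> S"
          then have "?m j x < 2 + card S" "x \<noteq> j" using j(3) \<open>j \<notin> S\<close> unfolding K_def by blast+
          then show "m' x < 2 + card S" by simp
        qed
        then show False using False by simp
      qed
      then show ?thesis unfolding val by simp
    next
      case True
      \<comment> \<open>Lowering an exponent 2 leaves \<open>K\<close>, and indices in
        \<open>S\<close> have coefficient 0, so only \<open>T'\<close> contributes. There the factor
        \<open>a j\<close> restores the lost power, and \<open>C\<close> is common to all
        terms.\<close>
      define T' where "T' = {j\<in>T. 3 \<le> m' j}"
      define C where "C = (\<Prod>j\<in>T. a j ^ m' j)"
      have sub: "T' \<subseteq> {..<n}" using T \<tau> by (auto simp: T'_def)
      have "(if 0 < m' j \<and> ?m j \<in> ?B then a j * \<kappa> (?m j) else 0)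
          = (if j \<in> T' then C * of_int (alt_sign \<tau> (f(j := f j + (-1)))) else 0)" if "j < n" for j
      proof (cases "j \<in> T'")
        case False
        have "a j * \<kappa> (?m j) = 0" if "0 < m' j"
        proof (cases "K (?m j)")
          case Kj: True
          have "j \<in> \<tau>" using True that unfolding K_def by (metis less_irrefl)
          then have "2 \<le> ?m j j" using Kj unfolding K_def by blast
          then have "j \<notin> T" using False by (auto simp: T'_def)
          then show ?thesis using \<open>j \<in> \<tau>\<close> by (auto simp: T_def S_def)
        qed (simp add: \<kappa>_def)
        then show ?thesis using False by auto
      next
        case j: True
        then have jT: "j \<in> T" and m3: "3 \<le> m' j" by (auto simp: T'_def)
        have Km: "K (?m j)"
          unfolding K_def
        proof (intro conjI allI ballI impI)
          fix x assume "x \<notin> \<tau>"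
          then show "?m j x = 0" using True jT T unfolding K_def by (auto simp: subset_iff)
        next
          fix x assume "x \<in> \<tau>"
          then show "2 \<le> ?m j x" using True m3 unfolding K_def by auto
        next
          fix x assume "x \<in> S"
          then have "x \<noteq> j" using jT by (auto simp: T_def)
          then show "?m j x < 2 + card S" using True \<open>x \<in> S\<close> unfolding K_def by auto
        qed
        have "?m j \<in> ?B"
          unfolding mono_basis_iff
          using m' sum_fun_upd_dec[of j n m' ?I] face[OF Km] m3 \<open>j < n\<close>
          by (auto simp: mono_basis_iff) (metis Suc_pred diff_le_self le_trans)+
        moreover have "(\<lambda>x. int (?m j x)) = f(j := f j + (-1))"
          using m3 by (auto simp: f_def of_nat_diff)
        moreover have "a j * (\<Prod>x\<in>T. a x ^ ?m j x) = C"
        proof -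
          have "(\<Prod>x\<in>T - {j}. a x ^ ?m j x) = (\<Prod>x\<in>T - {j}. a x ^ m' x)"
            by (rule prod.cong) auto
          then show ?thesis using m3 unfolding C_def
            by (simp add: prod.remove[OF T(2) jT] power_eq_if[of _ "m' j"] mult.assoc)
        qed
        ultimately show ?thesis using j m3 Km by (simp add: \<kappa>_def mult_ac)
      qed
      then have "mult_lin n d F ?I a \<kappa> m' =
          (\<Sum>j<n. if j \<in> T' then C * of_int (alt_sign \<tau> (f(j := f j + (-1)))) else 0)"
        unfolding val by (intro sum.cong) auto
      also have "\<dots> = (\<Sum>j\<in>T'. C * of_int (alt_sign \<tau> (f(j := f j + (-1)))))"
        using sub by (simp add: sum.If_cases Int_absorb1)
      also have "\<dots> = C * of_int (\<Sum>j\<in>T'. alt_sign \<tau> (f(j := f j + (-1))))"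
        by (simp add: sum_distrib_left)
      also have "(\<Sum>j\<in>T'. alt_sign \<tau> (f(j := f j + (-1)))) = 0"
      proof (rule alt_sign_sum_eq_0[OF fin])
        show "T' \<subseteq> \<tau>" using T by (auto simp: T'_def)
        fix j assume j: "j \<in> T'" and inj: "inj_on (f(j := f j + (-1))) \<tau>"
        have jT: "j \<in> T" and m3: "3 \<le> m' j" using j by (auto simp: T'_def)
        have "(\<lambda>x. int (?m j x)) = f(j := f j + (-1))"
          using m3 by (auto simp: f_def of_nat_diff)
        then have inj: "inj_on (?m j) \<tau>" using inj by (metis (mono_tags, lifting) inj_on_def)
        have le: "m' x \<le> d + 1" for x using m' by (auto simp: mono_basis_iff)
        have ge: "2 \<le> m' x" if "x \<in> \<tau>" for x using True that by (auto simp: K_def)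
        have "?m j ` \<tau> \<subseteq> {2..<d+2}"
        proof
          fix y assume "y \<in> ?m j ` \<tau>"
          then obtain x where x: "x \<in> \<tau>" "y = ?m j x" by blast
          show "y \<in> {2..<d+2}" using le[of x] ge[OF x(1)] x m3 by (auto simp: fun_upd_def)
        qed
        then have onto: "?m j ` \<tau> = {2..<d+2}"
          by (rule card_subset_eq[rotated]) (use card_image[OF inj] \<tau> in auto)
        \<comment> \<open>The cap on exponents keeps \<open>m' j\<close> among the values in use, so
          another vertex already carries it. This is why the exponents of the kernel element must
          run up to \<open>d + 1\<close>.\<close>
        have "m' j \<in> {2..<d+2}" using le[of j] ge jT T by (auto simp: less_Suc_eq_le)
        then obtain u where u: "u \<in> \<tau>" "?m j u = m' j" using onto by (metis imageE)
        have uj: "u \<noteq> j" using u m3 by auto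
        \<comment> \<open>The lowered exponents on \<open>S\<close> fill the block
          \<open>{2..<2 + card S}\<close>. If \<open>u\<close> were in \<open>S\<close>, then
          \<open>m' j - 1\<close> would lie in this block too and be taken on \<open>S\<close>,
          against injectivity at \<open>j\<close>.\<close>
        have "u \<notin> S"
        proof
          assume uS: "u \<in> S"
          have jS: "j \<notin> S" using jT by (auto simp: T_def)
          have im: "?m j ` S \<subseteq> {2..<2 + card S}"
          proof
            fix y assume "y \<in> ?m j ` S"
            then obtain x where x: "x \<in> S" "y = ?m j x" by blast
            then show "y \<in> {2..<2 + card S}" using True jS S unfolding K_def by (auto simp: subset_iff)
          qed
          have "?m j ` S = {2..<2 + card S}"
            by (rule card_subset_eq[OF _ im])
              (use card_image[OF inj_on_subset[OF inj S(1)]] in auto)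
          moreover have "m' u < 2 + card S" using True uS by (auto simp: K_def)
          then have "?m j j \<in> {2..<2 + card S}" using u uj m3 by auto
          ultimately obtain x where "x \<in> S" "?m j x = ?m j j" by (metis imageE)
          then have "x = j" using inj S jT T unfolding inj_on_def by blast
          then show False using \<open>x \<in> S\<close> jS by simp
        qed
        then have "u \<in> T'" using u uj m3 by (auto simp: T'_def T_def)
        then show "\<exists>u\<in>T'. u \<noteq> j \<and> f u = f j" using u uj by (auto simp: f_def)
      qed simp
      finally show ?thesis by simp
    qed
  qed
  then have zero: "mult_lin n d F ?I a \<kappa> = (\<lambda>_. 0)" by (auto simp: mult_lin_def)
  have zero': "mult_lin n d F ?I a (\<lambda>_. 0) = (\<lambda>_. 0)" by (auto simp: mult_lin_def cong: if_cong)
  have in1: "\<kappa> \<in> graded_piece n d F ?I" by (auto simp: graded_piece_def \<kappa>_def)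
  have in2: "(\<lambda>_. 0) \<in> graded_piece n d F ?I" by (auto simp: graded_piece_def)
  assume "inj_on (mult_lin n d F ?I a) (graded_piece n d F ?I)"
  then have \<kappa>0: "\<kappa> = (\<lambda>_. 0)" using zero zero' in1 in2 unfolding inj_on_def by metis
  obtain m where m: "\<And>j. j \<notin> \<tau> \<Longrightarrow> m j = 0" "bij_betw m \<tau> {2..<2 + card \<tau>}"
     "\<And>j. j \<in> S \<Longrightarrow> m j < 2 + card S"
    using ex_exponents[OF fin S(1)] by metis
  have mv: "m j \<in> {2..<2+d}" if "j \<in> \<tau>" for j using m(2) that \<tau> by (auto simp: bij_betw_def)
  have K: "K m" using m mv by (auto simp: K_def)
  have "m \<in> ?B"
    unfolding mono_basis_iff
  proof (intro conjI allI impI)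
    fix j show "m j \<le> d + 1" using m(1)[of j] mv[of j] by (cases "j \<in> \<tau>") auto
    show "n \<le> j \<Longrightarrow> m j = 0" using m(1)[of j] \<tau> by (metis lessThan_iff not_le subsetD)
    show "is_face n d F {j. 0 < m j}" by (rule face[OF K])
    show "(\<Sum>j<n. m j) = ?I" using sum_exponents[OF \<tau>(1) m(1,2)] \<tau> by (simp add: add.commute)
  qed
  then have "\<kappa> m = of_int (alt_sign \<tau> (\<lambda>j. int (m j))) * (\<Prod>j\<in>T. a j ^ m j)"
    using K by (simp add: \<kappa>_def)
  moreover have "inj_on (\<lambda>j. int (m j)) \<tau>" using m(2) by (auto simp: bij_betw_def inj_on_def)
  then have "(of_int (alt_sign \<tau> (\<lambda>j. int (m j))) :: 'k) \<noteq> 0"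
    by (rule of_int_alt_sign_neq_0[OF fin])
  moreover have "(\<Prod>j\<in>T. a j ^ m j) \<noteq> 0" using T by (auto simp: T_def S_def)
  ultimately show False using \<kappa>0 by simp
qed

section \<open>Failure of surjectivity\<close>

text \<open>With all \<open>w j = 1\<close> this is a nonzero simplicial \<open>d\<close>-cycle with
  coefficients in the field; \<open>w j\<close> scales the facet opposite to the vertex
  \<open>j\<close>. Nonvanishing is asked inside \<open>F\<close>, as values of \<open>z\<close>
  elsewhere are never read.\<close>

definition weighted_cycle :: "nat \<Rightarrow> nat \<Rightarrow> nat set set \<Rightarrow> (nat \<Rightarrow> 'k::field) \<Rightarrow> (nat set \<Rightarrow> 'k) \<Rightarrow> bool" where
  "weighted_cycle n d F w z \<longleftrightarrow> (\<exists>\<sigma>\<in>F. z \<sigma> \<noteq> 0) \<and>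
     (\<forall>\<tau>. \<tau> \<subseteq> {..<n} \<longrightarrow> card \<tau> = d \<longrightarrow>
       (\<Sum>j | j < n \<and> j \<notin> \<tau> \<and> insert j \<tau> \<in> F. (-1) ^ card {i\<in>\<tau>. i < j} * w j * z (insert j \<tau>)) = 0)"

text \<open>A weighted cycle \<open>z\<close> yields a linear functional vanishing on the image of \<open>\<times>\<ell>\<close>: it reads off the
  alternating sum over each \<open>d\<close>-face \<open>\<sigma>\<close> of the coefficients of the monomials whose exponents are a
  permutation of \<open>1, \<dots>, d + 1\<close>, weighted by \<open>z \<sigma>\<close>. Vertices with vanishing coefficient carry
  the largest exponents.\<close>

lemma mult_lin_not_surj:
  fixes a :: "nat \<Rightarrow> 'k::field"
  assumes F: "F \<subseteq> dfaces n d" and cyc: "weighted_cycle n d F (\<lambda>j. a j ^ (d+1)) z"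
  shows "mono_basis n d F (\<Sum>{1..<d+2}) \<noteq> {}"
    and "Suc I = \<Sum>{1..<d+2} \<Longrightarrow> mult_lin n d F I a ` graded_piece n d F I \<noteq> graded_piece n d F (Suc I)"
proof -
  let ?N = "\<Sum>{1..<d+2}"
  let ?B' = "mono_basis n d F ?N"
  define supp where "supp = (\<lambda>m :: nat \<Rightarrow> nat. {j. 0 < m j})"
  define S where "S = {j. a j = 0}"
  \<comment> \<open>\<open>Q\<close> reserves the top exponents for \<open>S\<close>. In
    \<open>\<phi>\<close> the powers of \<open>a j\<close> are complementary,
    \<open>d + 1 - m j\<close>, so that a factor \<open>a j\<close> compensates the raising of one
    exponent.\<close>
  define Q where "Q = (\<lambda>m. card (supp m) = d + 1 \<and> (\<forall>j\<in>supp m \<inter> S. card (supp m - S) < m j))"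
  define \<phi> where "\<phi> = (\<lambda>m. if Q m then of_int (alt_sign (supp m) (\<lambda>j. int (m j))) * z (supp m)
      * (\<Prod>j\<in>supp m - S. a j ^ (d + 1 - m j)) else 0)"
  have faceD: "is_face n d F \<sigma> \<Longrightarrow> card \<sigma> = d + 1 \<Longrightarrow> \<sigma> \<in> F" for \<sigma> by (auto simp: is_face_def)
  have inF: "\<sigma> \<subseteq> {..<n}" "card \<sigma> = d + 1" "finite \<sigma>" "is_face n d F \<sigma>" if "\<sigma> \<in> F" for \<sigma>
  proof -
    show "\<sigma> \<subseteq> {..<n}" "card \<sigma> = d + 1" using that F by (auto simp: dfaces_def)
    then show "finite \<sigma>" "is_face n d F \<sigma>" using that finite_subset by (auto simp: is_face_def)
  qed
  obtain \<sigma> where \<sigma>: "\<sigma> \<in> F" "z \<sigma> \<noteq> 0" using cyc by (auto simp: weighted_cycle_def)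
  obtain m1 where m1: "\<And>j. j \<notin> \<sigma> \<Longrightarrow> m1 j = 0" "bij_betw m1 \<sigma> {1..<1 + card \<sigma>}"
     "\<And>j. j \<in> \<sigma> - S \<Longrightarrow> m1 j < 1 + card (\<sigma> - S)"
     "\<And>j. j \<in> \<sigma> - (\<sigma> - S) \<Longrightarrow> 1 + card (\<sigma> - S) \<le> m1 j"
    by (rule ex_exponents[OF inF(3)[OF \<sigma>(1)] Diff_subset[of \<sigma> S], where b = 1]) (rule that)
  have mv: "m1 j \<in> {1..<d+2}" if "j \<in> \<sigma>" for j using m1(2) that inF[OF \<sigma>(1)] by (auto simp: bij_betw_def)
  have supp1: "supp m1 = \<sigma>"
  proof (intro set_eqI iffI)
    fix x assume "x \<in> supp m1"
    then have "m1 x \<noteq> 0" by (simp add: supp_def)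
    then show "x \<in> \<sigma>" using m1(1)[of x] by (cases "x \<in> \<sigma>") simp_all
  next
    fix x assume "x \<in> \<sigma>"
    then show "x \<in> supp m1" using mv[of x] by (simp add: supp_def)
  qed
  have m1B: "m1 \<in> ?B'"
    unfolding mono_basis_iff
  proof (intro conjI allI impI)
    fix j show "m1 j \<le> d + 1" using m1(1)[of j] mv[of j] by (cases "j \<in> \<sigma>") auto
    show "n \<le> j \<Longrightarrow> m1 j = 0" using m1(1)[of j] inF(1)[OF \<sigma>(1)] by (metis lessThan_iff not_le subsetD)
    show "is_face n d F {j. 0 < m1 j}" using inF(4)[OF \<sigma>(1)] supp1 by (simp add: supp_def)
    show "(\<Sum>j<n. m1 j) = ?N" using sum_exponents[OF inF(1)[OF \<sigma>(1)] m1(1,2)] inF[OF \<sigma>(1)] by simp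
  qed
  then show "?B' \<noteq> {}" by blast
  assume I: "Suc I = ?N"
  let ?B = "mono_basis n d F I"
  let ?up = "\<lambda>m j. m(j := m j + 1)" and ?dn = "\<lambda>m j. m(j := m j - 1)"
  have \<phi>1: "\<phi> m1 \<noteq> 0"
  proof -
    have "Q m1" using m1(4) inF[OF \<sigma>(1)] unfolding Q_def supp1 by (auto simp: Suc_le_eq)
    moreover have "inj_on (\<lambda>j. int (m1 j)) \<sigma>" using m1(2) by (auto simp: bij_betw_def inj_on_def)
    then have "(of_int (alt_sign \<sigma> (\<lambda>j. int (m1 j))) :: 'k) \<noteq> 0"
      by (rule of_int_alt_sign_neq_0[OF inF(3)[OF \<sigma>(1)]])
    moreover have "(\<Prod>j\<in>\<sigma> - S. a j ^ (d + 1 - m1 j)) \<noteq> 0"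
      using inF(3)[OF \<sigma>(1)] by (auto simp: S_def)
    ultimately show ?thesis using \<sigma>(2) by (simp add: \<phi>_def supp1)
  qed
  \<comment> \<open>The transpose of the multiplication map kills \<open>\<phi>\<close>, checked at
    one monomial at a time. Only supports of size \<open>d\<close> or \<open>d + 1\<close> matter,
    as \<open>\<phi>\<close> sees only supports of size \<open>d + 1\<close>.\<close>
  have local_sum: "(\<Sum>j | j < n \<and> ?up m j \<in> ?B'. a j * \<phi> (?up m j)) = 0" if m: "m \<in> ?B" for m
  proof -
    let ?J = "{j. j < n \<and> ?up m j \<in> ?B'}"
    have finJ: "finite ?J" by simp
    have face: "is_face n d F (supp m)" and sn: "supp m \<subseteq> {..<n}" and fs: "finite (supp m)"
      and cs: "card (supp m) \<le> d + 1"
      using m finite_subset by (auto simp: mono_basis_iff supp_def is_face_def)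
    have ub: "m j \<le> d + 1" for j using m by (auto simp: mono_basis_iff)
    have supp_up: "supp (?up m j) = insert j (supp m)" for j by (auto simp: supp_def)
    then have supp_Suc: "supp (m(j := Suc (m j))) = insert j (supp m)" for j by simp
    have up_in: "?up m j \<in> ?B'" if "j < n" "m j \<le> d" "is_face n d F (insert j (supp m))" for j
      unfolding mono_basis_iff
    proof (intro conjI allI impI)
      fix k show "?up m j k \<le> d + 1" using ub[of k] that by auto
      show "n \<le> k \<Longrightarrow> ?up m j k = 0" using m that by (auto simp: mono_basis_iff)
      show "is_face n d F {x. 0 < ?up m j x}" using that(3) supp_up[of j] by (simp add: supp_def)
      show "(\<Sum>j'<n. ?up m j j') = ?N"
        using m I sum_fun_upd_inc[OF that(1), of m] by (simp add: mono_basis_iff)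
    qed
    have up_face: "is_face n d F (insert j (supp m))" "m j \<le> d" if "?up m j \<in> ?B'" for j
    proof -
      show "is_face n d F (insert j (supp m))"
        using that supp_up[of j] by (simp add: mono_basis_iff supp_def)
      have "?up m j j \<le> d + 1" using that unfolding mono_basis_iff by blast
      then show "m j \<le> d" by simp
    qed
    consider "card (supp m) < d" | "card (supp m) = d + 1" | "card (supp m) = d" using cs by linarith
    then show ?thesis
    proof cases
      case 1
      have "\<phi> (?up m j) = 0" for j
      proof -
        have "card (supp (?up m j)) \<noteq> d + 1"
          unfolding supp_up using 1 fs by (simp add: card_insert_if)
        then show ?thesis by (simp add: \<phi>_def Q_def)
      qed
      then show ?thesis by simp
    next
      \<comment> \<open>The support is already a \<open>d\<close>-face and raising exponents stays
        inside it, so the terms cancel in pairs as for the kernel element.\<close>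
      case 2
      define A where "A = supp m"
      define f where "f = (\<lambda>j. int (m j))"
      have A: "A \<in> F" "finite A" "card A = d + 1" "A \<subseteq> {..<n}"
        using faceD[OF face] 2 fs sn by (auto simp: A_def)
      define T where "T = {j\<in>A - S. m j \<le> d}"
      have finT: "finite T" using A by (auto simp: T_def)
      have TJ: "T \<subseteq> ?J"
      proof
        fix j assume "j \<in> T"
        then have "j < n" "m j \<le> d" "insert j (supp m) = supp m" using A by (auto simp: T_def A_def)
        then show "j \<in> ?J" using up_in face by simp
      qed
      define QA where "QA \<longleftrightarrow> (\<forall>j\<in>A \<inter> S. card (A - S) < m j)"
      define C where "C = z A * (\<Prod>j\<in>A - S. a j ^ (d + 1 - m j))"
      have "(\<Sum>j\<in>?J. a j * \<phi> (?up m j)) = (\<Sum>j\<in>T. a j * \<phi> (?up m j))"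
      proof (rule sum.mono_neutral_right[OF finJ TJ], intro ballI)
        fix j assume j: "j \<in> ?J - T"
        show "a j * \<phi> (?up m j) = 0"
        proof (cases "j \<in> S")
          case False
          have "j \<notin> A" using j up_face(2)[of j] False by (auto simp: T_def)
          then have "\<not> Q (?up m j)" using A by (auto simp: Q_def supp_up supp_Suc A_def[symmetric])
          then show ?thesis by (simp add: \<phi>_def)
        qed (simp add: S_def)
      qed
      also have "\<dots> = (\<Sum>j\<in>T. if QA then C * of_int (alt_sign A (f(j := f j + 1))) else 0)"
      proof (rule sum.cong[OF refl])
        fix j assume j: "j \<in> T"
        have jA: "j \<in> A - S" "m j \<le> d" using j by (auto simp: T_def)
        have su: "supp (?up m j) = A" using jA by (auto simp: supp_up supp_Suc A_def)
        have Q: "Q (?up m j) \<longleftrightarrow> QA" using A jA unfolding Q_def su QA_def by auto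
        have f: "(\<lambda>x. int (?up m j x)) = f(j := f j + 1)" by (auto simp: f_def)
        have "(\<Prod>x\<in>A - S - {j}. a x ^ (d + 1 - ?up m j x)) = (\<Prod>x\<in>A - S - {j}. a x ^ (d + 1 - m x))"
          by (rule prod.cong) auto
        moreover have "d + 1 - m j = Suc (d + 1 - ?up m j j)" using jA by simp
        moreover have "j \<in> A - S" "finite (A - S)" using A jA by auto
        ultimately have "a j * (\<Prod>x\<in>A - S. a x ^ (d + 1 - ?up m j x)) = (\<Prod>x\<in>A - S. a x ^ (d + 1 - m x))"
          by (simp only: prod.remove[of "A - S" j] power_Suc mult.assoc)
        then show "a j * \<phi> (?up m j) = (if QA then C * of_int (alt_sign A (f(j := f j + 1))) else 0)"
          unfolding \<phi>_def Q su f C_def by (auto simp: mult_ac)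
      qed
      also have "\<dots> = 0"
      proof (cases QA)
        case True
        have "(\<Sum>j\<in>T. alt_sign A (f(j := f j + 1))) = 0"
        proof (rule alt_sign_sum_eq_0[OF A(2)])
          show "T \<subseteq> A" by (auto simp: T_def)
          fix j assume j: "j \<in> T" and inj: "inj_on (f(j := f j + 1)) A"
          have jA: "j \<in> A" "j \<notin> S" "m j \<le> d" using j by (auto simp: T_def)
          have "(\<lambda>x. int (?up m j x)) = f(j := f j + 1)" by (auto simp: f_def)
          then have inj: "inj_on (?up m j) A" using inj by (metis (mono_tags, lifting) inj_on_def)
          have ge: "1 \<le> m x" if "x \<in> A" for x using that by (auto simp: A_def supp_def)
          have "?up m j ` A \<subseteq> {1..<d+2}"
          proof
            fix y assume "y \<in> ?up m j ` A"
            then obtain x where x: "x \<in> A" "y = ?up m j x" by blast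
            show "y \<in> {1..<d+2}" using ub[of x] ge[OF x(1)] x jA by (auto simp: fun_upd_def)
          qed
          then have onto: "?up m j ` A = {1..<d+2}"
            by (rule card_subset_eq[rotated]) (use card_image[OF inj] A in auto)
          have "m j \<in> {1..<d+2}" using ub[of j] ge[OF jA(1)] by auto
          then obtain u where u: "u \<in> A" "?up m j u = m j" using onto by (metis imageE)
          have uj: "u \<noteq> j" using u by auto
          \<comment> \<open>Dual to the kernel element: the raised exponents on
            \<open>A \<inter> S\<close> fill the top block, and \<open>u\<close> in \<open>S\<close>
            would put \<open>m j + 1\<close> there as well, against injectivity at
            \<open>j\<close>.\<close>
          have "u \<notin> S"
          proof
            assume uS: "u \<in> S"
            let ?k = "card (A - S)"
            have im: "?up m j ` (A \<inter> S) \<subseteq> {?k + 1..<d + 2}"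
            proof
              fix y assume "y \<in> ?up m j ` (A \<inter> S)"
              then obtain x where x: "x \<in> A \<inter> S" "y = ?up m j x" by blast
              then show "y \<in> {?k + 1..<d + 2}" using True jA ub[of x] unfolding QA_def by (auto simp: Suc_le_eq)
            qed
            have "card A = ?k + card (A \<inter> S)"
              using A(2) by (metis Int_Diff_Un Int_Diff_disjoint add.commute card_Un_disjoint finite_Diff finite_Int)
            then have "?up m j ` (A \<inter> S) = {?k + 1..<d + 2}"
              using A(3) card_image[OF inj_on_subset[OF inj], of "A \<inter> S"]
              by (intro card_subset_eq[OF _ im]) auto
            moreover have "?k < m u" using True uS u(1) by (auto simp: QA_def)
            then have "?up m j j \<in> {?k + 1..<d + 2}" using u uj jA by auto
            ultimately obtain x where "x \<in> A \<inter> S" "?up m j x = ?up m j j" by (metis imageE)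
            then have "x = j" using inj jA unfolding inj_on_def by blast
            then show False using \<open>x \<in> A \<inter> S\<close> jA by simp
          qed
          then have "u \<in> T" using u uj jA by (auto simp: T_def)
          then show "\<exists>u\<in>T. u \<noteq> j \<and> f u = f j" using u uj by (auto simp: f_def)
        qed simp
        then have "(\<Sum>j\<in>T. C * of_int (alt_sign A (f(j := f j + 1)))) = 0"
          by (metis mult_zero_right of_int_0 of_int_sum sum_distrib_left)
        then show ?thesis using True by simp
      qed simp
      finally show ?thesis .
    next
      \<comment> \<open>A new vertex enters with exponent 1. An old exponent 1 would collide with
        it, so it must be the unique smallest one; what remains is the cycle condition at the ridge
        \<open>A\<close>.\<close>
      case 3
      define A where "A = supp m"
      define f where "f = (\<lambda>j. int (m j))"
      have A: "finite A" "card A = d" "A \<subseteq> {..<n}" using 3 fs sn by (auto simp: A_def)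
      have mA: "m j = 0" if "j \<notin> A" for j using that by (auto simp: A_def supp_def)
      show ?thesis
      proof (cases "\<forall>i\<in>A. 2 \<le> m i")
        case False
        then obtain i where "i \<in> A" "\<not> 2 \<le> m i" by blast
        then have i: "i \<in> A" "m i = 1" by (auto simp: A_def supp_def)
        have "\<phi> (?up m j) = 0" for j
        proof (cases "j \<in> A")
          case True
          then show ?thesis using 3 by (auto simp: \<phi>_def Q_def supp_up supp_Suc A_def insert_absorb)
        next
          case False
          then have "?up m j i = ?up m j j" "i \<noteq> j" using i mA by auto
          then have "\<not> inj_on (\<lambda>x. int (?up m j x)) (insert j A)"
            using i unfolding inj_on_def by (metis insertCI)
          moreover have su: "supp (?up m j) = insert j A" unfolding A_def by (rule supp_up)
          ultimately have "alt_sign (supp (?up m j)) (\<lambda>x. int (?up m j x)) = 0"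
            using alt_sign_eq_0_iff[of "insert j A"] A
            by (simp only: su finite_insert not_False_eq_True)
          then show ?thesis unfolding \<phi>_def by (simp only: of_int_0 mult_zero_left if_cancel)
        qed
        then show ?thesis by simp
      next
        case True
        let ?K = "{j. j < n \<and> j \<notin> A \<and> insert j A \<in> F}"
        have KJ: "?K \<subseteq> ?J"
        proof
          fix j assume j: "j \<in> ?K"
          then have "is_face n d F (insert j A)" using inF(4) by blast
          then show "j \<in> ?J" using up_in[of j] j mA by (simp add: A_def)
        qed
        \<comment> \<open>One more than the bound for \<open>A\<close> alone, because the new vertex
          outside \<open>S\<close> enlarges \<open>A - S\<close> by one.\<close>
        define QA where "QA \<longleftrightarrow> (\<forall>j\<in>A \<inter> S. card (A - S) + 1 < m j)"
        define C where "C = (if QA then of_int (alt_sign A f) * (\<Prod>j\<in>A - S. a j ^ (d + 1 - m j)) else 0)"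
        have "(\<Sum>j\<in>?J. a j * \<phi> (?up m j)) = (\<Sum>j\<in>?K. a j * \<phi> (?up m j))"
        proof (rule sum.mono_neutral_right[OF finJ KJ], intro ballI)
          fix j assume j: "j \<in> ?J - ?K"
          then have "is_face n d F (insert j A)" using up_face(1)[of j] by (simp add: A_def)
          moreover have "j \<in> A \<or> insert j A \<notin> F" using j by blast
          ultimately have "card (insert j A) \<noteq> d + 1"
            using faceD[of "insert j A"] A by (cases "j \<in> A") (simp_all add: insert_absorb)
          then have "\<not> Q (?up m j)" unfolding Q_def supp_up A_def by simp
          then show "a j * \<phi> (?up m j) = 0" by (simp add: \<phi>_def)
        qed
        also have "\<dots> = (\<Sum>j\<in>?K. C * ((-1) ^ card {i\<in>A. i < j} * a j ^ (d+1) * z (insert j A)))"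
        proof (rule sum.cong[OF refl])
          fix j assume j: "j \<in> ?K"
          show "a j * \<phi> (?up m j) = C * ((-1) ^ card {i\<in>A. i < j} * a j ^ (d+1) * z (insert j A))"
          proof (cases "j \<in> S")
            case False
            have jA: "j \<notin> A" and m0: "m j = 0" using j mA by auto
            have su: "supp (?up m j) = insert j A" unfolding A_def by (rule supp_up)
            have dS: "insert j A - S = insert j (A - S)" using False by auto
            have dI: "insert j A \<inter> S = A \<inter> S" using False by auto
            have "card (insert j A) = d + 1" "card (insert j (A - S)) = card (A - S) + 1"
              using A jA by auto
            moreover have "?up m j x = m x" if "x \<in> A" for x using that jA by auto
            ultimately have Q: "Q (?up m j) \<longleftrightarrow> QA" unfolding Q_def su QA_def dS dI by auto
            have "(\<lambda>x. int (?up m j x)) = f(j := 1)" using m0 by (auto simp: f_def)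
            moreover have "alt_sign (insert j A) (f(j := 1)) =
                (-1) ^ card {i\<in>A. i < j} * alt_sign A (f(j := 1))"
              by (rule alt_sign_insert_min) (use A jA True in \<open>auto simp: f_def\<close>)
            moreover have "alt_sign A (f(j := 1)) = alt_sign A f"
              by (rule alt_sign_cong) (use jA in auto)
            ultimately have al: "alt_sign (insert j A) (\<lambda>x. int (?up m j x)) =
                (-1) ^ card {i\<in>A. i < j} * alt_sign A f" by simp
            have "(\<Prod>x\<in>A - S. a x ^ (d + 1 - ?up m j x)) = (\<Prod>x\<in>A - S. a x ^ (d + 1 - m x))"
              by (rule prod.cong) (use jA in auto)
            \<comment> \<open>The new vertex contributes \<open>a j ^ d\<close>; with the factor
              \<open>a j\<close> from the form this is the weight \<open>a j ^ (d+1)\<close> of the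
              cycle.\<close>
            then have pr: "(\<Prod>x\<in>insert j (A - S). a x ^ (d + 1 - ?up m j x)) =
                a j ^ d * (\<Prod>x\<in>A - S. a x ^ (d + 1 - m x))"
              using A jA m0 by simp
            show ?thesis unfolding \<phi>_def Q su C_def al dS pr by (simp add: mult_ac)
          qed (simp add: S_def)
        qed
        also have "\<dots> = C * (\<Sum>j\<in>?K. (-1) ^ card {i\<in>A. i < j} * a j ^ (d+1) * z (insert j A))"
          by (simp add: sum_distrib_left)
        also have "\<dots> = 0" using cyc A unfolding weighted_cycle_def by auto
        finally show ?thesis .
      qed
    qed
  qed
  \<comment> \<open>Summation is exchanged over the pairs of \<open>m\<close> and \<open>j\<close>
    with \<open>m'\<close> equal to \<open>m\<close> times the variable \<open>j\<close>; each inner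
    sum is then a \<open>local_sum\<close>.\<close>
  have annih: "(\<Sum>m'\<in>?B'. \<phi> m' * mult_lin n d F I a w m') = 0" for w
  proof -
    have "(\<Sum>m'\<in>?B'. \<phi> m' * mult_lin n d F I a w m') =
        (\<Sum>m'\<in>?B'. \<Sum>j<n. if 0 < m' j \<and> ?dn m' j \<in> ?B then \<phi> m' * (a j * w (?dn m' j)) else 0)"
      by (rule sum.cong) (auto simp: mult_lin_def I sum_distrib_left intro!: sum.cong)
    also have "\<dots> = (\<Sum>j<n. \<Sum>m'\<in>?B'. if 0 < m' j \<and> ?dn m' j \<in> ?B then \<phi> m' * (a j * w (?dn m' j)) else 0)"
      by (rule sum.swap)
    also have "\<dots> = (\<Sum>j<n. \<Sum>m\<in>?B. if ?up m j \<in> ?B' then w m * (a j * \<phi> (?up m j)) else 0)"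
    proof (rule sum.cong[OF refl])
      fix j
      have "(\<Sum>m'\<in>?B'. if 0 < m' j \<and> ?dn m' j \<in> ?B then \<phi> m' * (a j * w (?dn m' j)) else 0)
          = (\<Sum>m' | m' \<in> ?B' \<and> (0 < m' j \<and> ?dn m' j \<in> ?B). \<phi> m' * (a j * w (?dn m' j)))"
        by (rule sum.inter_filter[OF finite_mono_basis, symmetric])
      also have "\<dots> = (\<Sum>m | m \<in> ?B \<and> ?up m j \<in> ?B'. w m * (a j * \<phi> (?up m j)))"
        by (rule sum.reindex_bij_witness[of _ "\<lambda>m. ?up m j" "\<lambda>m. ?dn m j"]) (auto simp: mult_ac)
      also have "\<dots> = (\<Sum>m\<in>?B. if ?up m j \<in> ?B' then w m * (a j * \<phi> (?up m j)) else 0)"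
        by (rule sum.inter_filter[OF finite_mono_basis])
      finally show "(\<Sum>m'\<in>?B'. if 0 < m' j \<and> ?dn m' j \<in> ?B then \<phi> m' * (a j * w (?dn m' j)) else 0)
        = (\<Sum>m\<in>?B. if ?up m j \<in> ?B' then w m * (a j * \<phi> (?up m j)) else 0)" .
    qed
    also have "\<dots> = (\<Sum>m\<in>?B. \<Sum>j<n. if ?up m j \<in> ?B' then w m * (a j * \<phi> (?up m j)) else 0)"
      by (rule sum.swap)
    also have "\<dots> = (\<Sum>m\<in>?B. w m * (\<Sum>j | j < n \<and> ?up m j \<in> ?B'. a j * \<phi> (?up m j)))"
    proof (rule sum.cong[OF refl])
      fix m
      have "(\<Sum>j<n. if ?up m j \<in> ?B' then w m * (a j * \<phi> (?up m j)) else 0)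
          = (\<Sum>j | j \<in> {..<n} \<and> ?up m j \<in> ?B'. w m * (a j * \<phi> (?up m j)))"
        by (rule sum.inter_filter[symmetric]) simp
      then show "(\<Sum>j<n. if ?up m j \<in> ?B' then w m * (a j * \<phi> (?up m j)) else 0)
          = w m * (\<Sum>j | j < n \<and> ?up m j \<in> ?B'. a j * \<phi> (?up m j))"
        by (simp only: sum_distrib_left lessThan_iff)
    qed
    also have "\<dots> = 0" using local_sum by simp
    finally show ?thesis .
  qed
  show "mult_lin n d F I a ` graded_piece n d F I \<noteq> graded_piece n d F (Suc I)"
  proof
    assume *: "mult_lin n d F I a ` graded_piece n d F I = graded_piece n d F (Suc I)"
    define e where "e = (\<lambda>m. if m = m1 then 1 else 0 :: 'k)"
    have "e \<in> graded_piece n d F (Suc I)" using m1B I by (auto simp: graded_piece_def e_def)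
    then obtain w where "e = mult_lin n d F I a w" using * by blast
    then have "(\<Sum>m'\<in>?B'. \<phi> m' * e m') = 0" using annih by simp
    moreover have "(\<Sum>m'\<in>?B'. \<phi> m' * e m') = \<phi> m1"
      using m1B finite_mono_basis by (simp add: e_def if_distrib cong: if_cong)
    ultimately show False using \<phi>1 by simp
  qed
qed

text \<open>One degree defeats both alternatives of full rank. That the target piece is nonzero also
  places the step below the top degree, where full rank is demanded. All weights appear in
  \<open>cyc\<close> because the form is known only from the assumed property.\<close>

lemma not_has_WLP:
  assumes F: "F \<subseteq> dfaces n d"
    and \<tau>: "\<tau> \<subseteq> {..<n}" "card \<tau> = d" "\<And>\<sigma>. \<sigma> \<in> F \<Longrightarrow> \<not> \<tau> \<subseteq> \<sigma>"
    and cyc: "\<And>w :: nat \<Rightarrow> 'k. \<exists>z. weighted_cycle n d F w z"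
  shows "\<not> has_WLP TYPE('k::field) n d F"
proof
  assume "has_WLP TYPE('k) n d F"
  then obtain a :: "nat \<Rightarrow> 'k" where a: "\<forall>i < top_degree n d F. full_rank_step n d F i a"
    unfolding has_WLP_def by blast
  obtain z where z: "weighted_cycle n d F (\<lambda>j. a j ^ (d+1)) z" using cyc by blast
  let ?I = "\<Sum>{2..<d+2}"
  have I: "Suc ?I = \<Sum>{1..<d+2}" by (subst (2) sum.atLeast_Suc_lessThan) (auto simp: numeral_2_eq_2)
  have "?I < top_degree n d F"
    using mult_lin_not_surj(1)[OF F z] unfolding I[symmetric] using less_top_degree by fast
  then have "full_rank_step n d F ?I a" using a by blast
  then show False
    using mult_lin_not_inj[OF \<tau>, where a = a] mult_lin_not_surj(2)[OF F z I] unfolding full_rank_step_def by blast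
qed

section \<open>Existence of weighted cycles\<close>

text \<open>The matrix of the weighted boundary. \<open>the_elem\<close> picks the vertex of
  \<open>\<sigma>\<close> missing from \<open>\<tau>\<close>, which presupposes sizes that differ by
  one.\<close>

definition incidence :: "(nat \<Rightarrow> 'k::field) \<Rightarrow> nat set \<Rightarrow> nat set \<Rightarrow> 'k" where
  "incidence w \<tau> \<sigma> = (if \<tau> \<subseteq> \<sigma> then (let j = the_elem (\<sigma> - \<tau>) in (-1) ^ card {i\<in>\<tau>. i < j} * w j) else 0)"

lemma incidence_insert:
  assumes "j \<notin> \<tau>"
  shows "incidence w \<tau> (insert j \<tau>) = (-1) ^ card {i\<in>\<tau>. i < j} * w j"
proof -
  have "insert j \<tau> - \<tau> = {j}" using assms by auto
  then show ?thesis by (auto simp: incidence_def Let_def)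
qed

text \<open>Turns a kernel vector of the boundary matrix with columns in \<open>R\<close> into a
  cycle of \<open>F\<close> by extension with zero: in row \<open>\<tau>\<close> only the columns
  \<open>insert j \<tau>\<close> can have nonzero entries.\<close>

lemma weighted_cycleI:
  fixes z :: "nat set \<Rightarrow> 'k::field"
  assumes F: "F \<subseteq> dfaces n d" and R: "R \<subseteq> F" and nz: "\<exists>\<sigma>\<in>R. z \<sigma> \<noteq> 0"
    and eq: "\<And>\<tau>. \<tau> \<subseteq> {..<n} \<Longrightarrow> card \<tau> = d \<Longrightarrow> (\<Sum>\<sigma>\<in>R. incidence w \<tau> \<sigma> * z \<sigma>) = 0"
  shows "weighted_cycle n d F w (\<lambda>\<sigma>. if \<sigma> \<in> R then z \<sigma> else 0)"
  unfolding weighted_cycle_def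
proof (intro conjI allI impI)
  show "\<exists>\<sigma>\<in>F. (if \<sigma> \<in> R then z \<sigma> else 0) \<noteq> 0" using R nz by auto
  fix \<tau> :: "nat set" assume \<tau>: "\<tau> \<subseteq> {..<n}" "card \<tau> = d"
  have ft: "finite \<tau>" using \<tau> finite_subset by blast
  have Rf: "\<sigma> \<subseteq> {..<n} \<and> card \<sigma> = d + 1" if "\<sigma> \<in> R" for \<sigma> using that R F by (auto simp: dfaces_def)
  have "finite (Pow {..<n})" by simp
  then have finR: "finite R" by (rule rev_finite_subset) (use Rf in auto)
  let ?J = "{j. j < n \<and> j \<notin> \<tau> \<and> insert j \<tau> \<in> F}" and ?K = "{j. j < n \<and> j \<notin> \<tau> \<and> insert j \<tau> \<in> R}"
  let ?g = "\<lambda>j. (-1) ^ card {i\<in>\<tau>. i < j} * w j * (if insert j \<tau> \<in> R then z (insert j \<tau>) else 0)"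
  have "(\<Sum>j\<in>?J. ?g j) = (\<Sum>j\<in>?K. ?g j)"
    by (rule sum.mono_neutral_right) (use R in auto)
  also have "\<dots> = (\<Sum>j\<in>?K. incidence w \<tau> (insert j \<tau>) * z (insert j \<tau>))"
    by (rule sum.cong) (auto simp: incidence_insert)
  also have "\<dots> = (\<Sum>\<sigma>\<in>(\<lambda>j. insert j \<tau>) ` ?K. incidence w \<tau> \<sigma> * z \<sigma>)"
    by (subst sum.reindex) (auto simp: inj_on_def o_def)
  also have "\<dots> = (\<Sum>\<sigma>\<in>R. incidence w \<tau> \<sigma> * z \<sigma>)"
  proof (rule sum.mono_neutral_left[OF finR])
    show "(\<lambda>j. insert j \<tau>) ` ?K \<subseteq> R" by auto
    show "\<forall>\<sigma>\<in>R - (\<lambda>j. insert j \<tau>) ` ?K. incidence w \<tau> \<sigma> * z \<sigma> = 0"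
    proof
      fix \<sigma> assume \<sigma>: "\<sigma> \<in> R - (\<lambda>j. insert j \<tau>) ` ?K"
      have "\<not> \<tau> \<subseteq> \<sigma>"
      proof
        assume sub: "\<tau> \<subseteq> \<sigma>"
        then have "card (\<sigma> - \<tau>) = 1" using Rf[of \<sigma>] \<sigma> \<tau> ft by (simp add: card_Diff_subset)
        then obtain j where j: "\<sigma> - \<tau> = {j}" by (meson card_1_singletonE)
        then have "\<sigma> = insert j \<tau>" "j \<notin> \<tau>" "j \<in> \<sigma>" using sub by auto
        then show False using \<sigma> Rf[of \<sigma>] by auto
      qed
      then show "incidence w \<tau> \<sigma> * z \<sigma> = 0" by (simp add: incidence_def)
    qed
  qed
  also have "\<dots> = 0" by (rule eq[OF \<tau>])
  finally show "(\<Sum>j\<in>?J. ?g j) = 0" .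
qed

definition degree_in :: "nat set set \<Rightarrow> nat set \<Rightarrow> nat" where
  "degree_in F \<tau> = card {\<sigma>\<in>F. \<tau> \<subseteq> \<sigma>}"

text \<open>A single round of peeling: degrees are taken in \<open>F\<close>, not among the
  surviving faces. Membership is thus a local event with an explicit probability.\<close>

definition core_faces :: "nat \<Rightarrow> nat set set \<Rightarrow> nat set set" where
  "core_faces d F = {\<sigma>\<in>F. \<forall>\<tau>. \<tau> \<subseteq> \<sigma> \<longrightarrow> card \<tau> = d \<longrightarrow> 2 \<le> degree_in F \<tau>}"

definition ridges :: "nat \<Rightarrow> nat \<Rightarrow> nat set set" where
  "ridges n d = {\<tau>. \<tau> \<subseteq> {..<n} \<and> card \<tau> = d}"

definition heavy_ridges :: "nat \<Rightarrow> nat \<Rightarrow> nat set set \<Rightarrow> nat set set" where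
  "heavy_ridges n d F = {\<tau> \<in> ridges n d. 2 \<le> degree_in F \<tau>}"

lemma finite_ridges: "finite (ridges n d)"
  unfolding ridges_def by (rule finite_subset[of _ "Pow {..<n}"]) auto

lemma finite_dfaces: "finite (dfaces n d)"
  unfolding dfaces_def by (rule finite_subset[of _ "Pow {..<n}"]) auto

text \<open>Unknowns are the core faces, equations the heavy ridges. Every other ridge lies in no
  core face, so its equation is trivial.\<close>

lemma ex_weighted_cycle_core:
  fixes w :: "nat \<Rightarrow> 'k::field"
  assumes F: "F \<subseteq> dfaces n d" and less: "card (heavy_ridges n d F) < card (core_faces d F)"
  shows "\<exists>z. weighted_cycle n d F w z"
proof -
  have fin: "finite (heavy_ridges n d F)" "finite (core_faces d F)"
    using finite_ridges finite_subset[OF F finite_dfaces] by (auto simp: heavy_ridges_def core_faces_def)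
  obtain z where z: "\<exists>\<sigma>\<in>core_faces d F. z \<sigma> \<noteq> 0"
    "\<forall>\<tau>\<in>heavy_ridges n d F. (\<Sum>\<sigma>\<in>core_faces d F. incidence w \<tau> \<sigma> * z \<sigma>) = 0"
    using underdetermined_system[OF fin less, of "incidence w"] by blast
  have "(\<Sum>\<sigma>\<in>core_faces d F. incidence w \<tau> \<sigma> * z \<sigma>) = 0" if \<tau>: "\<tau> \<subseteq> {..<n}" "card \<tau> = d" for \<tau>
  proof (cases "\<tau> \<in> heavy_ridges n d F")
    case False
    then have "\<not> \<tau> \<subseteq> \<sigma>" if "\<sigma> \<in> core_faces d F" for \<sigma>
      using that \<tau> by (auto simp: core_faces_def heavy_ridges_def ridges_def)
    then show ?thesis by (simp add: incidence_def)
  qed (use z in blast)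
  then show ?thesis
    using weighted_cycleI[OF F _ z(1)] by (auto simp: core_faces_def)
qed

text \<open>For graphs the rows of the weighted incidence matrix, scaled by the vertex weights, add up to
  zero, so one of the equations can be dropped.\<close>

lemma ex_weighted_cycle_graph:
  fixes w :: "nat \<Rightarrow> 'k::field"
  assumes F: "F \<subseteq> dfaces n 1" and R: "R \<subseteq> F" "R \<noteq> {}" and le: "card (\<Union>R) \<le> card R"
  shows "\<exists>z. weighted_cycle n 1 F w z"
proof -
  define V where "V = \<Union>R"
  have Rf: "\<sigma> \<subseteq> {..<n} \<and> card \<sigma> = 2" if "\<sigma> \<in> R" for \<sigma> using that R F by (auto simp: dfaces_def)
  have finR: "finite R" by (rule finite_subset[OF subset_trans[OF R(1) F] finite_dfaces])
  have "finite \<sigma>" if "\<sigma> \<in> R" for \<sigma> using Rf[OF that] finite_subset by blast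
  then have finV: "finite V" using finR by (auto simp: V_def)
  have out: "(\<Sum>\<sigma>\<in>R. incidence w {u} \<sigma> * z \<sigma>) = 0" if "u \<notin> V" for u z
    using that by (intro sum.neutral) (auto simp: V_def incidence_def)
  have pair: "incidence w {u} {u,v} = (-1) ^ (if u < v then 1 else 0) * w v" if "u \<noteq> v" for u v
  proof -
    have "{i\<in>{u}. i < v} = (if u < v then {u} else {})" by auto
    then show ?thesis using incidence_insert[of v "{u}" w] that by (simp add: insert_commute)
  qed
  have "\<exists>z. (\<exists>\<sigma>\<in>R. z \<sigma> \<noteq> 0) \<and> (\<forall>u. (\<Sum>\<sigma>\<in>R. incidence w {u} \<sigma> * z \<sigma>) = 0)"
  \<comment> \<open>If all weights on \<open>V\<close> vanish, the matrix is zero and any vector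
    works. Otherwise the dropped equation must belong to a vertex of nonzero weight, so that the
    dependency recovers it.\<close>
  proof (cases "\<exists>u\<in>V. w u \<noteq> 0")
    case False
    have "(\<Sum>\<sigma>\<in>R. incidence w {u} \<sigma> * 1) = 0" for u
    proof (rule sum.neutral, rule ballI)
      fix \<sigma> assume \<sigma>: "\<sigma> \<in> R"
      show "incidence w {u} \<sigma> * 1 = 0"
      proof (cases "u \<in> \<sigma>")
        case True
        obtain x y where "\<sigma> = {x,y}" "x \<noteq> y" using Rf[OF \<sigma>] by (auto simp: card_2_iff)
        then obtain v where v: "\<sigma> = {u,v}" "u \<noteq> v" using True by blast
        then have "w v = 0" using False \<sigma> by (auto simp: V_def)
        then show ?thesis using pair[OF v(2)] v by simp
      qed (simp add: incidence_def)
    qed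
    then show ?thesis using R(2) by (intro exI[of _ "\<lambda>_. 1"]) auto
  next
    case True
    then obtain u0 where u0: "u0 \<in> V" "w u0 \<noteq> 0" by blast
    let ?Q = "(\<lambda>u. {u}) ` (V - {u0})"
    have "card V > 0" using u0 finV card_gt_0_iff by blast
    then have "card ?Q < card R"
      using le u0 finV by (simp add: card_image V_def[symmetric])
    then obtain z where z: "\<exists>\<sigma>\<in>R. z \<sigma> \<noteq> 0" "\<forall>q\<in>?Q. (\<Sum>\<sigma>\<in>R. incidence w q \<sigma> * z \<sigma>) = 0"
      using underdetermined_system[of ?Q R "incidence w"] finV finR by blast
    define eq where "eq = (\<lambda>u. \<Sum>\<sigma>\<in>R. incidence w {u} \<sigma> * z \<sigma>)"
    \<comment> \<open>In the weighted sum of all rows, an edge \<open>{x, y}\<close> contributes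
      \<open>w x * w y\<close> with both signs.\<close>
    have "(\<Sum>u\<in>V. w u * eq u) = (\<Sum>u\<in>V. \<Sum>\<sigma>\<in>R. w u * (incidence w {u} \<sigma> * z \<sigma>))"
      by (simp add: eq_def sum_distrib_left)
    also have "\<dots> = (\<Sum>\<sigma>\<in>R. \<Sum>u\<in>V. w u * (incidence w {u} \<sigma> * z \<sigma>))" by (rule sum.swap)
    also have "\<dots> = 0"
    proof (rule sum.neutral, rule ballI)
      fix \<sigma> assume \<sigma>: "\<sigma> \<in> R"
      obtain x y where xy: "\<sigma> = {x,y}" "x \<noteq> y" using Rf[OF \<sigma>] by (auto simp: card_2_iff)
      have "(\<Sum>u\<in>V. w u * (incidence w {u} \<sigma> * z \<sigma>)) = (\<Sum>u\<in>{x,y}. w u * (incidence w {u} \<sigma> * z \<sigma>))"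
        by (rule sum.mono_neutral_right[OF finV]) (use xy \<sigma> in \<open>auto simp: V_def incidence_def\<close>)
      also have "\<dots> = w x * (incidence w {x} {x,y} * z \<sigma>) + w y * (incidence w {y} {y,x} * z \<sigma>)"
        using xy by (simp add: insert_commute)
      also have "\<dots> = 0"
        using xy(2) by (cases "x < y") (simp_all add: pair)
      finally show "(\<Sum>u\<in>V. w u * (incidence w {u} \<sigma> * z \<sigma>)) = 0" .
    qed
    finally have tot: "(\<Sum>u\<in>V. w u * eq u) = 0" .
    have other: "eq u = 0" if "u \<noteq> u0" for u
      using z(2) out[of u z] that by (cases "u \<in> V") (auto simp: eq_def)
    have "(\<Sum>u\<in>V. w u * eq u) = (\<Sum>u\<in>{u0}. w u * eq u)"
      by (rule sum.mono_neutral_right[OF finV]) (use u0 other in auto)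
    then have "eq u0 = 0" using tot u0 by simp
    then have "eq u = 0" for u using other by (cases "u = u0") auto
    then show ?thesis using z(1) unfolding eq_def by blast
  qed
  then obtain z where z: "\<exists>\<sigma>\<in>R. z \<sigma> \<noteq> 0" "\<And>u. (\<Sum>\<sigma>\<in>R. incidence w {u} \<sigma> * z \<sigma>) = 0" by blast
  have "(\<Sum>\<sigma>\<in>R. incidence w \<tau> \<sigma> * z \<sigma>) = 0" if "card \<tau> = 1" for \<tau>
    using that z(2) by (metis card_1_singletonE)
  then show ?thesis using weighted_cycleI[OF F R(1) z(1)] by blast
qed

section \<open>Random subsets\<close>

text \<open>Expectation over the random subset of \<open>S\<close> that keeps each element
  independently with probability \<open>p\<close>. As a finite sum it matches \<open>Yprob\<close>
  directly, and its algebraic identities hold for every real \<open>p\<close>.\<close>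

definition expct :: "real \<Rightarrow> 'a set \<Rightarrow> ('a set \<Rightarrow> real) \<Rightarrow> real" where
  "expct p S f = (\<Sum>F\<in>Pow S. p ^ card F * (1 - p) ^ (card S - card F) * f F)"

lemma expct_cong: "(\<And>F. F \<subseteq> S \<Longrightarrow> f F = g F) \<Longrightarrow> expct p S f = expct p S g"
  unfolding expct_def by (rule sum.cong) auto

lemma expct_add: "expct p S (\<lambda>F. f F + g F) = expct p S f + expct p S g"
  by (simp add: expct_def sum.distrib distrib_left)

lemma expct_diff: "expct p S (\<lambda>F. f F - g F) = expct p S f - expct p S g"
  by (simp add: expct_def sum_subtractf right_diff_distrib)

lemma expct_cmult: "expct p S (\<lambda>F. a * f F) = a * expct p S f"
  by (simp add: expct_def sum_distrib_left mult_ac)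

lemma expct_sum: "expct p S (\<lambda>F. \<Sum>i\<in>I. f i F) = (\<Sum>i\<in>I. expct p S (f i))"
  unfolding expct_def by (subst sum.swap) (simp add: sum_distrib_left)

lemma expct_mono:
  assumes "0 \<le> p" "p \<le> 1" and "\<And>F. F \<subseteq> S \<Longrightarrow> f F \<le> g F"
  shows "expct p S f \<le> expct p S g"
  unfolding expct_def by (rule sum_mono) (use assms in \<open>auto intro!: mult_left_mono\<close>)

lemma expct_empty: "expct p {} f = f {}"
  by (simp add: expct_def)

text \<open>Conditioning on whether \<open>s\<close> is kept; the inductions for independence and
  for the variance run through this identity.\<close>

lemma expct_insert:
  assumes "finite S" and "s \<notin> S"
  shows "expct p (insert s S) f = p * expct p S (\<lambda>F. f (insert s F)) + (1 - p) * expct p S f"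
proof -
  let ?t = "\<lambda>S F. p ^ card F * (1 - p) ^ (card S - card F)"
  have fin: "finite (Pow S)" "finite (insert s ` Pow S)" and disj: "Pow S \<inter> insert s ` Pow S = {}"
    using assms by auto
  have inj: "inj_on (insert s) (Pow S)"
  proof (rule inj_onI)
    fix F G assume FG: "F \<in> Pow S" "G \<in> Pow S" "insert s F = insert s G"
    then have "s \<notin> F" "s \<notin> G" using assms(2) by auto
    then show "F = G" using FG(3) by (metis insert_ident)
  qed
  have 1: "(\<Sum>F\<in>Pow S. ?t (insert s S) F * f F) = (1 - p) * expct p S f"
    unfolding expct_def sum_distrib_left
  proof (rule sum.cong[OF refl])
    fix F assume "F \<in> Pow S"
    then have "card F \<le> card S" using assms by (auto intro: card_mono)
    then show "?t (insert s S) F * f F = (1 - p) * (?t S F * f F)"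
      using assms by (simp add: Suc_diff_le mult_ac)
  qed
  have 2: "(\<Sum>F\<in>insert s ` Pow S. ?t (insert s S) F * f F) = p * expct p S (\<lambda>F. f (insert s F))"
    unfolding expct_def sum_distrib_left sum.reindex[OF inj]
  proof (rule sum.cong[OF refl])
    fix F assume F: "F \<in> Pow S"
    then have "finite F" "s \<notin> F" using assms finite_subset by auto
    then show "((\<lambda>F. ?t (insert s S) F * f F) \<circ> insert s) F = p * (?t S F * f (insert s F))"
      using assms by (simp add: mult_ac)
  qed
  show ?thesis
    unfolding expct_def[of p "insert s S"] Pow_insert sum.union_disjoint[OF fin disj] 1 2 by simp
qed

lemma expct_const: "finite S \<Longrightarrow> expct p S (\<lambda>_. a) = a"
  by (induction S rule: finite_induct) (auto simp: expct_empty expct_insert algebra_simps)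

text \<open>Independence of what happens on disjoint ground sets.\<close>

lemma expct_Un:
  assumes "finite A" and "finite B" and "A \<inter> B = {}"
  shows "expct p (A \<union> B) (\<lambda>F. f (F \<inter> A) * g (F \<inter> B)) = expct p A f * expct p B g"
  using assms
proof (induction A arbitrary: f rule: finite_induct)
  case empty
  have "expct p B (\<lambda>F. f {} * g (F \<inter> B)) = f {} * expct p B (\<lambda>F. g (F \<inter> B))"
    by (rule expct_cmult)
  also have "expct p B (\<lambda>F. g (F \<inter> B)) = expct p B g"
    by (rule expct_cong) (simp add: Int_absorb2)
  finally show ?case by (simp add: expct_empty)
next
  case (insert s A)
  have s: "s \<notin> A \<union> B" "s \<notin> B" "A \<inter> B = {}" using insert by auto
  have "expct p (insert s (A \<union> B)) (\<lambda>F. f (F \<inter> insert s A) * g (F \<inter> B)) =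
     p * expct p (A \<union> B) (\<lambda>F. f (insert s F \<inter> insert s A) * g (insert s F \<inter> B)) +
     (1 - p) * expct p (A \<union> B) (\<lambda>F. f (F \<inter> insert s A) * g (F \<inter> B))"
    by (rule expct_insert) (use insert s in auto)
  also have "expct p (A \<union> B) (\<lambda>F. f (insert s F \<inter> insert s A) * g (insert s F \<inter> B)) =
      expct p (A \<union> B) (\<lambda>F. f (insert s (F \<inter> A)) * g (F \<inter> B))"
  proof (rule expct_cong)
    fix F assume "F \<subseteq> A \<union> B"
    then have "F \<inter> insert s A = F \<inter> A" using s by auto
    then show "f (insert s F \<inter> insert s A) * g (insert s F \<inter> B) = f (insert s (F \<inter> A)) * g (F \<inter> B)"
      using s by (simp add: Int_insert_left)
  qed
  also have "\<dots> = expct p A (\<lambda>F. f (insert s F)) * expct p B g"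
    by (rule insert.IH) (use insert s in auto)
  also have "expct p (A \<union> B) (\<lambda>F. f (F \<inter> insert s A) * g (F \<inter> B)) =
      expct p (A \<union> B) (\<lambda>F. f (F \<inter> A) * g (F \<inter> B))"
  proof (rule expct_cong)
    fix F assume "F \<subseteq> A \<union> B"
    then have "F \<inter> insert s A = F \<inter> A" using s by auto
    then show "f (F \<inter> insert s A) * g (F \<inter> B) = f (F \<inter> A) * g (F \<inter> B)" by simp
  qed
  also have "\<dots> = expct p A f * expct p B g"
    by (rule insert.IH) (use insert s in auto)
  finally show ?case
    using insert s by (simp add: expct_insert algebra_simps)
qed

lemma expct_marginal:
  assumes "finite S" and "A \<subseteq> S"
  shows "expct p S (\<lambda>F. f (F \<inter> A)) = expct p A f"
proof -
  have "expct p (A \<union> (S - A)) (\<lambda>F. f (F \<inter> A) * 1) = expct p A f * expct p (S - A) (\<lambda>_. 1)"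
    by (rule expct_Un[where g = "\<lambda>_. 1"]) (use assms finite_subset in auto)
  moreover have "A \<union> (S - A) = S" using assms by auto
  ultimately show ?thesis using assms by (simp add: expct_const)
qed

lemma expct_prod:
  assumes "finite I" and "finite S" and "\<And>i. i \<in> I \<Longrightarrow> A i \<subseteq> S"
    and "\<And>i j. i \<in> I \<Longrightarrow> j \<in> I \<Longrightarrow> i \<noteq> j \<Longrightarrow> A i \<inter> A j = {}"
  shows "expct p S (\<lambda>F. \<Prod>i\<in>I. f i (F \<inter> A i)) = (\<Prod>i\<in>I. expct p (A i) (f i))"
  using assms
proof (induction I arbitrary: S rule: finite_induct)
  case empty
  then show ?case by (simp add: expct_const)
next
  case (insert k I)
  let ?B = "S - A k"
  have kS: "A k \<subseteq> S" using insert.prems(2) by simp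
  have dk: "A k \<inter> A i = {}" if "i \<in> I" for i
    using insert.prems(3)[of k i] insert.hyps that by blast
  have "expct p S (\<lambda>F. \<Prod>i\<in>insert k I. f i (F \<inter> A i)) =
      expct p S (\<lambda>F. f k (F \<inter> A k) * (\<Prod>i\<in>I. f i ((F \<inter> ?B) \<inter> A i)))"
  proof (rule expct_cong)
    fix F assume F: "F \<subseteq> S"
    have "(\<Prod>i\<in>I. f i (F \<inter> A i)) = (\<Prod>i\<in>I. f i ((F \<inter> ?B) \<inter> A i))"
    proof (rule prod.cong[OF refl])
      fix i assume "i \<in> I"
      then have "(F \<inter> ?B) \<inter> A i = F \<inter> A i" using F dk[of i] by blast
      then show "f i (F \<inter> A i) = f i ((F \<inter> ?B) \<inter> A i)" by simp
    qed
    then show "(\<Prod>i\<in>insert k I. f i (F \<inter> A i)) = f k (F \<inter> A k) * (\<Prod>i\<in>I. f i ((F \<inter> ?B) \<inter> A i))"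
      using insert.hyps by simp
  qed
  also have "\<dots> = expct p (A k \<union> ?B) (\<lambda>F. f k (F \<inter> A k) * (\<Prod>i\<in>I. f i ((F \<inter> ?B) \<inter> A i)))"
    using kS by (simp add: Un_absorb1)
  also have "\<dots> = expct p (A k) (f k) * expct p ?B (\<lambda>F. \<Prod>i\<in>I. f i (F \<inter> A i))"
  proof (rule expct_Un)
    show "finite (A k)" by (rule finite_subset[OF kS insert.prems(1)])
    show "finite ?B" using insert.prems(1) by simp
  qed auto
  also have "expct p ?B (\<lambda>F. \<Prod>i\<in>I. f i (F \<inter> A i)) = (\<Prod>i\<in>I. expct p (A i) (f i))"
  proof (rule insert.IH)
    fix i assume i: "i \<in> I"
    show "A i \<subseteq> ?B" using insert.prems(2)[of i] dk[OF i] i by blast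
  next
    fix i j assume "i \<in> I" "j \<in> I" "i \<noteq> j"
    then show "A i \<inter> A j = {}" using insert.prems(3) by simp
  qed (use insert.prems(1) in simp)
  finally show ?case using insert.hyps by simp
qed

section \<open>Elementary events and second moment bounds\<close>

lemma expct_superset:
  assumes "finite S" and "A \<subseteq> S"
  shows "expct p S (\<lambda>F. of_bool (A \<subseteq> F)) = p ^ card A"
proof -
  have "expct p S (\<lambda>F. of_bool (A \<subseteq> F)) = expct p S (\<lambda>F. of_bool (A \<subseteq> F \<inter> A))"
    by (rule expct_cong) auto
  also have "\<dots> = expct p A (\<lambda>F. of_bool (A \<subseteq> F))"
    by (rule expct_marginal[OF assms])
  also have "\<dots> = (\<Sum>F\<in>{A}. p ^ card F * (1 - p) ^ (card A - card F) * of_bool (A \<subseteq> F))"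
    unfolding expct_def
    by (rule sum.mono_neutral_right) (use assms finite_subset in auto)
  finally show ?thesis by simp
qed

lemma expct_eq_empty:
  fixes A :: "'a set"
  assumes "finite A"
  shows "expct p A (\<lambda>F. of_bool (F = {})) = (1 - p) ^ card A"
proof -
  have "expct p A (\<lambda>F. of_bool (F = {})) =
      (\<Sum>F\<in>{{} :: 'a set}. p ^ card F * (1 - p) ^ (card A - card F) * of_bool (F = {}))"
    unfolding expct_def by (rule sum.mono_neutral_right) (use assms in auto)
  then show ?thesis by simp
qed

lemma expct_card_eq_1:
  assumes "finite A"
  shows "expct p A (\<lambda>F. of_bool (card F = 1)) = real (card A) * p * (1 - p) ^ (card A - 1)"
proof -
  have "expct p A (\<lambda>F. of_bool (card F = 1)) =
      (\<Sum>F\<in>(\<lambda>x. {x}) ` A. p ^ card F * (1 - p) ^ (card A - card F) * of_bool (card F = 1))"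
    unfolding expct_def
    by (rule sum.mono_neutral_right) (use assms in \<open>auto simp: card_1_singleton_iff\<close>)
  also have "\<dots> = (\<Sum>x\<in>A. p * (1 - p) ^ (card A - 1))"
    by (subst sum.reindex) auto
  finally show ?thesis by simp
qed

text \<open>A form of the Efron-Stein inequality. Conditioning on one element splits the variance
  into the mean of the two conditional variances plus \<open>p * (1 - p)\<close> times the squared
  gap of the conditional means. The factor \<open>p\<close> is essential: for the
  \<open>d\<close>-faces, \<open>card S * p\<close> is of the order of the number of ridges, while
  \<open>card S\<close> is larger by a factor of order \<open>n\<close>.\<close>

lemma variance_le_bounded_differences:
  assumes "finite S" and p: "0 \<le> p" "p \<le> 1"
    and "\<And>s F. s \<in> S \<Longrightarrow> F \<subseteq> S \<Longrightarrow> s \<notin> F \<Longrightarrow> \<bar>f (insert s F) - f F\<bar> \<le> L"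
  shows "expct p S (\<lambda>F. (f F)\<^sup>2) - (expct p S f)\<^sup>2 \<le> real (card S) * p * L\<^sup>2"
  using assms(1,4)
proof (induction S arbitrary: f rule: finite_induct)
  case empty
  then show ?case by (simp add: expct_empty)
next
  case (insert s S)
  let ?f = "\<lambda>F. f (insert s F)"
  define A where "A = expct p S ?f"
  define B where "B = expct p S f"
  define A2 where "A2 = expct p S (\<lambda>F. (?f F)\<^sup>2)"
  define B2 where "B2 = expct p S (\<lambda>F. (f F)\<^sup>2)"
  have IH1: "A2 - A\<^sup>2 \<le> real (card S) * p * L\<^sup>2"
    unfolding A2_def A_def
  proof (rule insert.IH)
    fix t F assume t: "t \<in> S" "F \<subseteq> S" "t \<notin> F"
    then have "\<bar>f (insert t (insert s F)) - f (insert s F)\<bar> \<le> L"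
      using insert.prems[of t "insert s F"] insert.hyps by auto
    then show "\<bar>f (insert s (insert t F)) - f (insert s F)\<bar> \<le> L" by (simp add: insert_commute)
  qed
  have IH2: "B2 - B\<^sup>2 \<le> real (card S) * p * L\<^sup>2"
    unfolding B2_def B_def by (rule insert.IH) (use insert.prems in auto)
  have d: "\<bar>?f F - f F\<bar> \<le> L" if "F \<subseteq> S" for F
    using insert.prems[of s F] insert.hyps that by auto
  have "A - B \<le> L"
  proof -
    have "A - B = expct p S (\<lambda>F. ?f F - f F)" by (simp add: A_def B_def expct_diff)
    also have "\<dots> \<le> expct p S (\<lambda>_. L)" by (rule expct_mono[OF p]) (use d in \<open>simp add: abs_le_iff\<close>)
    finally show ?thesis using insert.hyps by (simp add: expct_const)
  qed
  moreover have "B - A \<le> L"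
  proof -
    have "B - A = expct p S (\<lambda>F. f F - ?f F)" by (simp add: A_def B_def expct_diff)
    also have "\<dots> \<le> expct p S (\<lambda>_. L)" by (rule expct_mono[OF p]) (use d in \<open>simp add: abs_le_iff\<close>)
    finally show ?thesis using insert.hyps by (simp add: expct_const)
  qed
  ultimately have "(A - B)\<^sup>2 \<le> L\<^sup>2" by (intro power2_le_iff_abs_le[THEN iffD2]) auto
  then have AB: "p * (1 - p) * (A - B)\<^sup>2 \<le> p * 1 * L\<^sup>2"
    using p by (intro mult_mono) auto
  have "expct p (insert s S) (\<lambda>F. (f F)\<^sup>2) - (expct p (insert s S) f)\<^sup>2 =
      p * A2 + (1 - p) * B2 - (p * A + (1 - p) * B)\<^sup>2"
    using insert.hyps by (simp add: expct_insert A_def B_def A2_def B2_def)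
  also have "\<dots> = p * (A2 - A\<^sup>2) + (1 - p) * (B2 - B\<^sup>2) + p * (1 - p) * (A - B)\<^sup>2"
    by (simp add: power2_eq_square algebra_simps)
  also have "\<dots> \<le> p * (real (card S) * p * L\<^sup>2) + (1 - p) * (real (card S) * p * L\<^sup>2) + p * 1 * L\<^sup>2"
    using IH1 IH2 AB p by (intro add_mono mult_left_mono) auto
  also have "\<dots> = real (card (insert s S)) * p * L\<^sup>2"
    using insert.hyps by (simp add: algebra_simps)
  finally show ?case .
qed

text \<open>Chebyshev: where \<open>f F \<le> 0\<close>, the deviation from the positive mean is at
  least the mean.\<close>

lemma expct_nonpos_le:
  assumes S: "finite S" and p: "0 \<le> p" "p \<le> 1" and pos: "0 < expct p S f"
  shows "expct p S (\<lambda>F. of_bool (f F \<le> 0)) \<le>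
    (expct p S (\<lambda>F. (f F)\<^sup>2) - (expct p S f)\<^sup>2) / (expct p S f)\<^sup>2"
proof -
  define \<mu> where "\<mu> = expct p S f"
  have "\<mu>\<^sup>2 * expct p S (\<lambda>F. of_bool (f F \<le> 0)) = expct p S (\<lambda>F. \<mu>\<^sup>2 * of_bool (f F \<le> 0))"
    by (simp add: expct_cmult)
  also have "\<dots> \<le> expct p S (\<lambda>F. (f F)\<^sup>2 + (\<mu>\<^sup>2 - (2 * \<mu>) * f F))"
  proof (rule expct_mono[OF p])
    fix F
    have "0 \<le> (f F)\<^sup>2 + (\<mu>\<^sup>2 - (2 * \<mu>) * f F)"
      using zero_le_power2[of "f F - \<mu>"] by (simp add: power2_diff mult_ac)
    moreover have "0 \<le> (f F)\<^sup>2 - (2 * \<mu>) * f F" if "f F \<le> 0"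
    proof -
      have "(2 * \<mu>) * f F \<le> 0" using that pos by (simp add: \<mu>_def mult_le_0_iff)
      moreover have "0 \<le> (f F)\<^sup>2" by simp
      ultimately show ?thesis by linarith
    qed
    ultimately show "\<mu>\<^sup>2 * of_bool (f F \<le> 0) \<le> (f F)\<^sup>2 + (\<mu>\<^sup>2 - (2 * \<mu>) * f F)"
      by (cases "f F \<le> 0") simp_all
  qed
  also have "\<dots> = expct p S (\<lambda>F. (f F)\<^sup>2) + (\<mu>\<^sup>2 - 2 * \<mu> * \<mu>)"
    unfolding expct_add expct_diff expct_cmult using S by (simp add: expct_const \<mu>_def)
  also have "\<dots> = expct p S (\<lambda>F. (f F)\<^sup>2) - \<mu>\<^sup>2" by (simp add: power2_eq_square)
  finally show ?thesis using pos by (simp add: \<mu>_def[symmetric] pos_le_divide_eq mult.commute)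
qed

section \<open>Core faces, heavy ridges and isolated ridges\<close>

definition cofaces :: "nat \<Rightarrow> nat \<Rightarrow> nat set \<Rightarrow> nat set set" where
  "cofaces n d \<tau> = {\<sigma> \<in> dfaces n d. \<tau> \<subseteq> \<sigma>}"

lemma card_dfaces: "card (dfaces n d) = n choose (d + 1)"
  unfolding dfaces_def using n_subsets[of "{..<n}" "d + 1"] by simp

lemma card_ridges: "card (ridges n d) = n choose d"
  unfolding ridges_def using n_subsets[of "{..<n}" d] by simp

lemma finite_cofaces: "finite (cofaces n d \<tau>)"
  unfolding cofaces_def using finite_dfaces by simp

lemma card_cofaces:
  assumes "\<tau> \<in> ridges n d"
  shows "card (cofaces n d \<tau>) = n - d"
proof -
  have \<tau>: "\<tau> \<subseteq> {..<n}" "card \<tau> = d" "finite \<tau>"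
    using assms finite_subset by (auto simp: ridges_def)
  have "cofaces n d \<tau> = (\<lambda>j. insert j \<tau>) ` ({..<n} - \<tau>)"
  proof (intro set_eqI iffI)
    fix \<sigma> assume "\<sigma> \<in> cofaces n d \<tau>"
    then have \<sigma>: "\<sigma> \<subseteq> {..<n}" "card \<sigma> = d + 1" "\<tau> \<subseteq> \<sigma>" by (auto simp: cofaces_def dfaces_def)
    then have "card (\<sigma> - \<tau>) = 1" using \<tau> by (simp add: card_Diff_subset)
    then obtain j where "\<sigma> - \<tau> = {j}" by (meson card_1_singletonE)
    then have "\<sigma> = insert j \<tau>" "j \<in> {..<n} - \<tau>" using \<sigma> by auto
    then show "\<sigma> \<in> (\<lambda>j. insert j \<tau>) ` ({..<n} - \<tau>)" by blast
  next
    fix \<sigma> assume "\<sigma> \<in> (\<lambda>j. insert j \<tau>) ` ({..<n} - \<tau>)"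
    then show "\<sigma> \<in> cofaces n d \<tau>" using \<tau> by (auto simp: cofaces_def dfaces_def)
  qed
  moreover have "inj_on (\<lambda>j. insert j \<tau>) ({..<n} - \<tau>)" by (auto simp: inj_on_def)
  ultimately show ?thesis using \<tau> by (simp add: card_image card_Diff_subset)
qed

lemma degree_in_eq:
  assumes "F \<subseteq> dfaces n d"
  shows "degree_in F \<tau> = card (F \<inter> cofaces n d \<tau>)"
proof -
  have "{\<sigma>\<in>F. \<tau> \<subseteq> \<sigma>} = F \<inter> cofaces n d \<tau>" using assms by (auto simp: cofaces_def)
  then show ?thesis by (simp add: degree_in_def)
qed

lemma cofaces_subset: "cofaces n d \<tau> \<subseteq> dfaces n d"
  by (auto simp: cofaces_def)

lemma expct_isolated:
  assumes "\<tau> \<in> ridges n d"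
  shows "expct p (dfaces n d) (\<lambda>F. of_bool (degree_in F \<tau> = 0)) = (1 - p) ^ (n - d)"
proof -
  have "expct p (dfaces n d) (\<lambda>F. of_bool (degree_in F \<tau> = 0)) =
      expct p (dfaces n d) (\<lambda>F. of_bool (F \<inter> cofaces n d \<tau> = {}))"
    by (rule expct_cong) (use finite_cofaces in \<open>simp add: degree_in_eq\<close>)
  also have "\<dots> = expct p (cofaces n d \<tau>) (\<lambda>F. of_bool (F = {}))"
    by (rule expct_marginal[OF finite_dfaces cofaces_subset])
  also have "\<dots> = (1 - p) ^ (n - d)"
    using expct_eq_empty[OF finite_cofaces] by (simp add: card_cofaces[OF assms])
  finally show ?thesis .
qed

lemma expct_heavy:
  assumes "\<tau> \<in> ridges n d"
  shows "expct p (dfaces n d) (\<lambda>F. of_bool (2 \<le> degree_in F \<tau>)) =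
    1 - (1 - p) ^ (n - d) - real (n - d) * p * (1 - p) ^ (n - d - 1)"
proof -
  let ?C = "cofaces n d \<tau>"
  have "expct p (dfaces n d) (\<lambda>F. of_bool (2 \<le> degree_in F \<tau>)) =
      expct p (dfaces n d) (\<lambda>F. of_bool (2 \<le> card (F \<inter> ?C)))"
    by (rule expct_cong) (simp add: degree_in_eq)
  also have "\<dots> = expct p ?C (\<lambda>F. of_bool (2 \<le> card F))"
    by (rule expct_marginal[OF finite_dfaces cofaces_subset])
  also have "\<dots> = expct p ?C (\<lambda>F. 1 - of_bool (F = {}) - of_bool (card F = 1))"
  proof (rule expct_cong)
    fix F assume "F \<subseteq> ?C"
    then have "finite F" using finite_cofaces finite_subset by blast
    then have "F = {} \<longleftrightarrow> card F = 0" by simp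
    then show "of_bool (2 \<le> card F) = (1 - of_bool (F = {}) - of_bool (card F = 1) :: real)"
      by (cases "card F = 0"; cases "card F = 1") auto
  qed
  also have "\<dots> = 1 - (1 - p) ^ card ?C - real (card ?C) * p * (1 - p) ^ (card ?C - 1)"
    unfolding expct_diff expct_const[OF finite_cofaces] expct_eq_empty[OF finite_cofaces]
      expct_card_eq_1[OF finite_cofaces] ..
  finally show ?thesis by (simp add: card_cofaces[OF assms])
qed

text \<open>The event asks for \<open>\<sigma>\<close> and, at each facet, for one further coface.
  Two distinct facets together span \<open>\<sigma>\<close>, so no other set of size
  \<open>d + 1\<close> contains both: with \<open>\<sigma>\<close> removed the coface sets are
  disjoint and the conditions independent.\<close>

lemma expct_core:
  assumes \<sigma>: "\<sigma> \<in> dfaces n d"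
  shows "expct p (dfaces n d) (\<lambda>F. of_bool (\<sigma> \<in> core_faces d F)) =
    p * (1 - (1 - p) ^ (n - d - 1)) ^ (d + 1)"
proof -
  have \<sigma>': "\<sigma> \<subseteq> {..<n}" "card \<sigma> = d + 1" "finite \<sigma>"
    using \<sigma> finite_subset by (auto simp: dfaces_def)
  define B where "B = {\<tau>. \<tau> \<subseteq> \<sigma> \<and> card \<tau> = d}"
  \<comment> \<open>The index \<open>\<sigma>\<close>, which is not one of its facets, stands for
    the condition that \<open>\<sigma>\<close> itself is chosen, so one product covers
    everything.\<close>
  define A where "A = (\<lambda>i. if i = \<sigma> then {\<sigma>} else cofaces n d i - {\<sigma>})"
  have finB: "finite B" unfolding B_def by (rule finite_subset[of _ "Pow \<sigma>"]) (use \<sigma>' in auto)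
  have \<sigma>B: "\<sigma> \<notin> B" using \<sigma>' by (auto simp: B_def)
  have cB: "card B = d + 1"
    unfolding B_def using n_subsets[OF \<sigma>'(3), of d] \<sigma>'(2) by simp
  have BR: "\<tau> \<in> ridges n d" if "\<tau> \<in> B" for \<tau> using that \<sigma>' by (auto simp: B_def ridges_def)
  have \<sigma>c: "\<sigma> \<in> cofaces n d \<tau>" if "\<tau> \<in> B" for \<tau> using that \<sigma> by (auto simp: B_def cofaces_def)
  have A\<sigma>: "A \<sigma> = {\<sigma>}" and A\<tau>: "\<tau> \<in> B \<Longrightarrow> A \<tau> = cofaces n d \<tau> - {\<sigma>}" for \<tau>
    using \<sigma>B by (auto simp: A_def)
  have sub: "A i \<subseteq> dfaces n d" for i using \<sigma> cofaces_subset by (auto simp: A_def)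
  have disjB: "A i \<inter> A j = {}" if "i \<in> B" "j \<in> B" "i \<noteq> j" for i j
  proof (rule ccontr)
    assume "A i \<inter> A j \<noteq> {}"
    then obtain \<rho> where "\<rho> \<in> A i" "\<rho> \<in> A j" by blast
    then have \<rho>: "\<rho> \<in> dfaces n d" "i \<union> j \<subseteq> \<rho>" "\<rho> \<noteq> \<sigma>"
      using that A\<tau> by (auto simp: cofaces_def)
    have fin: "finite i" "finite j" and ci: "card i = d" "card j = d" and ij: "i \<union> j \<subseteq> \<sigma>"
      using that \<sigma>' finite_subset by (auto simp: B_def)
    have "i \<subset> i \<union> j"
      using that(3) ci fin by (metis Un_upper1 card_subset_eq psubsetI sup.absorb_iff1 sup_ge2)
    then have "d < card (i \<union> j)" using psubset_card_mono[of "i \<union> j" i] fin ci by auto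
    then have "i \<union> j = \<sigma>"
      using card_seteq[OF \<sigma>'(3) ij] \<sigma>' by simp
    then have "\<sigma> \<subseteq> \<rho>" using \<rho> by simp
    moreover have "finite \<rho>" "card \<rho> = d + 1" using \<rho>(1) finite_subset by (auto simp: dfaces_def)
    ultimately have "\<sigma> = \<rho>" using card_subset_eq \<sigma>'(2) by metis
    then show False using \<rho> by simp
  qed
  have disj: "A i \<inter> A j = {}" if ij: "i \<in> insert \<sigma> B" "j \<in> insert \<sigma> B" "i \<noteq> j" for i j
  proof -
    consider "i = \<sigma>" "j \<in> B" | "j = \<sigma>" "i \<in> B" | "i \<in> B" "j \<in> B" using ij by blast
    then show ?thesis
      by cases (use A\<sigma> A\<tau> disjB ij(3) in auto)
  qed
  have "expct p (dfaces n d) (\<lambda>F. of_bool (\<sigma> \<in> core_faces d F)) =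
      expct p (dfaces n d) (\<lambda>F. \<Prod>i\<in>insert \<sigma> B. of_bool (F \<inter> A i \<noteq> {}))"
  proof (rule expct_cong)
    fix F assume F: "F \<subseteq> dfaces n d"
    have finF: "finite F" using F finite_dfaces finite_subset by blast
    have deg: "2 \<le> degree_in F \<tau> \<longleftrightarrow> F \<inter> A \<tau> \<noteq> {}" if "\<tau> \<in> B" "\<sigma> \<in> F" for \<tau>
    proof -
      have "F \<inter> cofaces n d \<tau> = insert \<sigma> (F \<inter> A \<tau>)" "\<sigma> \<notin> F \<inter> A \<tau>"
        using that A\<tau> \<sigma>c by auto
      then have "degree_in F \<tau> = Suc (card (F \<inter> A \<tau>))"
        using finF by (simp add: degree_in_eq[OF F])
      then show ?thesis using finF by (simp add: Suc_le_eq card_gt_0_iff numeral_2_eq_2)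
    qed
    have "\<sigma> \<in> core_faces d F \<longleftrightarrow> (\<forall>i\<in>insert \<sigma> B. F \<inter> A i \<noteq> {})"
    proof (cases "\<sigma> \<in> F")
      case True
      then have "\<sigma> \<in> core_faces d F \<longleftrightarrow> (\<forall>\<tau>\<in>B. 2 \<le> degree_in F \<tau>)" by (auto simp: core_faces_def B_def)
      then show ?thesis using deg True A\<sigma> by simp
    next
      case False
      then show ?thesis using A\<sigma> by (simp add: core_faces_def)
    qed
    moreover have "(\<Prod>i\<in>I. of_bool (P i)) = (of_bool (\<forall>i\<in>I. P i) :: real)" if "finite I"
      for I :: "nat set set" and P
      using that by (induction I rule: finite_induct) auto
    ultimately show "of_bool (\<sigma> \<in> core_faces d F) = (\<Prod>i\<in>insert \<sigma> B. of_bool (F \<inter> A i \<noteq> {}) :: real)"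
      using finB by (simp only: finite_insert)
  qed
  also have "\<dots> = (\<Prod>i\<in>insert \<sigma> B. expct p (A i) (\<lambda>G. of_bool (G \<noteq> {})))"
    by (rule expct_prod[where f = "\<lambda>_ G. of_bool (G \<noteq> {})"])
      (use finB finite_dfaces sub disj in auto)
  also have "\<dots> = (\<Prod>i\<in>insert \<sigma> B. 1 - (1 - p) ^ card (A i))"
  proof (rule prod.cong[OF refl])
    fix i
    have fin: "finite (A i)" using sub finite_dfaces finite_subset by blast
    have "expct p (A i) (\<lambda>G. of_bool (G \<noteq> {})) = expct p (A i) (\<lambda>G. 1 - of_bool (G = {}))"
      by (rule expct_cong) simp
    then show "expct p (A i) (\<lambda>G. of_bool (G \<noteq> {})) = 1 - (1 - p) ^ card (A i)"
      by (simp only: expct_diff expct_const[OF fin] expct_eq_empty[OF fin])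
  qed
  also have "\<dots> = p * (\<Prod>i\<in>B. 1 - (1 - p) ^ (n - d - 1))"
  proof -
    have "card (A \<tau>) = n - d - 1" if "\<tau> \<in> B" for \<tau>
      using A\<tau>[OF that] \<sigma>c[OF that] card_cofaces[OF BR[OF that]] finite_cofaces by simp
    then show ?thesis using finB \<sigma>B A\<sigma> by simp
  qed
  finally show ?thesis using cB by simp
qed

text \<open>Unknowns minus equations of the system for weighted cycles.\<close>

definition excess :: "nat \<Rightarrow> nat \<Rightarrow> nat set set \<Rightarrow> real" where
  "excess n d F = real (card (core_faces d F)) - real (card (heavy_ridges n d F))"

definition isolated_count :: "nat \<Rightarrow> nat \<Rightarrow> nat set set \<Rightarrow> real" where
  "isolated_count n d F = real (card {\<tau> \<in> ridges n d. degree_in F \<tau> = 0})"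

lemma real_card_filter: "finite A \<Longrightarrow> real (card {x\<in>A. P x}) = (\<Sum>x\<in>A. of_bool (P x))"
  by (simp add: of_bool_def sum.If_cases Int_def)

lemma expct_isolated_count:
  "expct p (dfaces n d) (isolated_count n d) = real (n choose d) * (1 - p) ^ (n - d)"
proof -
  have "expct p (dfaces n d) (isolated_count n d) =
     expct p (dfaces n d) (\<lambda>F. \<Sum>\<tau>\<in>ridges n d. of_bool (degree_in F \<tau> = 0))"
    unfolding isolated_count_def real_card_filter[OF finite_ridges] ..
  also have "\<dots> = (\<Sum>\<tau>\<in>ridges n d. (1 - p) ^ (n - d))"
    unfolding expct_sum by (rule sum.cong) (auto simp: expct_isolated)
  finally show ?thesis by (simp add: card_ridges)
qed

lemma expct_excess:
  "expct p (dfaces n d) (excess n d) =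
     real (n choose (d + 1)) * (p * (1 - (1 - p) ^ (n - d - 1)) ^ (d + 1))
     - real (n choose d) * (1 - (1 - p) ^ (n - d) - real (n - d) * p * (1 - p) ^ (n - d - 1))"
proof -
  have "expct p (dfaces n d) (excess n d) =
     expct p (dfaces n d) (\<lambda>F. (\<Sum>\<sigma>\<in>dfaces n d. of_bool (\<sigma> \<in> core_faces d F)) -
       (\<Sum>\<tau>\<in>ridges n d. of_bool (2 \<le> degree_in F \<tau>)))"
  proof (rule expct_cong)
    fix F assume F: "F \<subseteq> dfaces n d"
    have "core_faces d F = {\<sigma>\<in>dfaces n d. \<sigma> \<in> core_faces d F}" using F by (auto simp: core_faces_def)
    then have "real (card (core_faces d F)) = (\<Sum>\<sigma>\<in>dfaces n d. of_bool (\<sigma> \<in> core_faces d F))"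
      using real_card_filter[OF finite_dfaces] by metis
    then show "excess n d F = (\<Sum>\<sigma>\<in>dfaces n d. of_bool (\<sigma> \<in> core_faces d F)) -
       (\<Sum>\<tau>\<in>ridges n d. of_bool (2 \<le> degree_in F \<tau>))"
      unfolding excess_def heavy_ridges_def real_card_filter[OF finite_ridges] by simp
  qed
  also have "\<dots> = (\<Sum>\<sigma>\<in>dfaces n d. p * (1 - (1 - p) ^ (n - d - 1)) ^ (d + 1)) -
      (\<Sum>\<tau>\<in>ridges n d. 1 - (1 - p) ^ (n - d) - real (n - d) * p * (1 - p) ^ (n - d - 1))"
    unfolding expct_diff expct_sum
    by (intro arg_cong2[of _ _ _ _ "(-)"] sum.cong refl) (auto simp: expct_core expct_heavy)
  finally show ?thesis by (simp add: card_ridges card_dfaces)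
qed

section \<open>Effect of one additional face on the counts\<close>

lemma degree_in_insert:
  assumes "finite F" and "s \<notin> F"
  shows "degree_in (insert s F) \<tau> = degree_in F \<tau> + of_bool (\<tau> \<subseteq> s)"
proof -
  have "{\<sigma>\<in>insert s F. \<tau> \<subseteq> \<sigma>} = (if \<tau> \<subseteq> s then insert s {\<sigma>\<in>F. \<tau> \<subseteq> \<sigma>} else {\<sigma>\<in>F. \<tau> \<subseteq> \<sigma>})"
    by auto
  moreover have "card (insert s {\<sigma>\<in>F. \<tau> \<subseteq> \<sigma>}) = Suc (card {\<sigma>\<in>F. \<tau> \<subseteq> \<sigma>})"
    by (rule card_insert_disjoint) (use assms in auto)
  ultimately show ?thesis unfolding degree_in_def by (cases "\<tau> \<subseteq> s") simp_all
qed

lemma facets_of_dface: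
  assumes "s \<in> dfaces n d"
  shows "finite {\<tau>. \<tau> \<subseteq> s \<and> card \<tau> = d}" and "card {\<tau>. \<tau> \<subseteq> s \<and> card \<tau> = d} = d + 1"
proof -
  have "finite s" "card s = d + 1" using assms finite_subset by (auto simp: dfaces_def)
  then show "finite {\<tau>. \<tau> \<subseteq> s \<and> card \<tau> = d}" "card {\<tau>. \<tau> \<subseteq> s \<and> card \<tau> = d} = d + 1"
    using n_subsets[of s d] by (auto intro: finite_subset[of _ "Pow s"])
qed

lemma isolated_count_insert:
  assumes s: "s \<in> dfaces n d" "s \<notin> F" and F: "F \<subseteq> dfaces n d"
  shows "\<bar>isolated_count n d (insert s F) - isolated_count n d F\<bar> \<le> real (d + 1)"
proof -
  let ?B = "{\<tau>. \<tau> \<subseteq> s \<and> card \<tau> = d}"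
  have finF: "finite F" by (rule finite_subset[OF F finite_dfaces])
  note finB = facets_of_dface(1)[OF s(1)] and cardB = facets_of_dface(2)[OF s(1)]
  let ?I = "\<lambda>F. {\<tau> \<in> ridges n d. degree_in F \<tau> = 0}"
  have sub: "?I (insert s F) \<subseteq> ?I F" and sub': "?I F - ?I (insert s F) \<subseteq> ?B"
    using degree_in_insert[OF finF s(2)] by (auto simp: ridges_def)
  have "card (?I F) - card (?I (insert s F)) = card (?I F - ?I (insert s F))"
    using sub finite_ridges by (intro card_Diff_subset[symmetric]) (auto intro: finite_subset)
  also have "\<dots> \<le> d + 1" using card_mono[OF finB sub'] cardB by simp
  finally show ?thesis
    using card_mono[OF _ sub] finite_ridges unfolding isolated_count_def by simp
qed

text \<open>Both counts only grow. New heavy ridges are facets of \<open>s\<close>. A face other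
  than \<open>s\<close> becomes a core face only through a facet shared with \<open>s\<close> whose
  degree was 1, and such a facet determines the face: at most \<open>d + 1\<close> of these, plus
  \<open>s\<close>. Both increments lie between 0 and \<open>d + 2\<close>, hence the bound on their
  difference.\<close>

lemma excess_insert:
  assumes s: "s \<in> dfaces n d" "s \<notin> F" and F: "F \<subseteq> dfaces n d"
  shows "\<bar>excess n d (insert s F) - excess n d F\<bar> \<le> real (d + 2)"
proof -
  let ?B = "{\<tau>. \<tau> \<subseteq> s \<and> card \<tau> = d}"
  have finF: "finite F" by (rule finite_subset[OF F finite_dfaces])
  note finB = facets_of_dface(1)[OF s(1)] and cardB = facets_of_dface(2)[OF s(1)]
  let ?H = "heavy_ridges n d" and ?C = "core_faces d"
  have fin: "finite (?H G)" "finite G \<Longrightarrow> finite (?C G)" for G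
    using finite_ridges by (auto simp: heavy_ridges_def core_faces_def)
  have subH: "?H F \<subseteq> ?H (insert s F)" and subH': "?H (insert s F) - ?H F \<subseteq> ?B"
    using degree_in_insert[OF finF s(2)] by (auto simp: heavy_ridges_def ridges_def)
  have "card (?H (insert s F)) - card (?H F) = card (?H (insert s F) - ?H F)"
    using subH fin by (intro card_Diff_subset[symmetric]) auto
  also have "\<dots> \<le> d + 1" using card_mono[OF finB subH'] cardB by simp
  finally have H: "card (?H (insert s F)) \<le> card (?H F) + (d + 1)" by simp
  have H': "card (?H F) \<le> card (?H (insert s F))" using card_mono[OF fin(1) subH] .
  have subC: "?C F \<subseteq> ?C (insert s F)"
  proof
    fix \<sigma> assume \<sigma>: "\<sigma> \<in> ?C F"
    have "degree_in F \<tau> \<le> degree_in (insert s F) \<tau>" for \<tau>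
      unfolding degree_in_insert[OF finF s(2)] by simp
    then show "\<sigma> \<in> ?C (insert s F)"
      using \<sigma> order_trans unfolding core_faces_def by blast
  qed
  let ?U = "\<Union>\<tau>\<in>{\<tau>\<in>?B. degree_in F \<tau> = 1}. {\<sigma>\<in>F. \<tau> \<subseteq> \<sigma>}"
  have subC': "?C (insert s F) - ?C F \<subseteq> insert s ?U"
  proof
    fix \<sigma> assume \<sigma>: "\<sigma> \<in> ?C (insert s F) - ?C F"
    show "\<sigma> \<in> insert s ?U"
    proof (cases "\<sigma> = s")
      case False
      then have \<sigma>F: "\<sigma> \<in> F" using \<sigma> by (auto simp: core_faces_def)
      then obtain \<tau> where \<tau>: "\<tau> \<subseteq> \<sigma>" "card \<tau> = d" "\<not> 2 \<le> degree_in F \<tau>"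
        using \<sigma> by (auto simp: core_faces_def)
      then have "2 \<le> degree_in (insert s F) \<tau>" using \<sigma> by (auto simp: core_faces_def)
      then have "\<tau> \<subseteq> s \<and> degree_in F \<tau> = 1"
        using \<tau>(3) unfolding degree_in_insert[OF finF s(2), of \<tau>] by (cases "\<tau> \<subseteq> s") simp_all
      then have "\<tau> \<in> {\<tau>\<in>?B. degree_in F \<tau> = 1}" "\<sigma> \<in> {\<sigma>\<in>F. \<tau> \<subseteq> \<sigma>}" using \<tau> \<sigma>F by auto
      then show ?thesis by blast
    qed simp
  qed
  have "card ?U \<le> (\<Sum>\<tau>\<in>{\<tau>\<in>?B. degree_in F \<tau> = 1}. card {\<sigma>\<in>F. \<tau> \<subseteq> \<sigma>})"
    by (rule card_UN_le[OF finite_subset[OF _ finB]]) auto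
  also have "\<dots> = card {\<tau>\<in>?B. degree_in F \<tau> = 1}" by (simp add: degree_in_def)
  also have "\<dots> \<le> d + 1" using card_mono[OF finB, of "{\<tau>\<in>?B. degree_in F \<tau> = 1}"] cardB by auto
  finally have U: "card ?U \<le> d + 1" .
  have finU: "finite ?U" by (rule finite_subset[OF _ finF]) auto
  have "card (?C (insert s F)) - card (?C F) = card (?C (insert s F) - ?C F)"
    using subC fin finF by (intro card_Diff_subset[symmetric]) auto
  also have "\<dots> \<le> card (insert s ?U)" by (rule card_mono[OF _ subC']) (use finU in simp)
  also have "\<dots> \<le> d + 2" using U finU by (simp add: card_insert_if)
  finally have C: "card (?C (insert s F)) \<le> card (?C F) + (d + 2)" by simp
  have C': "card (?C F) \<le> card (?C (insert s F))"
    by (rule card_mono[OF _ subC]) (use fin finF in simp)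
  show ?thesis using H H' C C' unfolding excess_def by linarith
qed

section \<open>Asymptotics of the counts\<close>

lemma filterlim_choose_at_top:
  assumes "d \<ge> 1"
  shows "filterlim (\<lambda>n. real (n choose d)) at_top sequentially"
proof (rule filterlim_at_top_mono)
  show "filterlim (\<lambda>n. real n / real d) at_top sequentially"
    using assms filterlim_tendsto_pos_mult_at_top[OF tendsto_const _ filterlim_real_sequentially,
        of "inverse (real d)"]
    by (simp add: divide_inverse mult.commute)
  show "\<forall>\<^sub>F n in sequentially. real n / real d \<le> real (n choose d)"
    using eventually_ge_at_top[of d]
  proof eventually_elim
    fix n assume n: "d \<le> n"
    have "1 \<le> real n / real d" using n assms by simp
    then have "(real n / real d) ^ 1 \<le> (real n / real d) ^ d"
      using assms by (intro power_increasing) auto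
    also have "\<dots> \<le> real (n choose d)"
      using binomial_ge_n_over_k_pow_k[OF n, where 'a = real] by simp
    finally show "real n / real d \<le> real (n choose d)" by simp
  qed
qed

text \<open>Both sides count incident pairs of a ridge and a \<open>d\<close>-face. This converts
  the number of \<open>d\<close>-faces times \<open>c / n\<close> into about
  \<open>c / (d + 1)\<close> per ridge.\<close>

lemma choose_Suc_eq: "real (d + 1) * real (n choose (d + 1)) = real (n choose d) * real (n - d)"
proof -
  have "(d + 1) * (n choose (d + 1)) = n * ((n - 1) choose d)"
    using binomial_absorption[of d n] by simp
  also have "\<dots> = (n - d) * (n choose d)" by (rule binomial_absorb_comp[symmetric])
  finally have "real ((d + 1) * (n choose (d + 1))) = real ((n - d) * (n choose d))" by (rule arg_cong)
  then show ?thesis by (simp only: of_nat_mult mult.commute)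
qed

lemma choose_Suc_le: "real (n choose (d + 1)) \<le> real (n choose d) * real n"
proof -
  have "1 * real (n choose (d + 1)) \<le> real (d + 1) * real (n choose (d + 1))"
    by (intro mult_right_mono) auto
  also have "\<dots> \<le> real (n choose d) * real n"
    unfolding choose_Suc_eq by (intro mult_left_mono) auto
  finally show ?thesis by simp
qed

text \<open>The mean grows like \<open>\<delta> * (n choose d)\<close>, the variance is at most
  \<open>c * L\<^sup>2 * (n choose d)\<close>, so the ratio of variance to squared mean tends to
  0.\<close>

lemma expct_nonpos_tendsto_0:
  fixes f :: "nat \<Rightarrow> nat set set \<Rightarrow> real"
  assumes d: "d \<ge> 1" and c: "c \<ge> 0" and \<delta>: "\<delta> > 0"
    and lim: "(\<lambda>n. expct (c / real n) (dfaces n d) (f n) / real (n choose d)) \<longlonglongrightarrow> \<delta>"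
    and lip: "\<And>n s F. s \<in> dfaces n d \<Longrightarrow> s \<notin> F \<Longrightarrow> F \<subseteq> dfaces n d \<Longrightarrow> \<bar>f n (insert s F) - f n F\<bar> \<le> L"
  shows "(\<lambda>n. expct (c / real n) (dfaces n d) (\<lambda>F. of_bool (f n F \<le> 0))) \<longlonglongrightarrow> 0"
proof (rule tendsto_sandwich[of "\<lambda>_. 0" _ _ "\<lambda>n. (4 * c * L\<^sup>2 / \<delta>\<^sup>2) / real (n choose d)"])
  let ?E = "\<lambda>n. expct (c / real n) (dfaces n d)"
  have p: "\<forall>\<^sub>F n in sequentially. 0 \<le> c / real n \<and> c / real n \<le> 1 \<and> 0 < n"
  proof -
    have "\<forall>\<^sub>F n in sequentially. c \<le> real n"
      using filterlim_real_sequentially unfolding filterlim_at_top by blast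
    then show ?thesis
      using eventually_gt_at_top[of 0] by eventually_elim (use c in \<open>auto simp: divide_le_eq_1\<close>)
  qed
  show "\<forall>\<^sub>F n in sequentially. 0 \<le> ?E n (\<lambda>F. of_bool (f n F \<le> 0))"
    using p
  proof eventually_elim
    fix n assume "0 \<le> c / real n \<and> c / real n \<le> 1 \<and> 0 < n"
    then have "?E n (\<lambda>_. 0) \<le> ?E n (\<lambda>F. of_bool (f n F \<le> 0))" by (intro expct_mono) auto
    then show "0 \<le> ?E n (\<lambda>F. of_bool (f n F \<le> 0))" by (simp add: expct_const[OF finite_dfaces])
  qed
  have "\<forall>\<^sub>F n in sequentially. \<delta> / 2 < ?E n (f n) / real (n choose d)"
    using order_tendstoD(1)[OF lim, of "\<delta>/2"] \<delta> by simp
  then show "\<forall>\<^sub>F n in sequentially. ?E n (\<lambda>F. of_bool (f n F \<le> 0)) \<le> (4 * c * L\<^sup>2 / \<delta>\<^sup>2) / real (n choose d)"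
    using p eventually_ge_at_top[of d]
  proof eventually_elim
    fix n assume n: "\<delta> / 2 < ?E n (f n) / real (n choose d)"
      and p: "0 \<le> c / real n \<and> c / real n \<le> 1 \<and> 0 < n" and "d \<le> n"
    define C where "C = real (n choose d)"
    have C: "C > 0" using \<open>d \<le> n\<close> by (simp add: C_def)
    \<comment> \<open>Half of the limiting density, eventually exceeded; squaring it produces the
      constant 4.\<close>
    have \<mu>: "C * \<delta> / 2 < ?E n (f n)" using n C unfolding C_def[symmetric] by (simp add: field_simps)
    have "0 < C * \<delta> / 2" using C \<delta> by simp
    then have pos: "0 < ?E n (f n)" using \<mu> by linarith
    have "?E n (\<lambda>F. (f n F)\<^sup>2) - (?E n (f n))\<^sup>2 \<le> real (card (dfaces n d)) * (c / real n) * L\<^sup>2"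
      by (rule variance_le_bounded_differences[OF finite_dfaces]) (use p lip in auto)
    also have "\<dots> \<le> (C * real n) * (c / real n) * L\<^sup>2"
      unfolding card_dfaces C_def by (intro mult_right_mono choose_Suc_le) (use p in auto)
    also have "\<dots> = C * c * L\<^sup>2" using p by simp
    finally have var: "?E n (\<lambda>F. (f n F)\<^sup>2) - (?E n (f n))\<^sup>2 \<le> C * c * L\<^sup>2" .
    have "?E n (\<lambda>F. of_bool (f n F \<le> 0)) \<le> (?E n (\<lambda>F. (f n F)\<^sup>2) - (?E n (f n))\<^sup>2) / (?E n (f n))\<^sup>2"
      by (rule expct_nonpos_le[OF finite_dfaces]) (use p pos in auto)
    also have "\<dots> \<le> C * c * L\<^sup>2 / (?E n (f n))\<^sup>2"
      using var pos by (intro divide_right_mono) auto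
    also have "\<dots> \<le> C * c * L\<^sup>2 / (C * \<delta> / 2)\<^sup>2"
    proof (rule divide_left_mono)
      show "(C * \<delta> / 2)\<^sup>2 \<le> (?E n (f n))\<^sup>2" using \<mu> C \<delta> by (intro power_mono) auto
      show "0 \<le> C * c * L\<^sup>2" using C c by simp
      show "0 < (?E n (f n))\<^sup>2 * (C * \<delta> / 2)\<^sup>2" using pos C \<delta> by simp
    qed
    also have "\<dots> = (4 * c * L\<^sup>2 / \<delta>\<^sup>2) / C"
      using C \<delta> by (simp add: power2_eq_square field_simps)
    finally show "?E n (\<lambda>F. of_bool (f n F \<le> 0)) \<le> (4 * c * L\<^sup>2 / \<delta>\<^sup>2) / real (n choose d)"
      by (simp add: C_def)
  qed
  show "(\<lambda>n. (4 * c * L\<^sup>2 / \<delta>\<^sup>2) / real (n choose d)) \<longlonglongrightarrow> 0"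
    by (rule tendsto_divide_0[OF tendsto_const filterlim_at_top_imp_at_infinity[OF filterlim_choose_at_top[OF d]]])
qed simp

lemma one_minus_div_power_tendsto:
  fixes c :: real
  shows "(\<lambda>n. (1 - c / real n) ^ (n - k)) \<longlonglongrightarrow> exp (-c)"
proof -
  have c0: "(\<lambda>n. c / real n) \<longlonglongrightarrow> 0"
    by (rule tendsto_divide_0[OF tendsto_const filterlim_at_top_imp_at_infinity[OF filterlim_real_sequentially]])
  have 1: "(\<lambda>n. (1 - c / real n) ^ n) \<longlonglongrightarrow> exp (-c)"
    using tendsto_exp_limit_sequentially[of "-c"] by simp
  have 2: "(\<lambda>n. (1 - c / real n) ^ k) \<longlonglongrightarrow> (1 - 0) ^ k"
    by (intro tendsto_intros c0)
  have 3: "(\<lambda>n. (1 - c / real n) ^ n / (1 - c / real n) ^ k) \<longlonglongrightarrow> exp (-c) / (1 - 0) ^ k"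
    by (rule tendsto_divide[OF 1 2]) simp
  have "\<forall>\<^sub>F n in sequentially. c / real n < 1" using order_tendstoD(2)[OF c0] by simp
  then have "\<forall>\<^sub>F n in sequentially. (1 - c / real n) ^ n / (1 - c / real n) ^ k = (1 - c / real n) ^ (n - k)"
    using eventually_ge_at_top[of k]
    by eventually_elim (subst power_diff, auto)
  then show ?thesis using Lim_transform_eventually[OF 3] by simp
qed

lemma diff_mult_div_tendsto:
  fixes c :: real
  shows "(\<lambda>n. real (n - k) * (c / real n)) \<longlonglongrightarrow> c"
proof -
  have "(\<lambda>n. c - real k * (c / real n)) \<longlonglongrightarrow> c - real k * 0"
    by (intro tendsto_intros tendsto_divide_0[OF tendsto_const filterlim_at_top_imp_at_infinity[OF filterlim_real_sequentially]])
  moreover have "\<forall>\<^sub>F n in sequentially. c - real k * (c / real n) = real (n - k) * (c / real n)"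
    using eventually_ge_at_top[of "k + 1"]
  proof eventually_elim
    fix n assume "k + 1 \<le> n"
    then have "n \<noteq> 0" "real (n - k) = real n - real k" by auto
    then show "c - real k * (c / real n) = real (n - k) * (c / real n)"
      by (simp add: field_simps)
  qed
  ultimately show ?thesis using Lim_transform_eventually by fastforce
qed

lemma expct_isolated_count_tendsto:
  "(\<lambda>n. expct (c / real n) (dfaces n d) (isolated_count n d) / real (n choose d)) \<longlonglongrightarrow> exp (-c)"
proof (rule Lim_transform_eventually[OF one_minus_div_power_tendsto[of c d]])
  show "\<forall>\<^sub>F n in sequentially. (1 - c / real n) ^ (n - d) =
      expct (c / real n) (dfaces n d) (isolated_count n d) / real (n choose d)"
    using eventually_ge_at_top[of d] by eventually_elim (simp add: expct_isolated_count)
qed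

text \<open>Per ridge there are about \<open>c / (d + 1)\<close> chosen \<open>d\<close>-faces, each
  a core face with conditional probability near \<open>(1 - exp (-c)) ^ (d+1)\<close>; a ridge is
  heavy with probability near \<open>1 - (1 + c) * exp (-c)\<close>, as for a Poisson degree. This
  difference is where \<open>g_fun\<close> comes from.\<close>

lemma expct_excess_tendsto:
  "(\<lambda>n. expct (c / real n) (dfaces n d) (excess n d) / real (n choose d))
     \<longlonglongrightarrow> (g_fun d c - real (d + 1)) / real (d + 1)"
proof -
  let ?q = "\<lambda>n k. (1 - c / real n) ^ (n - k)"
  let ?h = "\<lambda>n. real (n - d) * (c / real n) / real (d + 1) * (1 - ?q n (d + 1)) ^ (d + 1)
     - (1 - ?q n d - real (n - d) * (c / real n) * ?q n (d + 1))"
  have "?h \<longlonglongrightarrow> c / real (d + 1) * (1 - exp (-c)) ^ (d + 1) - (1 - exp (-c) - c * exp (-c))"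
    by (intro tendsto_intros one_minus_div_power_tendsto diff_mult_div_tendsto) auto
  also have "c / real (d + 1) * (1 - exp (-c)) ^ (d + 1) - (1 - exp (-c) - c * exp (-c)) =
      (g_fun d c - real (d + 1)) / real (d + 1)"
    by (simp add: g_fun_def field_simps)
  finally have lim: "?h \<longlonglongrightarrow> (g_fun d c - real (d + 1)) / real (d + 1)" .
  show ?thesis
  proof (rule Lim_transform_eventually[OF lim])
    show "\<forall>\<^sub>F n in sequentially. ?h n = expct (c / real n) (dfaces n d) (excess n d) / real (n choose d)"
      using eventually_ge_at_top[of d]
    proof eventually_elim
      fix n assume "d \<le> n"
      define C where "C = real (n choose d)"
      have C: "C > 0" using \<open>d \<le> n\<close> by (simp add: C_def)
      have ch: "real (n choose (d + 1)) = C * real (n - d) / real (d + 1)"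
        using choose_Suc_eq[of d n] by (simp add: C_def field_simps)
      define P where "P = (1 - ?q n (d + 1)) ^ (d + 1)"
      define R where "R = 1 - ?q n d - real (n - d) * (c / real n) * ?q n (d + 1)"
      have "expct (c / real n) (dfaces n d) (excess n d) =
          C * real (n - d) / real (d + 1) * ((c / real n) * P) - C * R"
        unfolding expct_excess ch P_def R_def C_def[symmetric] by simp
      then have "expct (c / real n) (dfaces n d) (excess n d) / C =
          real (n - d) * (c / real n) / real (d + 1) * P - R"
        using C by (simp add: diff_divide_distrib mult_ac)
      then show "?h n = expct (c / real n) (dfaces n d) (excess n d) / real (n choose d)"
        unfolding P_def R_def C_def by simp
    qed
  qed
qed

section \<open>The threshold function\<close>

definition g_deriv :: "nat \<Rightarrow> real \<Rightarrow> real" where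
  "g_deriv d x = (1 - exp (-x)) ^ (d+1) - real (d+1) * x * exp (-x) * (1 - (1 - exp (-x)) ^ d)"

lemma g_fun_has_derivative: "(g_fun d has_real_derivative g_deriv d x) (at x)"
  unfolding g_fun_def[abs_def] g_deriv_def
  by (rule derivative_eq_intros refl)+ (simp add: algebra_simps)

text \<open>Convexity of \<open>exp\<close>: the slope of the chord from 0 increases. The tangent at
  \<open>x\<close> is used at the two points \<open>y\<close> and 0.\<close>

lemma exp_minus_one_slope_mono:
  fixes x y :: real
  assumes "0 < x" "x < y"
  shows "(exp x - 1) * y \<le> (exp y - 1) * x"
proof -
  have "exp x * (1 + (y - x)) \<le> exp x * exp (y - x)" by (intro mult_left_mono exp_ge_add_one_self) auto
  also have "\<dots> = exp y" by (simp add: exp_diff)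
  finally have 1: "exp x * (y - x) \<le> (exp y - 1) - (exp x - 1)" by (simp add: algebra_simps)
  have "exp x * (1 + (-x)) \<le> exp x * exp (-x)" by (intro mult_left_mono exp_ge_add_one_self) auto
  then have 2: "exp x - 1 \<le> x * exp x" by (simp add: exp_minus algebra_simps)
  have "(exp x - 1) * y = (exp x - 1) * x + (exp x - 1) * (y - x)" by (simp add: algebra_simps)
  also have "\<dots> \<le> (exp x - 1) * x + (x * exp x) * (y - x)"
    using 2 assms by (intro add_left_mono mult_right_mono) auto
  also have "\<dots> = (exp x - 1) * x + x * (exp x * (y - x))" by simp
  also have "\<dots> \<le> (exp x - 1) * x + x * ((exp y - 1) - (exp x - 1))"
    using 1 assms by (intro add_left_mono mult_left_mono) auto
  finally show ?thesis by (simp add: algebra_simps)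
qed

text \<open>With \<open>u = 1 - exp (- x)\<close>, the sign of the derivative is that of
  \<open>u^(d-1) / (1 + u + \<dots> + u^(d-1)) * (exp x - 1)^2 / x - (d + 1)\<close>, and both factors of the product are
  increasing in \<open>x\<close>.\<close>

lemma g_deriv_pos_mono:
  assumes d: "d \<ge> 1" and xy: "0 < x" "x < y" and nonneg: "g_deriv d x \<ge> 0"
  shows "g_deriv d y > 0"
proof -
  define u where "u = (\<lambda>x::real. 1 - exp (-x))"
  define E where "E = (\<lambda>x::real. exp x - 1)"
  define S where "S = (\<lambda>x. \<Sum>i<d. u x ^ i)"
  obtain k where k: "d = Suc k" using d by (cases d) auto
  have u01: "0 < u t" "u t < 1" if "t > 0" for t using that by (auto simp: u_def)
  have uE: "u t = E t * exp (-t)" for t by (simp add: u_def E_def exp_minus algebra_simps)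
  have Epos: "0 < E t" if "t > 0" for t using that by (simp add: E_def)
  have Spos: "0 < S t" if "t > 0" for t
  proof -
    have "0 < u t ^ 0" by simp
    also have "\<dots> \<le> S t" unfolding S_def
      by (rule member_le_sum) (use d u01[OF that] in auto)
    finally show ?thesis .
  qed
  \<comment> \<open>\<open>S t\<close> is the geometric sum coming from \<open>1 - u t ^ d\<close>,
    and \<open>u t = E t * exp (-t)\<close> turns two powers of \<open>u t\<close> into the square
    of \<open>E t\<close>.\<close>
  have gd: "g_deriv d t = (exp (-t))\<^sup>2 * (E t ^ 2 * u t ^ k - real (d+1) * t * S t)" for t
  proof -
    have "1 - u t ^ d = exp (-t) * S t"
      using one_diff_power_eq[of "u t" d] by (simp add: S_def u_def)
    moreover have "u t ^ (d+1) = (E t * exp (-t))\<^sup>2 * u t ^ k"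
      by (simp add: k power2_eq_square uE[symmetric])
    moreover have "g_deriv d t = u t ^ (d+1) - real (d+1) * t * exp (-t) * (1 - u t ^ d)"
      by (simp add: g_deriv_def u_def)
    ultimately have "g_deriv d t = (E t * exp (-t))\<^sup>2 * u t ^ k - real (d+1) * t * exp (-t) * (exp (-t) * S t)"
      by (simp only:)
    then show ?thesis by (simp add: power_mult_distrib power2_eq_square algebra_simps)
  qed
  have y0: "0 < y" using xy by simp
  have ux: "u x < u y" using xy by (simp add: u_def)
  \<comment> \<open>Monotonicity of \<open>u ^ k / S\<close>, compared term by term with
    denominators cleared; it rests on every exponent in \<open>S\<close> being at most
    \<open>k\<close>.\<close>
  have 1: "u x ^ k * S y \<le> u y ^ k * S x"
    unfolding S_def sum_distrib_left
  proof (rule sum_mono)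
    fix i assume "i \<in> {..<d}"
    then have i: "i \<le> k" by (simp add: k)
    have *: "a ^ k * b ^ i = (a * b) ^ i * a ^ (k - i)" for a b :: real
      using i by (simp add: power_mult_distrib flip: power_add)
    have "(u x * u y) ^ i * u x ^ (k - i) \<le> (u x * u y) ^ i * u y ^ (k - i)"
      using u01[OF xy(1)] ux by (intro mult_left_mono power_mono) auto
    then show "u x ^ k * u y ^ i \<le> u y ^ k * u x ^ i"
      unfolding * by (simp add: mult.commute)
  qed
  \<comment> \<open>Monotonicity of the square of \<open>E\<close> divided by the argument: one
    factor \<open>E\<close> increases strictly, the other is covered by the slope of the
    chord.\<close>
  have 2: "(E x)\<^sup>2 * y < (E y)\<^sup>2 * x"
  proof -
    have "E x < E y" using xy by (simp add: E_def)
    then have "(E x)\<^sup>2 * y < E y * (E x * y)"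
      using Epos[OF xy(1)] y0 by (simp add: power2_eq_square)
    also have "\<dots> \<le> E y * (E y * x)"
      using exp_minus_one_slope_mono[OF xy] Epos[OF y0] unfolding E_def by (intro mult_left_mono) auto
    finally show ?thesis by (simp add: power2_eq_square)
  qed
  have nx: "real (d+1) * x * S x \<le> (E x)\<^sup>2 * u x ^ k"
    using nonneg unfolding gd by (simp add: zero_le_mult_iff)
  have "(real (d+1) * y * S y) * (x * S x) = (real (d+1) * x * S x) * (y * S y)" by simp
  also have "\<dots> \<le> ((E x)\<^sup>2 * u x ^ k) * (y * S y)"
    using nx Spos[OF y0] y0 by (intro mult_right_mono) auto
  also have "\<dots> = ((E x)\<^sup>2 * y) * (u x ^ k * S y)" by simp
  also have "\<dots> < ((E y)\<^sup>2 * x) * (u x ^ k * S y)"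
    using 2 u01[OF xy(1)] Spos[OF y0] by (intro mult_strict_right_mono) auto
  also have "\<dots> \<le> ((E y)\<^sup>2 * x) * (u y ^ k * S x)"
    using 1 xy by (intro mult_left_mono) auto
  also have "\<dots> = ((E y)\<^sup>2 * u y ^ k) * (x * S x)" by simp
  finally have "real (d+1) * y * S y < (E y)\<^sup>2 * u y ^ k"
    using Spos[OF xy(1)] xy by (simp add: mult_less_cancel_right)
  then show ?thesis unfolding gd by simp
qed

text \<open>The value \<open>d + 1\<close> is also taken at 0, so Rolle gives a critical point
  \<open>\<xi>\<close> below the root \<open>r\<close>. Beyond \<open>\<xi>\<close> the derivative
  is positive, so the function increases strictly from \<open>r\<close> on; in particular there is
  no second positive root.\<close>

lemma g_fun_gt_after_root:
  assumes d: "d \<ge> 1" and r: "0 < r" "g_fun d r = real (d+1)" and y: "r < y"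
  shows "g_fun d y > real (d+1)"
proof -
  have "g_fun d 0 = g_fun d r" using r by (simp add: g_fun_def)
  moreover have "continuous_on {0..r} (g_fun d)"
    by (rule continuous_at_imp_continuous_on) (use g_fun_has_derivative DERIV_isCont in blast)
  ultimately obtain \<xi> where \<xi>: "0 < \<xi>" "\<xi> < r" "(g_fun d has_real_derivative 0) (at \<xi>)"
    using Rolle[OF r(1), of "g_fun d"] g_fun_has_derivative real_differentiable_def
    by (metis DERIV_unique has_real_derivative_iff_has_vector_derivative)
  then have "g_deriv d \<xi> = 0" using g_fun_has_derivative DERIV_unique by blast
  then have pos: "g_deriv d t > 0" if "\<xi> < t" for t using g_deriv_pos_mono[OF d \<xi>(1) that] by simp
  have "g_fun d r < g_fun d y"
    by (rule DERIV_pos_imp_increasing[OF y]) (use g_fun_has_derivative pos \<xi>(2) in force)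
  then show ?thesis using r by simp
qed

text \<open>Intermediate value theorem on the interval from \<open>1/2\<close> to
  \<open>d + 1\<close>; starting at \<open>1/2\<close> excludes the trivial solution 0.\<close>

lemma ex_g_fun_root:
  assumes d: "d \<ge> 1"
  shows "\<exists>x>0. g_fun d x = real (d+1)"
proof -
  \<comment> \<open>The Taylor bound \<open>exp (1/2) \<ge> 13/8\<close> gives at most
    \<open>3/2 * 8/13 = 12/13\<close> times \<open>d + 1\<close> for the first summand; the second
    is at most \<open>1/8\<close>, and \<open>1/8 \<le> (d + 1) / 13\<close> for
    \<open>d \<ge> 1\<close>.\<close>
  have low: "g_fun d (1/2) \<le> real (d+1)"
  proof -
    have "1 + 1/2 + (1/2)\<^sup>2 / 2 \<le> exp (1/2 :: real)" by (rule exp_lower_Taylor_quadratic) simp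
    then have "13/8 * exp (-1/2) \<le> exp (1/2 :: real) * exp (-1/2)"
      by (intro mult_right_mono) (auto simp: power2_eq_square)
    then have e: "exp (-1/2 :: real) \<le> 8/13" by (simp flip: exp_add)
    have e': "1/2 \<le> exp (-1/2 :: real)" using exp_ge_add_one_self[of "-1/2 :: real"] by simp
    have "(1 - exp (-1/2 :: real)) ^ (d+1) \<le> (1/2) ^ (d+1)"
      using e e' by (intro power_mono) auto
    also have "\<dots> \<le> (1/2) ^ 2" by (rule power_decreasing) (use d in auto)
    finally have p: "(1 - exp (-1/2 :: real)) ^ (d+1) \<le> 1/4" by (simp add: power2_eq_square)
    have "real (d+1) * (3/2) * exp (-1/2) \<le> real (d+1) * (3/2) * (8/13)"
      using e by (intro mult_left_mono) auto
    moreover have "g_fun d (1/2) = real (d+1) * (3/2) * exp (-1/2) + 1/2 * (1 - exp (-1/2)) ^ (d+1)"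
      by (simp add: g_fun_def)
    ultimately have "g_fun d (1/2) \<le> real (d+1) * (12/13) + 1/8"
      using p by linarith
    moreover have "1 \<le> real d" using d by simp
    ultimately show ?thesis by (simp add: field_simps)
  qed
  \<comment> \<open>For \<open>x = d + 1\<close> Bernoulli bounds the second summand below by
    \<open>x - x\<^sup>2 * exp (-x)\<close>; the first is \<open>(x\<^sup>2 + x) * exp (-x)\<close>,
    so \<open>x * exp (-x)\<close> is left over.\<close>
  have high: "real (d+1) \<le> g_fun d (real (d+1))"
  proof -
    let ?x = "real (d+1)"
    have "1 + real (d+1) * (- exp (- ?x)) \<le> (1 + (- exp (- ?x))) ^ (d+1)"
      by (rule Bernoulli_inequality) simp
    then have "?x * (1 - ?x * exp (- ?x)) \<le> ?x * (1 - exp (- ?x)) ^ (d+1)"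
      by (intro mult_left_mono) auto
    then have "?x + ?x * exp (- ?x) \<le> g_fun d ?x"
      by (simp add: g_fun_def algebra_simps)
    moreover have "0 \<le> ?x * exp (- ?x)" by simp
    ultimately show ?thesis by linarith
  qed
  have cont: "isCont (g_fun d) x" for x using g_fun_has_derivative DERIV_isCont by blast
  have "\<exists>x. 1/2 \<le> x \<and> x \<le> real (d+1) \<and> g_fun d x = real (d+1)"
    by (rule IVT[where f = "g_fun d"]) (use low high cont in auto)
  then show ?thesis by force
qed

lemma g_fun_gt:
  assumes "d \<ge> 2" and "c_const d < x"
  shows "0 < x" and "g_fun d x > real (d+1)"
proof -
  have d: "d \<ge> 1" using assms by simp
  obtain r where r: "0 < r" "g_fun d r = real (d+1)" using ex_g_fun_root[OF d] by blast
  have "c_const d = (THE x. x > 0 \<and> g_fun d x = real (d+1))" using assms by (simp add: c_const_def)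
  also have "\<dots> = r"
  proof (rule the_equality)
    fix s assume s: "s > 0 \<and> g_fun d s = real (d+1)"
    show "s = r"
      using g_fun_gt_after_root[OF d r, of s] g_fun_gt_after_root[OF d, of s r] s r
      by (metis less_irrefl linorder_neqE_linordered_idom)
  qed (use r in auto)
  finally show "0 < x" "g_fun d x > real (d+1)"
    using g_fun_gt_after_root[OF d r] assms r by auto
qed

section \<open>Cycles in graphs\<close>

definition next_index :: "nat \<Rightarrow> nat \<Rightarrow> nat" where
  "next_index k i = (if Suc i = k then 0 else Suc i)"

definition cycle_edge :: "nat \<Rightarrow> (nat \<Rightarrow> nat) \<Rightarrow> nat \<Rightarrow> nat set" where
  "cycle_edge k \<phi> i = {\<phi> i, \<phi> (next_index k i)}"

definition cycle_edges :: "nat \<Rightarrow> (nat \<Rightarrow> nat) \<Rightarrow> nat set set" where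
  "cycle_edges k \<phi> = cycle_edge k \<phi> ` {..<k}"

text \<open>Cycles of length \<open>k\<close> with a starting point and a direction. For
  \<open>k \<ge> 3\<close> each cycle is represented \<open>2 * k\<close> times, a constant factor
  that cancels in the ratio of second moment to squared mean.\<close>

definition injections :: "nat \<Rightarrow> nat \<Rightarrow> (nat \<Rightarrow> nat) set" where
  "injections n k = {\<phi> \<in> {..<k} \<rightarrow>\<^sub>E {..<n}. inj_on \<phi> {..<k}}"

lemma next_index_less: "i < k \<Longrightarrow> next_index k i < k"
  by (auto simp: next_index_def)

lemma inj_on_next_index: "inj_on (next_index k) {..<k}"
  by (auto simp: inj_on_def next_index_def split: if_splits)

lemma finite_injections: "finite (injections n k)"
  unfolding injections_def by (rule finite_subset[of _ "{..<k} \<rightarrow>\<^sub>E {..<n}"]) (auto intro: finite_PiE)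

text \<open>Equal edges at different positions would make \<open>i\<close> and \<open>j\<close>
  successors of each other, which happens only for \<open>k = 2\<close>.\<close>

lemma inj_on_cycle_edge:
  assumes k: "k \<ge> 3" and inj: "inj_on \<phi> {..<k}"
  shows "inj_on (cycle_edge k \<phi>) {..<k}"
proof (rule inj_onI)
  fix i j assume ij: "i \<in> {..<k}" "j \<in> {..<k}" and eq: "cycle_edge k \<phi> i = cycle_edge k \<phi> j"
  have lt: "next_index k i < k" "next_index k j < k" using ij next_index_less by auto
  from eq consider "\<phi> i = \<phi> j" | "\<phi> i = \<phi> (next_index k j)" "\<phi> (next_index k i) = \<phi> j"
    unfolding cycle_edge_def doubleton_eq_iff by blast
  then show "i = j"
  proof cases
    case 1
    then show ?thesis using inj ij by (auto dest: inj_onD)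
  next
    case 2
    then have "i = next_index k j" "next_index k i = j"
      using inj ij lt by (auto dest: inj_onD)
    then show ?thesis using k ij by (auto simp: next_index_def split: if_splits)
  qed
qed

lemma card_cycle_edges: "k \<ge> 3 \<Longrightarrow> inj_on \<phi> {..<k} \<Longrightarrow> card (cycle_edges k \<phi>) = k"
  unfolding cycle_edges_def by (simp add: card_image inj_on_cycle_edge)

lemma Union_cycle_edges: "\<Union> (cycle_edges k \<phi>) = \<phi> ` {..<k}"
  using next_index_less by (auto simp: cycle_edges_def cycle_edge_def)

lemma cycle_edges_subset:
  assumes "k \<ge> 3" and "\<phi> \<in> injections n k"
  shows "cycle_edges k \<phi> \<subseteq> dfaces n 1"
proof
  fix e assume "e \<in> cycle_edges k \<phi>"
  then obtain i where i: "i < k" "e = {\<phi> i, \<phi> (next_index k i)}" by (auto simp: cycle_edges_def cycle_edge_def)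
  have "i \<noteq> next_index k i" using assms(1) by (auto simp: next_index_def)
  then have "\<phi> i \<noteq> \<phi> (next_index k i)"
    using assms(2) i next_index_less[OF i(1)] by (auto simp: injections_def dest: inj_onD)
  moreover have "\<phi> i < n" "\<phi> (next_index k i) < n"
    using assms(2) i next_index_less[OF i(1)] by (auto simp: injections_def PiE_iff)
  ultimately show "e \<in> dfaces n 1" using i by (auto simp: dfaces_def)
qed

text \<open>A cycle has as many edges as vertices, exactly what the dropped equation
  tolerates.\<close>

lemma ex_weighted_cycle_of_cycle:
  fixes w :: "nat \<Rightarrow> 'k::field"
  assumes "F \<subseteq> dfaces n 1" and "k \<ge> 3" and "\<phi> \<in> injections n k" and "cycle_edges k \<phi> \<subseteq> F"
  shows "\<exists>z. weighted_cycle n 1 F w z"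
proof (rule ex_weighted_cycle_graph[OF assms(1,4)])
  have inj: "inj_on \<phi> {..<k}" using assms(3) by (simp add: injections_def)
  show "cycle_edges k \<phi> \<noteq> {}" using assms(2) by (auto simp: cycle_edges_def lessThan_empty_iff)
  show "card (\<Union> (cycle_edges k \<phi>)) \<le> card (cycle_edges k \<phi>)"
    unfolding Union_cycle_edges card_cycle_edges[OF assms(2) inj] using card_image[OF inj] by simp
qed

section \<open>Counting pairs of cycles by their shared edges\<close>

lemma card_injections_ge: "(n - k) ^ k \<le> card (injections n k)"
proof (cases "k \<le> n")
  case True
  let ?L = "{xs. length xs = k \<and> distinct xs \<and> set xs \<subseteq> {..<n}}"
  let ?h = "\<lambda>xs :: nat list. restrict (nth xs) {..<k}"
  have "(n - k) ^ k = (\<Prod>i\<in>{n - k + 1..n}. n - k)" using True by simp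
  also have "\<dots> \<le> \<Prod>{n - k + 1..n}" by (rule prod_mono) auto
  also have "\<dots> = card ?L" using card_lists_distinct_length_eq[of "{..<n}" k] True by simp
  also have "\<dots> \<le> card (injections n k)"
  proof (rule card_inj_on_le[OF _ _ finite_injections])
    show "inj_on ?h ?L"
    proof (rule inj_onI)
      fix xs ys assume x: "xs \<in> ?L" and y: "ys \<in> ?L" and eq: "?h xs = ?h ys"
      have "xs ! i = ys ! i" if "i < k" for i
        using fun_cong[OF eq, of i] that by simp
      then show "xs = ys" using x y by (auto intro: nth_equalityI)
    qed
    show "?h ` ?L \<subseteq> injections n k"
    proof
      fix \<phi> assume "\<phi> \<in> ?h ` ?L"
      then obtain xs where xs: "length xs = k" "distinct xs" "set xs \<subseteq> {..<n}" "\<phi> = ?h xs" by auto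
      have "\<phi> i \<in> {..<n}" if "i < k" for i
      proof -
        have "xs ! i \<in> set xs" using nth_mem that xs(1) by blast
        then show ?thesis using xs(3,4) that by auto
      qed
      moreover have "inj_on \<phi> {..<k}"
        using xs nth_eq_iff_index_eq by (auto simp: inj_on_def)
      ultimately show "\<phi> \<in> injections n k" using xs(4) by (auto simp: injections_def PiE_iff)
    qed
  qed
  finally show ?thesis .
next
  case False
  then show ?thesis by (cases k) simp_all
qed

definition shared_edges :: "nat \<Rightarrow> (nat \<Rightarrow> nat) \<Rightarrow> (nat \<Rightarrow> nat) \<Rightarrow> nat set" where
  "shared_edges k \<phi> \<psi> = {i. i < k \<and> cycle_edge k \<psi> i \<in> cycle_edges k \<phi>}"

lemma card_cycle_edges_Un:
  assumes k: "k \<ge> 3" and inj: "inj_on \<phi> {..<k}" "inj_on \<psi> {..<k}"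
  shows "card (cycle_edges k \<phi> \<union> cycle_edges k \<psi>) = k + (k - card (shared_edges k \<phi> \<psi>))"
proof -
  have sub: "shared_edges k \<phi> \<psi> \<subseteq> {..<k}" by (auto simp: shared_edges_def)
  have eq: "cycle_edges k \<psi> - cycle_edges k \<phi> = cycle_edge k \<psi> ` ({..<k} - shared_edges k \<phi> \<psi>)"
    by (auto simp: cycle_edges_def shared_edges_def)
  have "card (cycle_edges k \<psi> - cycle_edges k \<phi>) = card ({..<k} - shared_edges k \<phi> \<psi>)"
    unfolding eq by (rule card_image) (rule inj_on_subset[OF inj_on_cycle_edge[OF k inj(2)]], auto)
  also have "\<dots> = k - card (shared_edges k \<phi> \<psi>)"
    using sub by (subst card_Diff_subset) (auto intro: finite_subset)
  finally have c: "card (cycle_edges k \<psi> - cycle_edges k \<phi>) = k - card (shared_edges k \<phi> \<psi>)" .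
  have "cycle_edges k \<phi> \<union> cycle_edges k \<psi> = cycle_edges k \<phi> \<union> (cycle_edges k \<psi> - cycle_edges k \<phi>)"
    by auto
  then have "card (cycle_edges k \<phi> \<union> cycle_edges k \<psi>) =
      card (cycle_edges k \<phi>) + card (cycle_edges k \<psi> - cycle_edges k \<phi>)"
    using card_Un_disjoint[of "cycle_edges k \<phi>" "cycle_edges k \<psi> - cycle_edges k \<phi>"]
    by (auto simp: cycle_edges_def)
  then show ?thesis using c card_cycle_edges[OF k inj(1)] by simp
qed

text \<open>A nonempty set of positions closed under the cyclic successor is everything. Hence a
  proper nonempty set of edges of a cycle, a union of paths, touches more vertices than it has
  edges; the surplus vertex is worth a factor \<open>1 / n\<close> in the second moment.\<close>

lemma card_next_index_closure:
  assumes J: "J \<subseteq> {..<k}" "J \<noteq> {}" "J \<noteq> {..<k}"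
  shows "card J < card (J \<union> next_index k ` J)"
proof (rule psubset_card_mono)
  have fJ: "finite J" using J finite_subset by blast
  then show "finite (J \<union> next_index k ` J)" by simp
  have "\<not> next_index k ` J \<subseteq> J"
  proof
    assume cl: "next_index k ` J \<subseteq> J"
    have up: "i + m \<in> J" if "i \<in> J" "i + m < k" for i m
      using that
    proof (induction m)
      case (Suc m)
      then have "next_index k (i + m) \<in> J" using cl by auto
      then show ?case using Suc.prems by (simp add: next_index_def split: if_splits)
    qed simp
    obtain i where i: "i \<in> J" using J by blast
    then have "i < k" using J by auto
    then have "i + (k - 1 - i) \<in> J" using up[OF i, of "k - 1 - i"] by simp
    then have "k - 1 \<in> J" using \<open>i < k\<close> by simp
    then have "next_index k (k - 1) \<in> J" using cl by blast
    then have "0 \<in> J" using \<open>i < k\<close> by (simp add: next_index_def)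
    then have "{..<k} \<subseteq> J" using up[of 0] by auto
    then show False using J by auto
  qed
  then show "J \<subset> J \<union> next_index k ` J" by blast
qed

text \<open>Endpoints of shared edges are sent to vertices of \<open>\<phi>\<close>, with
  \<open>k\<close> choices each. By the surplus vertex at most \<open>k - card J - 1\<close>
  positions remain, with \<open>n\<close> choices each.\<close>

lemma card_shared_eq_le:
  assumes n: "n \<ge> 1" and J: "J \<subseteq> {..<k}" "J \<noteq> {}" "J \<noteq> {..<k}" and \<phi>: "inj_on \<phi> {..<k}"
  shows "card {\<psi> \<in> injections n k. shared_edges k \<phi> \<psi> = J} \<le> k ^ k * n ^ (k - card J - 1)"
proof -
  let ?V = "J \<union> next_index k ` J"
  let ?T = "\<lambda>i. if i \<in> ?V then \<phi> ` {..<k} else {..<n}"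
  have fin: "finite (\<Pi>\<^sub>E i\<in>{..<k}. ?T i)" by (rule finite_PiE) auto
  have Vk: "?V \<subseteq> {..<k}" using J next_index_less by auto
  have sub: "{\<psi> \<in> injections n k. shared_edges k \<phi> \<psi> = J} \<subseteq> (\<Pi>\<^sub>E i\<in>{..<k}. ?T i)"
  proof
    fix \<psi> assume "\<psi> \<in> {\<psi> \<in> injections n k. shared_edges k \<phi> \<psi> = J}"
    then have \<psi>: "\<psi> \<in> {..<k} \<rightarrow>\<^sub>E {..<n}" and sh: "shared_edges k \<phi> \<psi> = J" by (auto simp: injections_def)
    have "{\<psi> i, \<psi> (next_index k i)} \<subseteq> \<phi> ` {..<k}" if "i \<in> J" for i
    proof -
      have "cycle_edge k \<psi> i \<in> cycle_edges k \<phi>" using that sh by (auto simp: shared_edges_def)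
      then have "cycle_edge k \<psi> i \<subseteq> \<Union> (cycle_edges k \<phi>)" by blast
      then show ?thesis unfolding Union_cycle_edges cycle_edge_def .
    qed
    then have "\<psi> v \<in> \<phi> ` {..<k}" if "v \<in> ?V" for v using that by blast
    then show "\<psi> \<in> (\<Pi>\<^sub>E i\<in>{..<k}. ?T i)"
      using \<psi> by (intro PiE_I) (auto simp: PiE_iff extensional_def)
  qed
  have "card {\<psi> \<in> injections n k. shared_edges k \<phi> \<psi> = J} \<le> card (\<Pi>\<^sub>E i\<in>{..<k}. ?T i)"
    by (rule card_mono[OF fin sub])
  also have "\<dots> = (\<Prod>i<k. if i \<in> ?V then k else n)"
    by (subst card_PiE) (auto simp: card_image[OF \<phi>] intro!: prod.cong)
  also have "\<dots> = (\<Prod>i\<in>{..<k} \<inter> ?V. k) * (\<Prod>i\<in>{..<k} - ?V. n)"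
    using prod.If_cases[of "{..<k}" "\<lambda>i. i \<in> ?V" "\<lambda>_. k" "\<lambda>_. n"]
    by (simp only: finite_lessThan Collect_mem_eq Diff_eq simp_thms)
  also have "\<dots> = k ^ card ?V * n ^ (k - card ?V)"
  proof -
    have "{..<k} \<inter> ?V = ?V" using Vk by blast
    moreover have "card ({..<k} - ?V) = k - card ?V"
      using Vk by (subst card_Diff_subset) (auto intro: finite_subset)
    ultimately show ?thesis by simp
  qed
  also have "\<dots> \<le> k ^ k * n ^ (k - card J - 1)"
  proof (rule mult_mono)
    have "k \<ge> 1" using J by (cases k) auto
    moreover have "card ?V \<le> k" using card_mono[OF _ Vk] by simp
    ultimately show "k ^ card ?V \<le> k ^ k" by (intro power_increasing) auto
    show "n ^ (k - card ?V) \<le> n ^ (k - card J - 1)"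
      using card_next_index_closure[OF J] n by (intro power_increasing) auto
  qed auto
  finally show ?thesis .
qed

lemma card_neighbours_le:
  assumes \<phi>: "inj_on \<phi> {..<k}"
  shows "card {u. {v, u} \<in> cycle_edges k \<phi>} \<le> 2" and "finite {u. {v, u} \<in> cycle_edges k \<phi>}"
proof -
  let ?A = "{u. \<exists>j<k. v = \<phi> j \<and> u = \<phi> (next_index k j)}"
  let ?B = "{u. \<exists>j<k. v = \<phi> (next_index k j) \<and> u = \<phi> j}"
  have sub: "{u. {v, u} \<in> cycle_edges k \<phi>} \<subseteq> ?A \<union> ?B"
    by (auto simp: cycle_edges_def cycle_edge_def doubleton_eq_iff)
  have A: "\<exists>x. ?A \<subseteq> {x}"
  proof (cases "\<exists>j<k. v = \<phi> j")
    case True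
    then obtain j where "j < k" "v = \<phi> j" by blast
    then have "?A \<subseteq> {\<phi> (next_index k j)}" using \<phi> by (auto dest: inj_onD)
    then show ?thesis by blast
  qed auto
  have B: "\<exists>x. ?B \<subseteq> {x}"
  proof (cases "\<exists>j<k. v = \<phi> (next_index k j)")
    case True
    then obtain j where j: "j < k" "v = \<phi> (next_index k j)" by blast
    have "i = j" if "i < k" "v = \<phi> (next_index k i)" for i
    proof -
      have "next_index k i = next_index k j"
        using \<phi> j that next_index_less by (auto dest: inj_onD)
      then show ?thesis using inj_on_next_index[of k] j that by (auto dest: inj_onD)
    qed
    then have "?B \<subseteq> {\<phi> j}" by auto
    then show ?thesis by blast
  qed auto
  obtain x where x: "?A \<subseteq> {x}" using A by blast
  obtain y where y: "?B \<subseteq> {y}" using B by blast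
  have xy: "{u. {v, u} \<in> cycle_edges k \<phi>} \<subseteq> {x, y}"
    using subset_trans[OF sub Un_mono[OF x y]] by (simp add: insert_commute)
  then show "finite {u. {v, u} \<in> cycle_edges k \<phi>}" by (rule finite_subset) simp
  have "card {u. {v, u} \<in> cycle_edges k \<phi>} \<le> card {x, y}" by (rule card_mono[OF _ xy]) simp
  also have "\<dots> \<le> 2" by (simp add: card_insert_if)
  finally show "card {u. {v, u} \<in> cycle_edges k \<phi>} \<le> 2" .
qed

text \<open>A traversal of the edges of \<open>\<phi>\<close> is determined by its first two
  vertices: each vertex has at most two neighbours, and the next one differs from the previous one.
  Both initial vertices lie on \<open>\<phi>\<close>, whence \<open>k ^ 2\<close>.\<close>

lemma card_shared_all_le:
  assumes k: "k \<ge> 3" and \<phi>: "inj_on \<phi> {..<k}"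
  shows "card {\<psi> \<in> injections n k. shared_edges k \<phi> \<psi> = {..<k}} \<le> k ^ 2"
proof -
  let ?P = "{\<psi> \<in> injections n k. shared_edges k \<phi> \<psi> = {..<k}}"
  let ?X = "\<phi> ` {..<k}"
  have edge: "cycle_edge k \<psi> i \<in> cycle_edges k \<phi>" if "\<psi> \<in> ?P" "i < k" for \<psi> i
    using that by (auto simp: shared_edges_def)
  have "card ?P \<le> card (?X \<times> ?X)"
  proof (rule card_inj_on_le[where f = "\<lambda>\<psi>. (\<psi> 0, \<psi> 1)"])
    show "inj_on (\<lambda>\<psi>. (\<psi> 0, \<psi> 1)) ?P"
    proof (rule inj_onI)
      fix \<psi> \<chi> assume \<psi>: "\<psi> \<in> ?P" and \<chi>: "\<chi> \<in> ?P" and eq: "(\<psi> 0, \<psi> 1) = (\<chi> 0, \<chi> 1)"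
      have inj: "inj_on \<psi> {..<k}" "inj_on \<chi> {..<k}" using \<psi> \<chi> by (auto simp: injections_def)
      have step: "\<psi> (Suc (Suc i)) = \<chi> (Suc (Suc i))"
        if i: "Suc (Suc i) < k" and e: "\<psi> i = \<chi> i" "\<psi> (Suc i) = \<chi> (Suc i)" for i
      proof (rule ccontr)
        assume ne: "\<psi> (Suc (Suc i)) \<noteq> \<chi> (Suc (Suc i))"
        let ?N = "{u. {\<psi> (Suc i), u} \<in> cycle_edges k \<phi>}"
        have nx: "next_index k i = Suc i" "next_index k (Suc i) = Suc (Suc i)"
          using i by (auto simp: next_index_def)
        have "\<psi> i \<in> ?N" using edge[OF \<psi>, of i] i nx by (simp add: cycle_edge_def insert_commute)
        moreover have "\<psi> (Suc (Suc i)) \<in> ?N" using edge[OF \<psi>, of "Suc i"] i nx by (simp add: cycle_edge_def)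
        moreover have "\<chi> (Suc (Suc i)) \<in> ?N" using edge[OF \<chi>, of "Suc i"] i nx e by (simp add: cycle_edge_def)
        ultimately have "{\<psi> i, \<psi> (Suc (Suc i)), \<chi> (Suc (Suc i))} \<subseteq> ?N" by blast
        then have "card {\<psi> i, \<psi> (Suc (Suc i)), \<chi> (Suc (Suc i))} \<le> card ?N"
          by (rule card_mono[OF card_neighbours_le(2)[OF \<phi>]])
        also have "\<dots> \<le> 2" by (rule card_neighbours_le(1)[OF \<phi>])
        finally have "card {\<psi> i, \<psi> (Suc (Suc i)), \<chi> (Suc (Suc i))} \<le> 2" .
        moreover have "\<psi> i \<noteq> \<psi> (Suc (Suc i))" using inj_onD[OF inj(1), of i "Suc (Suc i)"] i by auto
        moreover have "\<chi> i \<noteq> \<chi> (Suc (Suc i))" using inj_onD[OF inj(2), of i "Suc (Suc i)"] i by auto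
        ultimately show False using ne e by simp
      qed
      \<comment> \<open>Two consecutive vertices are carried along, since the next one depends on
        both.\<close>
      have both: "Suc i < k \<longrightarrow> \<psi> i = \<chi> i \<and> \<psi> (Suc i) = \<chi> (Suc i)" for i
        by (induction i) (use eq step in auto)
      show "\<psi> = \<chi>"
      proof
        fix i
        show "\<psi> i = \<chi> i"
        proof (cases "i < k")
          case True
          show ?thesis
          proof (cases i)
            case 0
            then show ?thesis using eq by simp
          next
            case (Suc j)
            then show ?thesis using both[of j] True by simp
          qed
        next
          case False
          then show ?thesis using \<psi> \<chi> by (auto simp: injections_def PiE_iff extensional_def)
        qed
      qed
    qed
    show "(\<lambda>\<psi>. (\<psi> 0, \<psi> 1)) ` ?P \<subseteq> ?X \<times> ?X"
    proof
      fix q assume "q \<in> (\<lambda>\<psi>. (\<psi> 0, \<psi> 1)) ` ?P"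
      then obtain \<psi> where \<psi>: "\<psi> \<in> ?P" "q = (\<psi> 0, \<psi> 1)" by blast
      have "cycle_edge k \<psi> 0 \<subseteq> \<Union> (cycle_edges k \<phi>)" using edge[OF \<psi>(1), of 0] k by auto
      then show "q \<in> ?X \<times> ?X"
        using \<psi>(2) k unfolding Union_cycle_edges by (auto simp: cycle_edge_def next_index_def split: if_splits)
    qed
  qed auto
  also have "\<dots> = k ^ 2" using card_image[OF \<phi>] by (simp add: card_cartesian_product power2_eq_square)
  finally show ?thesis .
qed

section \<open>The random complex\<close>

definition cycle_count :: "nat \<Rightarrow> nat \<Rightarrow> nat set set \<Rightarrow> real" where
  "cycle_count n k F = (\<Sum>\<phi>\<in>injections n k. of_bool (cycle_edges k \<phi> \<subseteq> F))"

lemma expct_cycle_count: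
  assumes k: "k \<ge> 3"
  shows "expct p (dfaces n 1) (cycle_count n k) = real (card (injections n k)) * p ^ k"
proof -
  have "expct p (dfaces n 1) (cycle_count n k) = (\<Sum>\<phi>\<in>injections n k. p ^ k)"
    unfolding cycle_count_def expct_sum
  proof (rule sum.cong[OF refl])
    fix \<phi> assume \<phi>: "\<phi> \<in> injections n k"
    then have "inj_on \<phi> {..<k}" by (simp add: injections_def)
    then show "expct p (dfaces n 1) (\<lambda>F. of_bool (cycle_edges k \<phi> \<subseteq> F)) = p ^ k"
      using expct_superset[OF finite_dfaces cycle_edges_subset[OF k \<phi>]] card_cycle_edges[OF k] by simp
  qed
  then show ?thesis by simp
qed

text \<open>Sorted by the set \<open>J\<close> of shared positions: the empty set gives the
  edge-disjoint pairs and at most \<open>c ^ k\<close>, the full set at most \<open>k ^ 2\<close>,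
  and each of the fewer than \<open>2 ^ k\<close> others a term of order
  \<open>1 / n\<close>.\<close>

lemma sum_shared_le:
  assumes k: "k \<ge> 3" and n: "n \<ge> 1" and \<phi>: "inj_on \<phi> {..<k}" and c: "c \<ge> 1"
  shows "(\<Sum>\<psi>\<in>injections n k. (c / real n) ^ (k - card (shared_edges k \<phi> \<psi>)))
     \<le> c ^ k + real (k ^ 2) + 2 ^ k * (real (k ^ k) * c ^ k) / real n"
proof -
  let ?N = "\<lambda>J. {\<psi> \<in> injections n k. shared_edges k \<phi> \<psi> = J}"
  let ?t = "\<lambda>J. real (card (?N J)) * (c / real n) ^ (k - card J)"
  let ?K = "{..<k}"
  have fin: "finite (Pow ?K)" by simp
  have "(\<Sum>\<psi>\<in>injections n k. (c / real n) ^ (k - card (shared_edges k \<phi> \<psi>)))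
      = (\<Sum>J\<in>Pow ?K. \<Sum>\<psi>\<in>?N J. (c / real n) ^ (k - card (shared_edges k \<phi> \<psi>)))"
    by (rule sum.group[symmetric]) (auto simp: finite_injections shared_edges_def)
  also have "\<dots> = (\<Sum>J\<in>Pow ?K. ?t J)"
    by (rule sum.cong) auto
  also have "\<dots> = ?t {} + (?t ?K + (\<Sum>J\<in>Pow ?K - {{}} - {?K}. ?t J))"
  proof -
    have "0 \<in> ?K" using k by simp
    then have 0: "{} \<in> Pow ?K" and 1: "?K \<in> Pow ?K - {{}}" by blast+
    have "finite (Pow ?K - {{}})" using fin by blast
    then show ?thesis by (simp only: sum.remove[OF fin 0] sum.remove[OF _ 1])
  qed
  also have "\<dots> \<le> c ^ k + (real (k ^ 2) + (\<Sum>J\<in>Pow ?K - {{}} - {?K}. real (k ^ k) * c ^ k / real n))"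
  proof (intro add_mono sum_mono)
    have "card (?N {}) \<le> card (?K \<rightarrow>\<^sub>E {..<n})"
      by (rule card_mono) (auto simp: injections_def intro: finite_PiE)
    also have "\<dots> = n ^ k" by (simp add: card_PiE)
    finally have "real (card (?N {})) \<le> real n ^ k" by (metis of_nat_le_iff of_nat_power)
    then have "?t {} \<le> real n ^ k * (c / real n) ^ k"
      unfolding card.empty diff_zero using c n by (intro mult_right_mono) auto
    also have "\<dots> = c ^ k" using n by (simp add: power_divide)
    finally show "?t {} \<le> c ^ k" .
  next
    show "?t ?K \<le> real (k ^ 2)" using card_shared_all_le[OF k \<phi>, of n] by simp
  next
    fix J assume J: "J \<in> Pow ?K - {{}} - {?K}"
    then have J': "J \<subseteq> ?K" "J \<noteq> {}" "J \<noteq> ?K" by auto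
    define j where "j = k - card J - 1"
    have "card J < k" using psubset_card_mono[of ?K J] J' by auto
    then have j: "k - card J = Suc j" by (simp add: j_def)
    have "real (card (?N J)) \<le> real (k ^ k * n ^ j)"
      unfolding j_def of_nat_le_iff by (rule card_shared_eq_le[OF n J' \<phi>])
    then have "?t J \<le> real (k ^ k * n ^ j) * (c / real n) ^ Suc j"
      unfolding j using c by (intro mult_right_mono) auto
    \<comment> \<open>\<open>n ^ j\<close> choices meet \<open>Suc j\<close> factors
      \<open>1 / n\<close>: here the surplus vertex pays off.\<close>
    also have "\<dots> = real (k ^ k) * c ^ Suc j / real n"
      using n by (simp add: power_divide)
    also have "\<dots> \<le> real (k ^ k) * c ^ k / real n"
      using c j by (intro divide_right_mono mult_left_mono power_increasing) auto
    finally show "?t J \<le> real (k ^ k) * c ^ k / real n" .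
  qed
  also have "\<dots> = c ^ k + (real (k ^ 2) + real (card (Pow ?K - {{}} - {?K})) * (real (k ^ k) * c ^ k / real n))"
    by simp
  also have "\<dots> \<le> c ^ k + (real (k ^ 2) + 2 ^ k * (real (k ^ k) * c ^ k / real n))"
  proof -
    have "card (Pow ?K - {{}} - {?K}) \<le> card (Pow ?K)" by (rule card_mono) auto
    then have "card (Pow ?K - {{}} - {?K}) \<le> 2 ^ k" by (simp add: card_Pow)
    then have "real (card (Pow ?K - {{}} - {?K})) \<le> 2 ^ k"
      by (metis of_nat_le_iff of_nat_numeral of_nat_power)
    then show ?thesis using c by (intro add_left_mono mult_right_mono) auto
  qed
  finally show ?thesis by simp
qed

text \<open>A pair of cycles is present with probability \<open>p\<close> to the number of edges in
  the union, so the second moment is at most \<open>\<mu> * D\<close>. Chebyshev leaves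
  \<open>D / \<mu> - 1\<close>, and \<open>card_injections_ge\<close> bounds \<open>\<mu>\<close>
  from below.\<close>

lemma expct_no_cycle_le:
  assumes k: "k \<ge> 3" and n: "n > k" and c: "1 \<le> c" "c \<le> real n"
  shows "expct (c / real n) (dfaces n 1) (\<lambda>F. of_bool (cycle_count n k F \<le> 0)) \<le>
    (c ^ k + real (k ^ 2) + 2 ^ k * (real (k ^ k) * c ^ k) / real n) / (real (n - k) * (c / real n)) ^ k - 1"
proof -
  define p where "p = c / real n"
  define D where "D = c ^ k + real (k ^ 2) + 2 ^ k * (real (k ^ k) * c ^ k) / real n"
  define \<mu> where "\<mu> = expct p (dfaces n 1) (cycle_count n k)"
  have p: "0 < p" "p \<le> 1" using n c by (auto simp: p_def)
  have D: "0 < D" using c unfolding D_def by (intro add_pos_nonneg) auto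
  have \<mu>_eq: "\<mu> = real (card (injections n k)) * p ^ k"
    unfolding \<mu>_def by (rule expct_cycle_count[OF k])
  have lower: "(real (n - k) * p) ^ k \<le> \<mu>"
  proof -
    have "real (n - k) ^ k \<le> real (card (injections n k))"
      using card_injections_ge[of n k] by (metis of_nat_le_iff of_nat_power)
    then show ?thesis unfolding \<mu>_eq power_mult_distrib using p by (intro mult_right_mono) auto
  qed
  have pos0: "0 < (real (n - k) * p) ^ k" using n p by simp
  then have pos: "0 < \<mu>" using lower by linarith
  have "expct p (dfaces n 1) (\<lambda>F. (cycle_count n k F)\<^sup>2) =
      (\<Sum>\<phi>\<in>injections n k. \<Sum>\<psi>\<in>injections n k.
        expct p (dfaces n 1) (\<lambda>F. of_bool (cycle_edges k \<phi> \<union> cycle_edges k \<psi> \<subseteq> F)))"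
  proof -
    have "(cycle_count n k F)\<^sup>2 = (\<Sum>\<phi>\<in>injections n k. \<Sum>\<psi>\<in>injections n k.
        of_bool (cycle_edges k \<phi> \<union> cycle_edges k \<psi> \<subseteq> F))" for F
      unfolding cycle_count_def power2_eq_square sum_product by (intro sum.cong refl) auto
    then show ?thesis by (simp only: expct_sum)
  qed
  also have "\<dots> = (\<Sum>\<phi>\<in>injections n k. \<Sum>\<psi>\<in>injections n k. p ^ k * p ^ (k - card (shared_edges k \<phi> \<psi>)))"
  proof (intro sum.cong refl)
    fix \<phi> \<psi> assume *: "\<phi> \<in> injections n k" "\<psi> \<in> injections n k"
    then have "inj_on \<phi> {..<k}" "inj_on \<psi> {..<k}" by (auto simp: injections_def)
    then show "expct p (dfaces n 1) (\<lambda>F. of_bool (cycle_edges k \<phi> \<union> cycle_edges k \<psi> \<subseteq> F)) =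
        p ^ k * p ^ (k - card (shared_edges k \<phi> \<psi>))"
      using expct_superset[OF finite_dfaces, of "cycle_edges k \<phi> \<union> cycle_edges k \<psi>" n 1 p]
        cycle_edges_subset[OF k *(1)] cycle_edges_subset[OF k *(2)]
      by (simp only: Un_least card_cycle_edges_Un[OF k] power_add)
  qed
  also have "\<dots> \<le> (\<Sum>\<phi>\<in>injections n k. p ^ k * D)"
  proof (rule sum_mono)
    fix \<phi> assume "\<phi> \<in> injections n k"
    then have \<phi>: "inj_on \<phi> {..<k}" by (simp add: injections_def)
    have "(\<Sum>\<psi>\<in>injections n k. p ^ (k - card (shared_edges k \<phi> \<psi>))) \<le> D"
      unfolding p_def D_def by (rule sum_shared_le[OF k _ \<phi> c(1)]) (use n in simp)
    then show "(\<Sum>\<psi>\<in>injections n k. p ^ k * p ^ (k - card (shared_edges k \<phi> \<psi>))) \<le> p ^ k * D"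
      unfolding sum_distrib_left[symmetric] using p by (intro mult_left_mono) auto
  qed
  also have "\<dots> = \<mu> * D" by (simp add: \<mu>_eq)
  finally have second: "expct p (dfaces n 1) (\<lambda>F. (cycle_count n k F)\<^sup>2) \<le> \<mu> * D" .
  have "expct p (dfaces n 1) (\<lambda>F. of_bool (cycle_count n k F \<le> 0)) \<le>
      (expct p (dfaces n 1) (\<lambda>F. (cycle_count n k F)\<^sup>2) - \<mu>\<^sup>2) / \<mu>\<^sup>2"
    unfolding \<mu>_def by (rule expct_nonpos_le[OF finite_dfaces]) (use p pos in \<open>auto simp: \<mu>_def\<close>)
  also have "\<dots> \<le> (\<mu> * D - \<mu>\<^sup>2) / \<mu>\<^sup>2"
    using second by (intro divide_right_mono) auto
  also have "\<dots> = D / \<mu> - 1" using pos by (simp add: power2_eq_square diff_divide_distrib)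
  also have "\<dots> \<le> D / (real (n - k) * p) ^ k - 1"
    using lower pos0 pos D by (intro diff_right_mono divide_left_mono) auto
  finally show ?thesis unfolding D_def p_def .
qed

text \<open>The length is quantified inside the event, so the bounds for all \<open>k\<close> speak
  about the same event and \<open>k\<close> may be chosen after the target accuracy.\<close>

definition has_cycle :: "nat \<Rightarrow> nat set set \<Rightarrow> bool" where
  "has_cycle n F \<longleftrightarrow> (\<exists>k\<ge>3. \<exists>\<phi>\<in>injections n k. cycle_edges k \<phi> \<subseteq> F)"

lemma eventually_le_real: "\<forall>\<^sub>F n in sequentially. c \<le> real n"
  using filterlim_real_sequentially unfolding filterlim_at_top by blast

lemma expct_of_bool_mono:
  assumes "0 \<le> p" "p \<le> 1" and "\<And>F. F \<subseteq> S \<Longrightarrow> P F \<Longrightarrow> Q F"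
  shows "expct p S (\<lambda>F. of_bool (P F)) \<le> expct p S (\<lambda>F. of_bool (Q F))"
  by (rule expct_mono[OF assms(1,2)]) (use assms(3) in auto)

lemma expct_acyclic_tendsto_0:
  assumes c: "c > 1"
  shows "(\<lambda>n. expct (c / real n) (dfaces n 1) (\<lambda>F. of_bool (\<not> has_cycle n F))) \<longlonglongrightarrow> 0"
proof (rule LIMSEQ_I)
  fix r :: real assume r: "r > 0"
  have "(\<lambda>k. real k ^ 2 * (1 / c) ^ k) \<longlonglongrightarrow> 0"
  proof -
    \<comment> \<open>\<open>k\<^sup>2 / c ^ k\<close> is the square of \<open>k * s ^ k\<close>, a
      null sequence since \<open>s < 1\<close>.\<close>
    define s where "s = sqrt (1 / c)"
    have s: "norm s < 1" "s\<^sup>2 = 1 / c" using c by (auto simp: s_def)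
    have "(\<lambda>k. (real k * s ^ k)\<^sup>2) \<longlonglongrightarrow> 0\<^sup>2"
      by (intro tendsto_power powser_times_n_limit_0 s(1))
    moreover have "(real k * s ^ k)\<^sup>2 = real k ^ 2 * (1 / c) ^ k" for k
    proof -
      have "(s ^ k)\<^sup>2 = (s\<^sup>2) ^ k" by (metis power_mult mult.commute)
      then show ?thesis by (simp only: power_mult_distrib s(2))
    qed
    ultimately show ?thesis by simp
  qed
  then have "\<forall>\<^sub>F k in sequentially. real k ^ 2 * (1 / c) ^ k < r"
    using order_tendstoD(2) r by blast
  then have "\<forall>\<^sub>F k in sequentially. 3 \<le> k \<and> real k ^ 2 * (1 / c) ^ k < r"
    using eventually_ge_at_top[of 3] by eventually_elim auto
  then obtain k where k: "3 \<le> k" "real k ^ 2 * (1 / c) ^ k < r"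
    using eventually_happens'[OF sequentially_bot] by blast
  let ?b = "\<lambda>n. (c ^ k + real (k ^ 2) + 2 ^ k * (real (k ^ k) * c ^ k) / real n)
      / (real (n - k) * (c / real n)) ^ k - 1"
  have "?b \<longlonglongrightarrow> (c ^ k + real (k ^ 2) + 0) / c ^ k - 1"
    using c by (intro tendsto_intros diff_mult_div_tendsto
        tendsto_divide_0[OF tendsto_const filterlim_at_top_imp_at_infinity[OF filterlim_real_sequentially]]) auto
  also have "(c ^ k + real (k ^ 2) + 0) / c ^ k - 1 = real k ^ 2 * (1 / c) ^ k"
    using c by (simp add: field_simps power_divide)
  finally have "\<forall>\<^sub>F n in sequentially. ?b n < r" using order_tendstoD(2) k(2) by blast
  then have "\<forall>\<^sub>F n in sequentially.
      norm (expct (c / real n) (dfaces n 1) (\<lambda>F. of_bool (\<not> has_cycle n F)) - 0) < r"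
    using eventually_gt_at_top[of k] eventually_le_real[of c]
  proof eventually_elim
    fix n assume b: "?b n < r" and n: "k < n" "c \<le> real n"
    have p: "0 \<le> c / real n" "c / real n \<le> 1" using c n by auto
    let ?E = "expct (c / real n) (dfaces n 1)"
    have "?E (\<lambda>F. of_bool (\<not> has_cycle n F)) \<le> ?E (\<lambda>F. of_bool (cycle_count n k F \<le> 0))"
    proof (rule expct_of_bool_mono[OF p])
      fix F assume "\<not> has_cycle n F"
      then show "cycle_count n k F \<le> 0" using k(1) by (auto simp: has_cycle_def cycle_count_def)
    qed
    also have "\<dots> \<le> ?b n" by (rule expct_no_cycle_le[OF k(1) n(1)]) (use c n in auto)
    finally have "?E (\<lambda>F. of_bool (\<not> has_cycle n F)) < r" using b by linarith
    moreover have "?E (\<lambda>_. 0) \<le> ?E (\<lambda>F. of_bool (\<not> has_cycle n F))"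
      by (rule expct_mono[OF p]) simp
    then have "0 \<le> ?E (\<lambda>F. of_bool (\<not> has_cycle n F))" by (simp add: expct_const[OF finite_dfaces])
    ultimately show "norm (?E (\<lambda>F. of_bool (\<not> has_cycle n F)) - 0) < r" by simp
  qed
  then show "\<exists>no. \<forall>n\<ge>no. norm (expct (c / real n) (dfaces n 1) (\<lambda>F. of_bool (\<not> has_cycle n F)) - 0) < r"
    by (simp add: eventually_sequentially)
qed

text \<open>The exceptional event \<open>Q\<close> mentions neither the field nor the weights, so no
  union over linear forms is taken: it is acyclicity for \<open>d = 1\<close> and nonpositive excess
  for \<open>d \<ge> 2\<close>.\<close>

lemma expct_no_weighted_cycle_tendsto_0:
  assumes d: "d \<ge> 1" and c: "c_const d < c"
  shows "(\<lambda>n. expct (c / real n) (dfaces n d)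
     (\<lambda>F. of_bool (\<not> (\<forall>w :: nat \<Rightarrow> 'k::field. \<exists>z. weighted_cycle n d F w z)))) \<longlonglongrightarrow> 0"
proof -
  let ?E = "\<lambda>n. expct (c / real n) (dfaces n d)"
  let ?bad = "\<lambda>n F. of_bool (\<not> (\<forall>w :: nat \<Rightarrow> 'k. \<exists>z. weighted_cycle n d F w z))"
  have c0: "c > 0" using g_fun_gt(1)[of d c] d c by (cases "d = 1") (auto simp: c_const_def)
  have p: "0 \<le> c / real n \<and> c / real n \<le> 1" if "c \<le> real n" for n
    using that c0 by (simp add: divide_le_eq_1)
  obtain Q where Q: "(\<lambda>n. ?E n (\<lambda>F. of_bool (Q n F))) \<longlonglongrightarrow> 0"
    and imp: "\<And>n F. F \<subseteq> dfaces n d \<Longrightarrow> \<not> Q n F \<Longrightarrow> \<forall>w :: nat \<Rightarrow> 'k. \<exists>z. weighted_cycle n d F w z"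
  proof (cases "d = 1")
    case True
    show ?thesis
    proof (rule that[of "\<lambda>n F. \<not> has_cycle n F"])
      show "(\<lambda>n. ?E n (\<lambda>F. of_bool (\<not> has_cycle n F))) \<longlonglongrightarrow> 0"
        using expct_acyclic_tendsto_0 c True by (simp add: c_const_def)
    next
      fix n F assume "F \<subseteq> dfaces n d" "\<not> \<not> has_cycle n F"
      then show "\<forall>w :: nat \<Rightarrow> 'k. \<exists>z. weighted_cycle n d F w z"
        using ex_weighted_cycle_of_cycle True unfolding has_cycle_def by blast
    qed
  next
    case False
    then have g: "g_fun d c > real (d + 1)" using g_fun_gt(2)[of d c] d c by simp
    show ?thesis
    proof (rule that[of "\<lambda>n F. excess n d F \<le> 0"])
      show "(\<lambda>n. ?E n (\<lambda>F. of_bool (excess n d F \<le> 0))) \<longlonglongrightarrow> 0"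
      proof (rule expct_nonpos_tendsto_0[OF d _ _ expct_excess_tendsto])
        show "0 < (g_fun d c - real (d + 1)) / real (d + 1)" using g by simp
      qed (use c0 excess_insert in auto)
    next
      fix n F assume F: "F \<subseteq> dfaces n d" and "\<not> excess n d F \<le> 0"
      then have "card (heavy_ridges n d F) < card (core_faces d F)" by (simp add: excess_def)
      then show "\<forall>w :: nat \<Rightarrow> 'k. \<exists>z. weighted_cycle n d F w z"
        by (intro allI ex_weighted_cycle_core[OF F])
    qed
  qed
  show ?thesis
  proof (rule tendsto_sandwich[OF _ _ tendsto_const Q])
    show "\<forall>\<^sub>F n in sequentially. 0 \<le> ?E n (?bad n)"
      using eventually_le_real[of c]
    proof eventually_elim
      fix n assume "c \<le> real n"
      then have "?E n (\<lambda>_. 0) \<le> ?E n (?bad n)" by (intro expct_mono) (use p in auto)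
      then show "0 \<le> ?E n (?bad n)" by (simp add: expct_const[OF finite_dfaces])
    qed
    show "\<forall>\<^sub>F n in sequentially. ?E n (?bad n) \<le> ?E n (\<lambda>F. of_bool (Q n F))"
      using eventually_le_real[of c]
    proof eventually_elim
      fix n assume "c \<le> real n"
      then have "0 \<le> c / real n" "c / real n \<le> 1" using p by blast+
      then show "?E n (?bad n) \<le> ?E n (\<lambda>F. of_bool (Q n F))"
        by (rule expct_of_bool_mono) (use imp in blast)
    qed
  qed
qed

theorem theorem7p4:
  fixes d :: nat and c :: real
  assumes "d \<ge> 1" and "c_const d < c" and "c < real (d+1)"
  shows "(\<lambda>n. Yprob n d (c / real n) (\<lambda>F. \<not> has_WLP TYPE('k::field) n d F))
           \<longlonglongrightarrow> 1"
proof -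
  let ?E = "\<lambda>n. expct (c / real n) (dfaces n d)"
  let ?cyc = "\<lambda>n F. \<forall>w :: nat \<Rightarrow> 'k. \<exists>z. weighted_cycle n d F w z"
  let ?Q = "\<lambda>n F. \<not> has_WLP TYPE('k) n d F"
  have c0: "c > 0" using g_fun_gt(1)[of d c] assms by (cases "d = 1") (auto simp: c_const_def)
  have Y: "Yprob n d (c / real n) (?Q n) = ?E n (\<lambda>F. of_bool (?Q n F))" for n
    unfolding Yprob_def expct_def by (rule sum.cong) auto
  have iso: "(\<lambda>n. ?E n (\<lambda>F. of_bool (isolated_count n d F \<le> 0))) \<longlonglongrightarrow> 0"
    by (rule expct_nonpos_tendsto_0[OF assms(1) _ _ expct_isolated_count_tendsto])
      (use c0 isolated_count_insert in auto)
  have cyc: "(\<lambda>n. ?E n (\<lambda>F. of_bool (\<not> ?cyc n F))) \<longlonglongrightarrow> 0"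
    by (rule expct_no_weighted_cycle_tendsto_0[OF assms(1,2)])
  have fails: "?Q n F" if F: "F \<subseteq> dfaces n d" and "\<not> isolated_count n d F \<le> 0" and "?cyc n F" for n F
  proof -
    have "{\<tau> \<in> ridges n d. degree_in F \<tau> = 0} \<noteq> {}"
      using that(2) by (simp add: isolated_count_def card_gt_0_iff del: Collect_empty_eq)
    then obtain \<tau> where \<tau>: "\<tau> \<subseteq> {..<n}" "card \<tau> = d" "degree_in F \<tau> = 0" by (auto simp: ridges_def)
    have "finite F" using F finite_dfaces finite_subset by blast
    then have "{\<sigma>\<in>F. \<tau> \<subseteq> \<sigma>} = {}" using \<tau>(3) by (simp add: degree_in_def)
    then show ?thesis using not_has_WLP[OF F \<tau>(1,2)] that(3) by blast
  qed
  have "\<forall>\<^sub>F n in sequentially. 1 - (?E n (\<lambda>F. of_bool (isolated_count n d F \<le> 0)) +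
      ?E n (\<lambda>F. of_bool (\<not> ?cyc n F))) \<le> Yprob n d (c / real n) (?Q n)"
    using eventually_le_real[of c]
  proof eventually_elim
    fix n assume "c \<le> real n"
    then have p: "0 \<le> c / real n" "c / real n \<le> 1" using c0 by (auto simp: divide_le_eq_1)
    \<comment> \<open>The union bound in pointwise form: outside the two exceptional events the
      property fails.\<close>
    have "?E n (\<lambda>F. 1 - (of_bool (isolated_count n d F \<le> 0) + of_bool (\<not> ?cyc n F))) \<le>
        ?E n (\<lambda>F. of_bool (?Q n F))"
    proof (rule expct_mono[OF p])
      fix F assume "F \<subseteq> dfaces n d"
      then show "1 - (of_bool (isolated_count n d F \<le> 0) + of_bool (\<not> ?cyc n F)) \<le> (of_bool (?Q n F) :: real)"
        using fails[of F n] by (cases "isolated_count n d F \<le> 0"; cases "?cyc n F") simp_all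
    qed
    then show "1 - (?E n (\<lambda>F. of_bool (isolated_count n d F \<le> 0)) +
      ?E n (\<lambda>F. of_bool (\<not> ?cyc n F))) \<le> Yprob n d (c / real n) (?Q n)"
      unfolding Y by (simp only: expct_diff expct_add expct_const[OF finite_dfaces])
  qed
  moreover have "\<forall>\<^sub>F n in sequentially. Yprob n d (c / real n) (?Q n) \<le> 1"
    using eventually_le_real[of c]
  proof eventually_elim
    fix n assume "c \<le> real n"
    then have p: "0 \<le> c / real n" "c / real n \<le> 1" using c0 by (auto simp: divide_le_eq_1)
    have "?E n (\<lambda>F. of_bool (?Q n F)) \<le> ?E n (\<lambda>_. 1)" by (rule expct_mono[OF p]) simp
    then show "Yprob n d (c / real n) (?Q n) \<le> 1" unfolding Y by (simp add: expct_const[OF finite_dfaces])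
  qed
  moreover have "(\<lambda>n. 1 - (?E n (\<lambda>F. of_bool (isolated_count n d F \<le> 0)) +
      ?E n (\<lambda>F. of_bool (\<not> ?cyc n F)))) \<longlonglongrightarrow> 1 - (0 + 0)"
    by (intro tendsto_intros iso cyc)
  ultimately show ?thesis
    using tendsto_sandwich[of _ "\<lambda>n. Yprob n d (c / real n) (?Q n)" sequentially "\<lambda>_. 1" 1] by simp
qed

end
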